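(* Let $K_4$ be the complete graph on four vertices. Then $$\Lambda_1(K_4) = 16 \pi^2 .$$
   Context: A metric on a finite connected graph $G$ with edge set $E \neq \emptyset$ is a function $\ell : E \to (0,\infty)$; the pair $(G,\ell)$ is a finite metric graph, in which each edge $e$ is identified with an interval in $\mathbb{R}$ of length $\ell(e)$. Its length is $L(G,\ell)=\sum_{e\in E}\ell(e)$. The (Neumann) eigenvalues of $(G,\ell)$ are the numbers $\lambda$ for which there is a nonzero continuous function $f$ on $G$ with $-f''=\lambda f$ on each edge and $\sum_{e\sim v} f'(v)=0$ at each vertex $v$, where the sum is over edges incident to $v$ and derivatives are taken in the direction away from $v$ into the edge. Counted with multiplicity they are indexed as $0=\lambda_0(G,\ell)<\lambda_1(G,\ell)\le\lambda_2(G,\ell)\le\dots$. Equivalently, $\lambda_j(G,\ell)=\min_W\max_{0\ne f\in W}\frac{\int_G|f'|^2}{\int_G|f|^2}$, the minimum over all $(j+1)$-dimensional subspaces $W$ of $H^1(G,\ell)$, the space of continuous functions $f:G\to\mathbb{R}$ that are in $H^1$ over each edge. $\Lambda_1(G)$ is the smallest number such that $\lambda_1(G,\ell)\le \Lambda_1(G)/L(G,\ell)^2$ for all metrics $\ell$ on $G$. *)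

theory Defs
  imports
    "HOL-Analysis.Analysis"
    "HOL-Library.Function_Algebras"
    "Graph_Theory.Graph_Theory"
begin

text \<open>
  A finite graph (possibly with loops and parallel edges) is represented by a
  \<^typ>\<open>('a, 'b) pre_digraph\<close> in which each edge occurs as exactly one arc.  The direction of the
  arc \<^term>\<open>e\<close> only fixes the identification of the edge with the interval \<open>[0, l e]\<close>: the tail
  is at \<^term>\<open>0::real\<close>, the head is at \<open>l e\<close>.  Reversing an arc amounts to
  substituting \<open>l e - t\<close> for \<open>t\<close>, so lengths and eigenvalues do not depend on the directions.
\<close>

definition is_metric :: "('a, 'b) pre_digraph \<Rightarrow> ('b \<Rightarrow> real) \<Rightarrow> bool" where
  "is_metric G l \<longleftrightarrow> (\<forall>e\<in>arcs G. 0 < l e)"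

definition total_length :: "('a, 'b) pre_digraph \<Rightarrow> ('b \<Rightarrow> real) \<Rightarrow> real" where
  "total_length G l = (\<Sum>e\<in>arcs G. l e)"

text \<open>
  A continuous real function on a metric graph is given by its restrictions \<open>f e\<close> to the edges, which have
  to agree at the vertices (\<open>g\<close> gives the common values there).  Outside of the graph the
  values are fixed to be 0, so that equality and linear independence are those of functions on
  the graph.
\<close>
definition continuous_functions ::
    "('a, 'b) pre_digraph \<Rightarrow> ('b \<Rightarrow> real) \<Rightarrow> ('b \<Rightarrow> real \<Rightarrow> real) set" where
  "continuous_functions G l = {f.
     (\<forall>e t. \<not> (e \<in> arcs G \<and> t \<in> {0..l e}) \<longrightarrow> f e t = 0) \<and>
     (\<forall>e\<in>arcs G. continuous_on {0..l e} (f e)) \<and>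
     (\<exists>g :: 'a \<Rightarrow> real. \<forall>e\<in>arcs G. f e 0 = g (tail G e) \<and> f e (l e) = g (head G e))}"

text \<open>
  Here \<open>f'\<close> is the derivative on each closed edge, one-sided at the end points, in the direction
  of the arc.  The derivative away from a vertex into the edge is therefore \<open>f' e 0\<close> at the tail
  and \<open>- f' e (l e)\<close> at the head; a loop contributes both.
\<close>
definition eigenspace ::
    "('a, 'b) pre_digraph \<Rightarrow> ('b \<Rightarrow> real) \<Rightarrow> real \<Rightarrow> ('b \<Rightarrow> real \<Rightarrow> real) set" where
  "eigenspace G l \<mu> = {f \<in> continuous_functions G l. \<exists>f' :: 'b \<Rightarrow> real \<Rightarrow> real.
     (\<forall>e\<in>arcs G. \<forall>t\<in>{0..l e}.
        (f e has_real_derivative f' e t) (at t within {0..l e}) \<and>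
        (f' e has_real_derivative - \<mu> * f e t) (at t within {0..l e})) \<and>
     (\<forall>v\<in>verts G. (\<Sum>e\<in>out_arcs G v. f' e 0) - (\<Sum>e\<in>in_arcs G v. f' e (l e)) = 0)}"

definition is_eigenvalue :: "('a, 'b) pre_digraph \<Rightarrow> ('b \<Rightarrow> real) \<Rightarrow> real \<Rightarrow> bool" where
  "is_eigenvalue G l \<mu> \<longleftrightarrow> (\<exists>f\<in>eigenspace G l \<mu>. f \<noteq> 0)"

definition fun_scale :: "real \<Rightarrow> ('b \<Rightarrow> real \<Rightarrow> real) \<Rightarrow> 'b \<Rightarrow> real \<Rightarrow> real" where
  "fun_scale c f = (\<lambda>e t. c * f e t)"

global_interpretation edge_fun: vector_space "fun_scale :: real \<Rightarrow> ('b \<Rightarrow> real \<Rightarrow> real) \<Rightarrow> _"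
  by unfold_locales (auto simp: fun_scale_def fun_eq_iff algebra_simps)

lemma subspace_eigenspace: "edge_fun.subspace (eigenspace G l \<mu>)"
proof (rule edge_fun.subspaceI)
  show "0 \<in> eigenspace G l \<mu>"
    unfolding eigenspace_def continuous_functions_def
    by (auto intro!: exI[of _ "\<lambda>_. 0"] exI[of _ "\<lambda>_ _. 0"] simp: zero_fun_def)
next
  fix f h assume "f \<in> eigenspace G l \<mu>" "h \<in> eigenspace G l \<mu>"
  then obtain f' h' g k where
    *: "\<forall>e t. \<not> (e \<in> arcs G \<and> t \<in> {0..l e}) \<longrightarrow> f e t = 0"
      "\<forall>e t. \<not> (e \<in> arcs G \<and> t \<in> {0..l e}) \<longrightarrow> h e t = 0"
      "\<forall>e\<in>arcs G. continuous_on {0..l e} (f e)" "\<forall>e\<in>arcs G. continuous_on {0..l e} (h e)"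
      "\<forall>e\<in>arcs G. f e 0 = g (tail G e) \<and> f e (l e) = g (head G e)"
      "\<forall>e\<in>arcs G. h e 0 = k (tail G e) \<and> h e (l e) = k (head G e)"
    and d: "\<forall>e\<in>arcs G. \<forall>t\<in>{0..l e}.
        (f e has_real_derivative f' e t) (at t within {0..l e}) \<and>
        (f' e has_real_derivative - \<mu> * f e t) (at t within {0..l e})"
      "\<forall>e\<in>arcs G. \<forall>t\<in>{0..l e}.
        (h e has_real_derivative h' e t) (at t within {0..l e}) \<and>
        (h' e has_real_derivative - \<mu> * h e t) (at t within {0..l e})"
    and k: "\<forall>v\<in>verts G. (\<Sum>e\<in>out_arcs G v. f' e 0) - (\<Sum>e\<in>in_arcs G v. f' e (l e)) = 0"
      "\<forall>v\<in>verts G. (\<Sum>e\<in>out_arcs G v. h' e 0) - (\<Sum>e\<in>in_arcs G v. h' e (l e)) = 0"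
    unfolding eigenspace_def continuous_functions_def by blast
  have eq: "f + h = (\<lambda>e t. f e t + h e t)" by (simp add: fun_eq_iff)
  have "f + h \<in> continuous_functions G l"
    unfolding continuous_functions_def eq using *
    by (auto intro!: continuous_on_add exI[of _ "\<lambda>v. g v + k v"])
  moreover have "((\<lambda>t. f e t + h e t) has_real_derivative f' e t + h' e t) (at t within {0..l e}) \<and>
      ((\<lambda>t. f' e t + h' e t) has_real_derivative - \<mu> * (f e t + h e t)) (at t within {0..l e})"
    if "e \<in> arcs G" "t \<in> {0..l e}" for e t
    using DERIV_add[of "f e" "f' e t" t "{0..l e}" "h e" "h' e t"]
      DERIV_add[of "f' e" "- \<mu> * f e t" t "{0..l e}" "h' e" "- \<mu> * h e t"] d that
    by (simp add: distrib_left)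
  moreover have "(\<Sum>e\<in>out_arcs G v. f' e 0 + h' e 0) -
      (\<Sum>e\<in>in_arcs G v. f' e (l e) + h' e (l e)) = 0" if "v \<in> verts G" for v
    using k that by (simp add: sum.distrib)
  ultimately show "f + h \<in> eigenspace G l \<mu>"
    unfolding eigenspace_def eq by (auto intro!: exI[of _ "\<lambda>e t. f' e t + h' e t"])
next
  fix c f assume "f \<in> eigenspace G l \<mu>"
  then obtain f' g where
    *: "\<forall>e t. \<not> (e \<in> arcs G \<and> t \<in> {0..l e}) \<longrightarrow> f e t = 0"
      "\<forall>e\<in>arcs G. continuous_on {0..l e} (f e)"
      "\<forall>e\<in>arcs G. f e 0 = g (tail G e) \<and> f e (l e) = g (head G e)"
    and d: "\<forall>e\<in>arcs G. \<forall>t\<in>{0..l e}.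
        (f e has_real_derivative f' e t) (at t within {0..l e}) \<and>
        (f' e has_real_derivative - \<mu> * f e t) (at t within {0..l e})"
    and k: "\<forall>v\<in>verts G. (\<Sum>e\<in>out_arcs G v. f' e 0) - (\<Sum>e\<in>in_arcs G v. f' e (l e)) = 0"
    unfolding eigenspace_def continuous_functions_def by blast
  have "fun_scale c f \<in> continuous_functions G l"
    unfolding continuous_functions_def fun_scale_def using *
    by (auto intro!: continuous_on_mult_left exI[of _ "\<lambda>v. c * g v"])
  moreover have "((\<lambda>t. c * f e t) has_real_derivative c * f' e t) (at t within {0..l e}) \<and>
      ((\<lambda>t. c * f' e t) has_real_derivative - \<mu> * (c * f e t)) (at t within {0..l e})"
    if "e \<in> arcs G" "t \<in> {0..l e}" for e t
    using DERIV_cmult[of "f e" "f' e t" t "{0..l e}" c]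
      DERIV_cmult[of "f' e" "- \<mu> * f e t" t "{0..l e}" c] d that
    by (simp add: mult.left_commute)
  moreover have "(\<Sum>e\<in>out_arcs G v. c * f' e 0) - (\<Sum>e\<in>in_arcs G v. c * f' e (l e)) = 0"
    if "v \<in> verts G" for v
    using k that by (simp flip: sum_distrib_left)
  ultimately show "fun_scale c f \<in> eigenspace G l \<mu>"
    unfolding eigenspace_def fun_scale_def by (auto intro!: exI[of _ "\<lambda>e t. c * f' e t"])
qed

definition multiplicity_of :: "('a, 'b) pre_digraph \<Rightarrow> ('b \<Rightarrow> real) \<Rightarrow> real \<Rightarrow> nat" where
  "multiplicity_of G l \<mu> = edge_fun.dim (eigenspace G l \<mu>)"

text \<open>
  The sum is finite because on a finite metric graph there are finitely many eigenvalues
  below any bound, each of finite multiplicity.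
\<close>
definition eigenvalue_count :: "('a, 'b) pre_digraph \<Rightarrow> ('b \<Rightarrow> real) \<Rightarrow> real \<Rightarrow> nat" where
  "eigenvalue_count G l x = (\<Sum>\<mu> | is_eigenvalue G l \<mu> \<and> \<mu> \<le> x. multiplicity_of G l \<mu>)"

text \<open>
  The \<open>j\<close>-th entry, starting from \<open>j = 0\<close>, of the nondecreasing list of eigenvalues repeated
  according to multiplicity.
\<close>
definition eigenvalue :: "nat \<Rightarrow> ('a, 'b) pre_digraph \<Rightarrow> ('b \<Rightarrow> real) \<Rightarrow> real" where
  "eigenvalue j G l = (LEAST x. j + 1 \<le> eigenvalue_count G l x)"

definition Lambda_1 :: "('a, 'b) pre_digraph \<Rightarrow> real" where
  "Lambda_1 G = (LEAST C. \<forall>l. is_metric G l \<longrightarrow> eigenvalue 1 G l \<le> C / (total_length G l)\<^sup>2)"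

text \<open>
  The library represents an undirected graph by a symmetric digraph, in which every edge occurs
  as two arcs.  We keep one arc of each pair.
\<close>
definition complete_graph :: "nat \<Rightarrow> (nat, nat \<times> nat) pre_digraph" where
  "complete_graph n = with_proj \<lparr>pverts = {..<n}, parcs = {(i, j). i < j \<and> j < n}\<rparr>"

lemma complete_digraph_mk_symmetric: "complete_digraph n (mk_symmetric (complete_graph n))"
  unfolding complete_digraph_pair_def
proof -
  have "(\<Union>e\<in>{(i, j). i < j \<and> j < n}. {(fst e, snd e), (snd e, fst e)}) =
      {(u, v). (u, v) \<in> {..<n} \<times> {..<n} \<and> u \<noteq> v}"
    by (force simp: nat_neq_iff)
  then show "finite (pverts (mk_symmetric (complete_graph n))) \<and>
      card (pverts (mk_symmetric (complete_graph n))) = n \<and>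
      parcs (mk_symmetric (complete_graph n)) =
        {(u, v). (u, v) \<in> pverts (mk_symmetric (complete_graph n)) \<times>
          pverts (mk_symmetric (complete_graph n)) \<and> u \<noteq> v}"
    by (simp add: mk_symmetric_def complete_graph_def)
qed

lemma digraph_complete_graph: "digraph (complete_graph n)"
proof -
  have "finite {(i, j). i < j \<and> j < n}"
    by (rule finite_subset[of _ "{..<n} \<times> {..<n}"]) auto
  then show ?thesis
    by unfold_locales (auto simp: complete_graph_def arc_to_ends_def)
qed

end

theory Submission
  imports Defs
begin

text \<open>
  \<^bold>\<open>The metrics that approach the bound.\<close>  Give the four edges of a cycle length 1 and the remaining two
  (opposite) edges length \<open>\<delta>\<close>.  As \<open>\<delta>\<close> tends to 0 the graph becomes two vertices joined by four unit edges,
  whose first nonzero eigenvalue is \<open>\<pi>\<^sup>2\<close> and whose length is 4.  The eigenvalue equation of the graph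
  splits into four scalar ones, along the constant function and the three sign functions
  of the perfect matchings, and none of them has a solution \<open>0 < k < \<pi> / (1 + \<delta>)\<close>
  (\<open>thin_metric_eigenvalue\<close>).

  \<^bold>\<open>The upper bound.\<close>  Let \<open>L\<close> be the total length and \<open>k = 4 \<pi> / L\<close>.  By the variational principle it is
  enough to find a plane of functions with \<open>\<integral> f'\<^sup>2 \<le> k\<^sup>2 \<integral> f\<^sup>2\<close>.  An edge of length at least \<open>\<pi> / k\<close> carries
  such a function that vanishes outside of the edge, a bump, so two such edges, or one of twice that length, are enough
  (\<open>plane_two_long_edges\<close>, \<open>plane_very_long_edge\<close>).  In the
  remaining case there are also test functions that solve \<open>f'' = - k\<^sup>2 f\<close>
  on the edges, and these are orthogonal to bumps.  With \<open>s e = cot (k l(e) / 2)\<close>, such a function on the edge \<open>e\<close> is given by two numbers \<open>d\<close>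
  and \<open>n\<close>, the end values are \<open>n s \<plusminus> d\<close>, and the form is \<open>2 k s (d\<^sup>2 - n\<^sup>2)\<close>.  Every perfect matching
  of the graph gives such a function: it takes opposite values on the two matched pairs of vertices, and it is shifted
  by a constant so as to be orthogonal to the function that is constant at the vertices.  The plane is spanned by two of the
  following: a bump, the function that is constant at the vertices, and one of the three matching functions.

  Let \<open>E\<^sub>1, E\<^sub>3, E\<^sub>5\<close> be the elementary symmetric polynomials of the six numbers \<open>s e\<close>, which are the cotangents of
  angles with sum \<open>2 \<pi>\<close>.  If \<open>E\<^sub>5 \<le> 0\<close>, then there is a bump, and the first two functions are enough.
  That otherwise one of the matching functions is good enough (\<open>good_matching_exists\<close>) is proved by averaging
  the three conditions with the squares of the sums of the two cotangents of a matching as weights.  The sum of the angles gives \<open>E\<^sub>3 = E\<^sub>1 + E\<^sub>5\<close> and \<open>E\<^sub>5 \<le> E\<^sub>1\<close>, and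
  the averaged condition has the form \<open>E\<^sub>5 \<le> X\<close> for a certain quotient \<open>X\<close>.
  A homogeneous polynomial inequality (\<open>odd_discriminant\<close>) says that \<open>X\<^sup>2 - E\<^sub>3 X + E\<^sub>1 E\<^sub>5 \<le> 0\<close>, that is
  \<open>(X - E\<^sub>1) (X - E\<^sub>5) \<le> 0\<close>, so \<open>X\<close> lies between \<open>E\<^sub>5\<close> and \<open>E\<^sub>1\<close>.

  \<^bold>\<open>The variational principle.\<close>  Functions are replaced by their values at the vertices and at the
  quarter points of the edges.  For \<open>k\<close> so small that a quarter of every edge is shorter than \<open>\<pi> / k\<close>, the number \<open>k\<^sup>2\<close>
  is an eigenvalue if and only if a symmetric bilinear form \<open>Q\<^sub>k\<close> on these values is
  degenerate (\<open>is_eigenvalue_iff_radical\<close>).  The form depends continuously on \<open>k\<close> and strictly decreases.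
  Therefore only finitely many \<open>k\<close> in a bounded range are singular (\<open>finite_singular_decreasing\<close>), and between 0, where the form
  is positive on a hyperplane, and a \<open>k\<close> where it is nonpositive on a plane there is
  a singular parameter (\<open>bilinear_family_becomes_singular\<close>).
\<close>

section \<open>Families of quadratic forms\<close>

lemma nsd_iff:
  fixes p q r :: real
  shows "(\<forall>c d. c\<^sup>2 * p + 2 * c * d * q + d\<^sup>2 * r \<le> 0) \<longleftrightarrow> p \<le> 0 \<and> r \<le> 0 \<and> q\<^sup>2 \<le> p * r"
proof
  assume *: "\<forall>c d. c\<^sup>2 * p + 2 * c * d * q + d\<^sup>2 * r \<le> 0"
  have p: "p \<le> 0" using *[rule_format, of 1 0] by simp
  have r: "r \<le> 0" using *[rule_format, of 0 1] by simp
  have "q\<^sup>2 \<le> p * r"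
  proof (cases "p = 0")
    case True
    have "q = 0"
    proof (rule ccontr)
      assume "q \<noteq> 0"
      have "2 * ((1 - r) / (2 * q)) * q + r \<le> 0" using *[rule_format, of "(1 - r) / (2 * q)" 1] True by simp
      moreover have "2 * ((1 - r) / (2 * q)) * q = 1 - r" using \<open>q \<noteq> 0\<close> by simp
      ultimately show False by linarith
    qed
    thus ?thesis using True by simp
  next
    case False
    have "q\<^sup>2 * p + 2 * q * (- p) * q + (- p)\<^sup>2 * r \<le> 0" using * by blast
    hence "p * (p * r - q\<^sup>2) \<le> 0" by (simp add: power2_eq_square algebra_simps)
    thus ?thesis using p False by (simp add: mult_le_0_iff)
  qed
  with p r show "p \<le> 0 \<and> r \<le> 0 \<and> q\<^sup>2 \<le> p * r" by simp
next
  assume *: "p \<le> 0 \<and> r \<le> 0 \<and> q\<^sup>2 \<le> p * r"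
  show "\<forall>c d. c\<^sup>2 * p + 2 * c * d * q + d\<^sup>2 * r \<le> 0"
  proof (intro allI)
    fix c d
    show "c\<^sup>2 * p + 2 * c * d * q + d\<^sup>2 * r \<le> 0"
    proof (cases "p = 0")
      case True
      then show ?thesis using * by (simp add: mult_nonneg_nonpos)
    next
      case False
      have "0 \<le> (c * p + d * q)\<^sup>2 + d\<^sup>2 * (p * r - q\<^sup>2)" using * by simp
      also have "\<dots> = p * (c\<^sup>2 * p + 2 * c * d * q + d\<^sup>2 * r)" by (simp add: power2_eq_square algebra_simps)
      finally show ?thesis using * False by (simp add: zero_le_mult_iff)
    qed
  qed
qed

lemma bilinear_quadratic:
  assumes "bilinear B" and sym: "\<And>x y. B x y = B y x"
  shows "B (c *\<^sub>R u + d *\<^sub>R v) (c *\<^sub>R u + d *\<^sub>R v) = c\<^sup>2 * B u u + 2 * c * d * B u v + d\<^sup>2 * (B v v :: real)"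
  using sym[of v u] by (simp add: bilinear_ladd[OF assms(1)] bilinear_radd[OF assms(1)] bilinear_lmul[OF assms(1)] bilinear_rmul[OF assms(1)]
    power2_eq_square algebra_simps)

text \<open>
  A form is negative semidefinite on the span of \<open>u\<close> and \<open>v\<close> if and only if its Gram matrix there satisfies the three
  inequalities below (\<open>nsd_iff\<close>).  In this shape the condition is visibly closed.
\<close>
definition nsd_plane :: "('a::euclidean_space \<Rightarrow> 'a \<Rightarrow> real) \<Rightarrow> bool" where
  "nsd_plane B \<longleftrightarrow> (\<exists>u v. (\<forall>c d. c *\<^sub>R u + d *\<^sub>R v = 0 \<longrightarrow> c = 0 \<and> d = 0) \<and> B u u \<le> 0 \<and> B v v \<le> 0 \<and> (B u v)\<^sup>2 \<le> B u u * B v v)"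

text \<open>
  Orthonormal bases vary in a compact set, which is used to find the first parameter with such a plane.
\<close>
lemma nsd_plane_orthonormal:
  assumes B: "bilinear B" and sym: "\<And>x y. B x y = B y x" and "nsd_plane B"
  shows "\<exists>u v. norm u = 1 \<and> norm v = 1 \<and> u \<bullet> v = 0 \<and> B u u \<le> 0 \<and> B v v \<le> 0 \<and> (B u v)\<^sup>2 \<le> B u u * B v v"
proof -
  obtain u v where ind: "\<And>c d. c *\<^sub>R u + d *\<^sub>R v = 0 \<Longrightarrow> c = 0 \<and> d = 0" 
    and n: "B u u \<le> 0 \<and> B v v \<le> 0 \<and> (B u v)\<^sup>2 \<le> B u u * B v v"
    using assms unfolding nsd_plane_def by blast
  have Q: "B (c *\<^sub>R u + d *\<^sub>R v) (c *\<^sub>R u + d *\<^sub>R v) \<le> 0" for c d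
    using n[folded nsd_iff] by (simp add: bilinear_quadratic[OF B sym])
  have u0: "u \<noteq> 0" using ind[of 1 0] by auto
  define w where "w = v - ((u \<bullet> v) / (u \<bullet> u)) *\<^sub>R u"
  have w0: "w \<noteq> 0" using ind[of "- ((u \<bullet> v) / (u \<bullet> u))" 1] unfolding w_def by auto
  have uw: "u \<bullet> w = 0" unfolding w_def using u0 by (simp add: inner_diff_right)
  define u' w' where "u' = (1 / norm u) *\<^sub>R u" and "w' = (1 / norm w) *\<^sub>R w"
  have "B (c *\<^sub>R u' + d *\<^sub>R w') (c *\<^sub>R u' + d *\<^sub>R w') \<le> 0" for c d
  proof -
    have "c *\<^sub>R u' + d *\<^sub>R w' = (c / norm u - d / norm w * ((u \<bullet> v) / (u \<bullet> u))) *\<^sub>R u + (d / norm w) *\<^sub>R v"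
      unfolding u'_def w'_def w_def by (simp add: algebra_simps)
    thus ?thesis using Q by metis
  qed
  hence "B u' u' \<le> 0 \<and> B w' w' \<le> 0 \<and> (B u' w')\<^sup>2 \<le> B u' u' * B w' w'"
    by (simp add: bilinear_quadratic[OF B sym] nsd_iff[symmetric])
  moreover have "norm u' = 1" "norm w' = 1" "u' \<bullet> w' = 0" using u0 w0 uw unfolding u'_def w'_def by auto
  ultimately show ?thesis by blast
qed

lemma continuous_on_bilinear_family:
  fixes B :: "real \<Rightarrow> 'a::euclidean_space \<Rightarrow> 'a \<Rightarrow> real"
  assumes bil: "\<And>k. bilinear (B k)" and cont: "\<And>x y. continuous_on I (\<lambda>k. B k x y)"
    and f: "continuous_on S f" "f ` S \<subseteq> I" and g: "continuous_on S g" and h: "continuous_on S h"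
  shows "continuous_on S (\<lambda>s. B (f s) (g s) (h s))"
proof -
  have eq: "B k x y = (\<Sum>i\<in>Basis. \<Sum>j\<in>Basis. (x \<bullet> i) * (y \<bullet> j) * B k i j)" for k x y
  proof -
    have "B k x y = B k (\<Sum>i\<in>Basis. (x \<bullet> i) *\<^sub>R i) (\<Sum>j\<in>Basis. (y \<bullet> j) *\<^sub>R j)" by (simp add: euclidean_representation)
    also have "\<dots> = (\<Sum>(i,j)\<in>Basis \<times> Basis. B k ((x \<bullet> i) *\<^sub>R i) ((y \<bullet> j) *\<^sub>R j))" by (rule bilinear_sum[OF bil])
    finally show ?thesis by (simp add: bilinear_lmul[OF bil] bilinear_rmul[OF bil] sum.cartesian_product mult.assoc mult.left_commute)
  qed
  have c: "continuous_on S (\<lambda>s. B (f s) i j)" for i j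
    using continuous_on_compose2[OF cont f] by blast
  have "(\<lambda>s. B (f s) (g s) (h s)) = (\<lambda>s. \<Sum>i\<in>Basis. \<Sum>j\<in>Basis. (g s \<bullet> i) * (h s \<bullet> j) * B (f s) i j)"
    by (rule ext) (rule eq)
  thus ?thesis using c g h by (simp only:) (intro continuous_intros)
qed

text \<open>
  Let \<open>k\<close> be the first parameter with a plane on which the form is nonpositive.  It exists by compactness, and
  it is not \<open>a\<close> because a plane meets every hyperplane.  If the form at \<open>k\<close>, given by the self-adjoint map \<open>A\<close>,
  were nondegenerate, then moving the plane along \<open>x \<mapsto> x - \<epsilon> A x\<close> would make the form negative definite on it,
  since the value at \<open>x\<close> changes by \<open>- 2 \<epsilon> |A x|\<^sup>2 + O(\<epsilon>\<^sup>2 |A x|\<^sup>2)\<close>; negative definiteness would persist for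
  slightly smaller parameters.
\<close>
theorem bilinear_family_becomes_singular:
  fixes B :: "real \<Rightarrow> 'a::euclidean_space \<Rightarrow> 'a \<Rightarrow> real"
  assumes bil: "\<And>k. bilinear (B k)" and sym: "\<And>k x y. B k x y = B k y x" 
    and cont: "\<And>x y. continuous_on {a..b} (\<lambda>k. B k x y)" and ab: "a \<le> b"
    and pos: "\<And>x. x \<bullet> z = 0 \<Longrightarrow> x \<noteq> 0 \<Longrightarrow> 0 < B a x x"
    and neg: "nsd_plane (B b)"
  shows "\<exists>k\<in>{a<..b}. \<exists>x. x \<noteq> 0 \<and> (\<forall>y. B k x y = 0)"
proof -
  define K where "K = {a..b} \<times> (sphere (0::'a) 1 \<times> sphere (0::'a) 1)"
  define T where "T = {s \<in> K. fst (snd s) \<bullet> snd (snd s) = 0} \<inter> ({s \<in> K. B (fst s) (fst (snd s)) (fst (snd s)) \<le> 0} \<inter>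
    ({s \<in> K. B (fst s) (snd (snd s)) (snd (snd s)) \<le> 0} \<inter>
    {s \<in> K. (B (fst s) (fst (snd s)) (snd (snd s)))\<^sup>2 \<le> B (fst s) (fst (snd s)) (fst (snd s)) * B (fst s) (snd (snd s)) (snd (snd s))}))"
  have T: "(k, u, v) \<in> T \<longleftrightarrow> k \<in> {a..b} \<and> norm u = 1 \<and> norm v = 1 \<and> u \<bullet> v = 0 \<and> B k u u \<le> 0 \<and> B k v v \<le> 0 \<and> (B k u v)\<^sup>2 \<le> B k u u * B k v v" for k u v
    unfolding T_def K_def by auto
  have "compact K" unfolding K_def by (intro compact_Times compact_sphere compact_Icc)
  hence clK: "closed K" by (rule compact_imp_closed)
  have cB: "continuous_on K (\<lambda>s. B (fst s) (g s) (h s))" if "continuous_on K g" "continuous_on K h" for g h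
    by (rule continuous_on_bilinear_family[OF bil cont _ _ that]) (auto simp: K_def continuous_on_fst)
  have "closed T" unfolding T_def
    by (intro closed_Int continuous_closed_preimage_constant continuous_on_closed_Collect_le clK cB continuous_intros)
  moreover have "T \<subseteq> K" unfolding T_def by auto
  ultimately have "compact T" using \<open>compact K\<close> compact_Int_closed[of K T] by (simp add: Int_absorb1)
  have Tk: "\<exists>u v. (k, u, v) \<in> T" if "k \<in> {a..b}" "nsd_plane (B k)" for k
    using nsd_plane_orthonormal[OF bil sym that(2)] that(1) unfolding T by blast
  have "T \<noteq> {}" using Tk[of b] neg ab by auto
  have "compact (fst ` T)" using \<open>compact T\<close> by (intro compact_continuous_image continuous_on_fst continuous_on_id)
  then obtain k where k: "k \<in> fst ` T" "\<And>k'. k' \<in> fst ` T \<Longrightarrow> k \<le> k'"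
    using compact_attains_inf[of "fst ` T"] \<open>T \<noteq> {}\<close> by auto
  then obtain u v where uv: "(k, u, v) \<in> T" by auto
  hence kab: "k \<in> {a..b}" and n: "norm u = 1" "norm v = 1" "u \<bullet> v = 0" and nsd: "B k u u \<le> 0 \<and> B k v v \<le> 0 \<and> (B k u v)\<^sup>2 \<le> B k u u * B k v v"
    unfolding T by auto
  have Q: "B k (c *\<^sub>R u + d *\<^sub>R v) (c *\<^sub>R u + d *\<^sub>R v) \<le> 0" for c d
    using nsd[folded nsd_iff] by (simp add: bilinear_quadratic[OF bil sym])
  have ind: "c = 0 \<and> d = 0" if "c *\<^sub>R u + d *\<^sub>R v = 0" for c d
  proof -
    have "0 = (c *\<^sub>R u + d *\<^sub>R v) \<bullet> u" "0 = (c *\<^sub>R u + d *\<^sub>R v) \<bullet> v" using that by auto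
    thus ?thesis using n by (simp add: inner_add_left inner_commute[of v u] dot_square_norm)
  qed
  have "k \<noteq> a"
  proof
    assume "k = a"
    obtain c d where cd: "(c, d) \<noteq> (0, 0)" "c * (u \<bullet> z) + d * (v \<bullet> z) = 0"
    proof (cases "u \<bullet> z = 0")
      case True thus ?thesis using that[of 1 0] by simp
    next
      case False thus ?thesis using that[of "- (v \<bullet> z)" "u \<bullet> z"] by simp
    qed
    hence "c *\<^sub>R u + d *\<^sub>R v \<noteq> 0" using ind by auto
    moreover have "(c *\<^sub>R u + d *\<^sub>R v) \<bullet> z = 0" using cd by (simp add: inner_add_left)
    ultimately have "0 < B a (c *\<^sub>R u + d *\<^sub>R v) (c *\<^sub>R u + d *\<^sub>R v)" by (intro pos)
    thus False using Q[of c d] \<open>k = a\<close> by simp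
  qed
  hence "a < k" using kab by auto
  have "\<exists>x. x \<noteq> 0 \<and> (\<forall>y. B k x y = 0)"
  proof (rule ccontr)
    assume "\<not> ?thesis"
    hence inj: "\<exists>y. B k x y \<noteq> 0" if "x \<noteq> 0" for x using that by blast
    define A where "A x = (\<Sum>i\<in>Basis. B k x i *\<^sub>R i)" for x
    have A: "B k x y = A x \<bullet> y" for x y
    proof -
      have lin: "linear (B k x)" using bil[of k] unfolding bilinear_def by blast
      have "B k x y = B k x (\<Sum>i\<in>Basis. (y \<bullet> i) *\<^sub>R i)" by (simp add: euclidean_representation)
      also have "\<dots> = (\<Sum>i\<in>Basis. (y \<bullet> i) * B k x i)"
        by (simp add: linear_sum[OF lin] linear_cmul[OF lin])
      also have "\<dots> = A x \<bullet> y" unfolding A_def by (simp add: inner_sum_left inner_sum_right inner_commute[of _ y] mult.commute)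
      finally show ?thesis .
    qed
    have A0: "A x \<noteq> 0" if "x \<noteq> 0" for x using inj[OF that] A by auto
    obtain C where C: "0 < C" "\<And>x y. norm (B k x y) \<le> C * norm x * norm y" using bilinear_bounded_pos[OF bil] by metis
    \<comment> \<open>For this step size the quadratic term is at most half of the linear one.\<close>
    define D where "D x = x - (1 / C) *\<^sub>R A x" for x
    have D: "B k (D x) (D x) < 0" if "x \<noteq> 0" "B k x x \<le> 0" for x
    proof -
      have "B k (D x) (D x) = B k x x - 2 / C * (A x \<bullet> A x) + 1 / C\<^sup>2 * B k (A x) (A x)"
        unfolding D_def using sym[of k "A x" x]
        by (simp add: bilinear_lsub[OF bil] bilinear_rsub[OF bil] bilinear_lmul[OF bil] bilinear_rmul[OF bil] A[of x "A x"] power2_eq_square algebra_simps)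
      moreover have "1 / C\<^sup>2 * B k (A x) (A x) \<le> 1 / C\<^sup>2 * (C * (A x \<bullet> A x))"
        using C(2)[of "A x" "A x"] by (intro mult_left_mono) (auto simp: dot_square_norm power2_eq_square mult.assoc)
      moreover have "1 / C\<^sup>2 * (C * (A x \<bullet> A x)) = 1 / C * (A x \<bullet> A x)" using C by (simp add: power2_eq_square)
      moreover have "0 < 1 / C * (A x \<bullet> A x)" using A0[OF that(1)] C by simp
      moreover have "2 / C * (A x \<bullet> A x) = 2 * (1 / C * (A x \<bullet> A x))" by simp
      ultimately show ?thesis using that(2) by linarith
    qed
    have Dlin: "D (c *\<^sub>R u + d *\<^sub>R v) = c *\<^sub>R D u + d *\<^sub>R D v" for c d
    proof -
      have "A (c *\<^sub>R u + d *\<^sub>R v) = c *\<^sub>R A u + d *\<^sub>R A v"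
        unfolding A_def by (simp add: bilinear_ladd[OF bil] bilinear_lmul[OF bil] scaleR_add_left sum.distrib scaleR_sum_right)
      thus ?thesis unfolding D_def by (simp add: algebra_simps)
    qed
    have ind': "c = 0 \<and> d = 0" if "c *\<^sub>R D u + d *\<^sub>R D v = 0" for c d
    proof (rule ccontr)
      assume "\<not> ?thesis"
      hence "c *\<^sub>R u + d *\<^sub>R v \<noteq> 0" using ind by blast
      from D[OF this Q] show False using that unfolding Dlin by (simp add: bilinear_lzero[OF bil])
    qed
    have qd: "c\<^sup>2 * B k (D u) (D u) + 2 * c * d * B k (D u) (D v) + d\<^sup>2 * B k (D v) (D v) < 0" if "(c, d) \<noteq> (0, 0)" for c d
    proof -
      have "c *\<^sub>R u + d *\<^sub>R v \<noteq> 0" using ind that by blast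
      from D[OF this Q] show ?thesis unfolding Dlin by (simp add: bilinear_quadratic[OF bil sym])
    qed
    have 1: "B k (D u) (D u) < 0" using qd[of 1 0] by simp
    have 2: "B k (D v) (D v) < 0" using qd[of 0 1] by simp
    have "(B k (D u) (D v))\<^sup>2 * B k (D u) (D u) + 2 * B k (D u) (D v) * (- B k (D u) (D u)) * B k (D u) (D v) + (- B k (D u) (D u))\<^sup>2 * B k (D v) (D v) < 0"
      using 1 by (intro qd) auto
    hence "B k (D u) (D u) * (B k (D u) (D u) * B k (D v) (D v) - (B k (D u) (D v))\<^sup>2) < 0" by (simp add: power2_eq_square algebra_simps)
    hence 3: "0 < B k (D u) (D u) * B k (D v) (D v) - (B k (D u) (D v))\<^sup>2" using 1 by (simp add: mult_less_0_iff)
    have lim: "((\<lambda>k'. B k' x y) \<longlongrightarrow> B k x y) (at k within {a..b})" for x y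
      using cont[of x y] kab by (simp add: continuous_on_def)
    have "\<forall>\<^sub>F k' in at k within {a..b}. B k' (D u) (D u) < 0 \<and> B k' (D v) (D v) < 0 \<and> 0 < B k' (D u) (D u) * B k' (D v) (D v) - (B k' (D u) (D v))\<^sup>2"
      by (intro eventually_conj order_tendstoD(2)[OF lim 1] order_tendstoD(2)[OF lim 2] order_tendstoD(1)[OF _ 3] tendsto_intros lim)
    then obtain \<delta> where \<delta>: "0 < \<delta>" "\<And>k'. k' \<in> {a..b} \<Longrightarrow> k' \<noteq> k \<Longrightarrow> dist k' k < \<delta> \<Longrightarrow> B k' (D u) (D u) < 0 \<and> B k' (D v) (D v) < 0 \<and> 0 < B k' (D u) (D u) * B k' (D v) (D v) - (B k' (D u) (D v))\<^sup>2"
      unfolding eventually_at by blast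
    define k' where "k' = max a (k - \<delta> / 2)"
    have k': "k' \<in> {a..b}" "k' < k" "dist k' k < \<delta>" using kab \<open>a < k\<close> \<delta>(1) unfolding k'_def by (auto simp: dist_real_def max_def)
    have "nsd_plane (B k')" unfolding nsd_plane_def using \<delta>(2)[of k'] k' ind' by (intro exI[of _ "D u"] exI[of _ "D v"]) auto
    from Tk[OF k'(1) this] obtain x y where "(k', x, y) \<in> T" by auto
    hence "k' \<in> fst ` T" by force
    from k(2)[OF this] k' show False by simp
  qed
  thus ?thesis using \<open>a < k\<close> kab by (intro bexI[of _ k]) auto
qed

text \<open>
  The dimension of a maximal nonpositive subspace grows at every singular parameter: what was nonpositive
  before has become negative, and a vector of the radical can be added to it.
\<close>
theorem finite_singular_decreasing:
  fixes B :: "real \<Rightarrow> 'a::euclidean_space \<Rightarrow> 'a \<Rightarrow> real"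
  assumes bil: "\<And>k. bilinear (B k)" and sym: "\<And>k x y. B k x y = B k y x" 
    and decr: "\<And>k k' x. k \<in> I \<Longrightarrow> k' \<in> I \<Longrightarrow> k < k' \<Longrightarrow> x \<noteq> 0 \<Longrightarrow> B k' x x < B k x x"
  shows "finite {k \<in> I. \<exists>x. x \<noteq> 0 \<and> (\<forall>y. B k x y = 0)}"
proof -
  define S where "S = {k \<in> I. \<exists>x. x \<noteq> 0 \<and> (\<forall>y. B k x y = 0)}"
  have main: "\<exists>W. subspace W \<and> dim W = card F \<and> (\<forall>k\<in>I. \<forall>x\<in>W. (\<forall>t\<in>F. t \<le> k) \<longrightarrow> B k x x \<le> 0)"
    if "finite F" "F \<subseteq> S" for F
    using that
  proof (induction F rule: finite_linorder_max_induct)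
    case empty
    have "subspace {0::'a}" "dim {0::'a} = 0" by auto
    moreover have "\<forall>k\<in>I. B k 0 0 \<le> 0" by (simp add: bilinear_lzero[OF bil])
    ultimately show ?case by (intro exI[of _ "{0}"]) auto
  next
    case (insert t F)
    then obtain W where W: "subspace W" "dim W = card F" "\<And>k x. k \<in> I \<Longrightarrow> x \<in> W \<Longrightarrow> \<forall>t\<in>F. t \<le> k \<Longrightarrow> B k x x \<le> 0" by auto
    from insert.prems have "t \<in> I" unfolding S_def by auto
    from insert.prems obtain z where z: "z \<noteq> 0" "\<And>y. B t z y = 0" unfolding S_def by auto
    have strict: "B t x x < 0" if "x \<in> W" "x \<noteq> 0" for x
    proof (cases "F = {}")
      case True
      hence "dim W = 0" using W by simp
      hence "x = 0" using that(1) by auto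
      thus ?thesis using that by simp
    next
      case False
      have "Max F \<in> F" using insert.hyps False by simp
      hence m: "Max F \<in> I" "Max F < t" "\<forall>s\<in>F. s \<le> Max F" using insert.hyps insert.prems unfolding S_def by auto
      have "B t x x < B (Max F) x x" using decr m \<open>t \<in> I\<close> that(2) by blast
      also have "\<dots> \<le> 0" using W(3) m that by blast
      finally show ?thesis .
    qed
    have "z \<notin> W" using strict[of z] z by auto
    have "span W = W" using W(1) by (simp add: span_eq_iff)
    have "dim (span (insert z W)) = card (insert t F)"
      using dim_insert[of z W] \<open>z \<notin> W\<close> \<open>span W = W\<close> W(2) insert.hyps by (auto simp: card_insert_if)
    moreover have "B k x x \<le> 0" if k: "k \<in> I" "\<forall>s\<in>insert t F. s \<le> k" and x: "x \<in> span (insert z W)" for k x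
    proof -
      obtain c where c: "x - c *\<^sub>R z \<in> W" using x \<open>span W = W\<close> by (auto simp: span_breakdown_eq)
      define w where "w = x - c *\<^sub>R z"
      have xw: "x = w + c *\<^sub>R z" unfolding w_def by simp
      have "B t x x = B t w w"
        unfolding xw using z(2) sym[of t w z] by (simp add: bilinear_ladd[OF bil] bilinear_radd[OF bil] bilinear_lmul[OF bil] bilinear_rmul[OF bil])
      also have "\<dots> \<le> 0" using strict[of w] c unfolding w_def[symmetric] by (cases "w = 0") (auto simp: bilinear_lzero[OF bil])
      finally have "B t x x \<le> 0" .
      moreover have "B k x x \<le> B t x x"
        using decr[of t k x] \<open>t \<in> I\<close> k by (cases "x = 0"; cases "t = k") (auto simp: bilinear_lzero[OF bil])
      ultimately show ?thesis by simp
    qed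
    ultimately show ?case by (intro exI[of _ "span (insert z W)"]) auto
  qed
  show ?thesis
  proof (rule ccontr)
    assume "infinite {k \<in> I. \<exists>x. x \<noteq> 0 \<and> (\<forall>y. B k x y = 0)}"
    then obtain F where F: "finite F" "card F = Suc DIM('a)" "F \<subseteq> S"
      using infinite_arbitrarily_large[of S] unfolding S_def by blast
    from main[OF F(1,3)] obtain W :: "'a set" where "dim W = card F" by auto
    thus False using dim_subset_UNIV[of W] F by simp
  qed
qed

section \<open>The equation on an interval\<close>

text \<open>
  On an interval of length \<open>h\<close> let \<open>f\<close> be the solution of \<open>f'' = - k\<^sup>2 f\<close> with end values \<open>u\<close> and \<open>v\<close>.  Then
  \<open>\<integral> f'\<^sup>2 - k\<^sup>2 f\<^sup>2 = f' f|\<^sub>0\<^sup>h\<close> is \<open>piece_form k h u v u v\<close>: the odd part of \<open>f\<close> contributes the cotangent and the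
  even part the tangent.  The value of \<open>cot_coeff\<close> at \<open>k = 0\<close> is the limit, which belongs to linear functions.
\<close>
definition cot_coeff :: "real \<Rightarrow> real \<Rightarrow> real" where
  "cot_coeff k h = (if k = 0 then 1 / h else k / 2 * cot (k * h / 2))"

definition tan_coeff :: "real \<Rightarrow> real \<Rightarrow> real" where
  "tan_coeff k h = k / 2 * tan (k * h / 2)"

definition piece_form :: "real \<Rightarrow> real \<Rightarrow> real \<Rightarrow> real \<Rightarrow> real \<Rightarrow> real \<Rightarrow> real" where
  "piece_form k h u v u' v' = cot_coeff k h * (v - u) * (v' - u') - tan_coeff k h * (u + v) * (u' + v')"

lemma tan_coeff_strict_mono:
  assumes "0 \<le> k" "k < k'" "0 < h" "k' * h < pi"
  shows "tan_coeff k h < tan_coeff k' h"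
proof -
  have "k * h < k' * h" using assms by simp
  hence "k * h < pi" using assms by linarith
  have lt: "tan (k * h / 2) < tan (k' * h / 2)"
    using assms \<open>k * h < k' * h\<close> by (intro tan_monotone) (auto intro: less_le_trans[of _ 0])
  have "0 \<le> tan (k * h / 2)"
    using assms \<open>k * h < pi\<close> by (cases "k = 0") (auto intro!: less_imp_le tan_gt_zero)
  have "k / 2 * tan (k * h / 2) \<le> k' / 2 * tan (k * h / 2)" using \<open>0 \<le> tan (k * h / 2)\<close> assms by (intro mult_right_mono) auto
  also have "\<dots> < k' / 2 * tan (k' * h / 2)" using lt assms by (intro mult_strict_left_mono) auto
  finally show ?thesis unfolding tan_coeff_def .
qed

text \<open>
  The derivative of \<open>y cot y\<close> is \<open>(cos y sin y - y) / sin\<^sup>2 y\<close>.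
\<close>
lemma cot_coeff_strict_antimono:
  assumes "0 < k" "k < k'" "0 < h" "k' * h < 2 * pi"
  shows "cot_coeff k' h < cot_coeff k h"
proof -
  have d: "\<exists>D. DERIV (\<lambda>y. y * cot y) y :> D \<and> D < 0" if "0 < y" "y < pi" for y :: real
  proof -
    have s: "0 < sin y" using that by (simp add: sin_gt_zero)
    have "((\<lambda>y. y * (cos y / sin y)) has_real_derivative (cos y * sin y - y) / (sin y)\<^sup>2) (at y)"
      using s by (auto intro!: derivative_eq_intros simp: field_simps power2_eq_square) 
        (metis (no_types, opaque_lifting) distrib_left mult.commute mult.left_commute mult.right_neutral power2_eq_square sin_cos_squared_add2)
    moreover have "(cos y * sin y - y) / (sin y)\<^sup>2 < 0"
    proof -
      have "cos y < cos 0" using that by (intro cos_monotone_0_pi) auto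
      hence "cos y * sin y < 1 * sin y" using s by (intro mult_strict_right_mono) auto
      also have "1 * sin y \<le> y" using abs_sin_x_le_abs_x[of y] that by simp
      finally show ?thesis using s by (simp add: divide_neg_pos)
    qed
    ultimately show ?thesis unfolding cot_def by blast
  qed
  have "k' * h / 2 * cot (k' * h / 2) < k * h / 2 * cot (k * h / 2)"
  proof (rule DERIV_neg_imp_decreasing[where f = "\<lambda>y. y * cot y"])
    show "k * h / 2 < k' * h / 2" using assms by simp
    fix y assume "k * h / 2 \<le> y" "y \<le> k' * h / 2"
    moreover have "0 < k * h / 2" using assms by simp
    ultimately have "0 < y" "y < pi" using assms by linarith+
    thus "\<exists>D. DERIV (\<lambda>y. y * cot y) y :> D \<and> D < 0" by (rule d)
  qed
  hence "h * (k' / 2 * cot (k' * h / 2)) < h * (k / 2 * cot (k * h / 2))" by (simp add: mult_ac)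
  thus ?thesis using assms unfolding cot_coeff_def by simp
qed

lemma isCont_cot_coeff:
  assumes "0 \<le> k" "0 < h" "k * h < 2 * pi"
  shows "isCont (\<lambda>k. cot_coeff k h) k"
proof (cases "k = 0")
  case True
  have "DERIV (\<lambda>k. sin (k * h / 2)) 0 :> h / 2" by (auto intro!: derivative_eq_intros)
  hence A: "((\<lambda>k. sin (k * h / 2) / k) \<longlongrightarrow> h / 2) (at 0)" by (simp add: DERIV_def)
  have B: "((\<lambda>k. cos (k * h / 2)) \<longlongrightarrow> cos (0 * h / 2)) (at 0)" by (intro tendsto_intros) simp
  have "((\<lambda>k. cos (k * h / 2) / (2 * (sin (k * h / 2) / k))) \<longlongrightarrow> cos (0 * h / 2) / (2 * (h / 2))) (at 0)"
    by (rule tendsto_divide[OF B tendsto_mult[OF tendsto_const A]]) (use assms in simp)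
  moreover have "\<forall>\<^sub>F k in at 0. cos (k * h / 2) / (2 * (sin (k * h / 2) / k)) = cot_coeff k h"
    by (auto simp: eventually_at_filter cot_coeff_def cot_def)
  ultimately have "((\<lambda>k. cot_coeff k h) \<longlongrightarrow> 1 / h) (at 0)"
    by (rule_tac Lim_transform_eventually[of "\<lambda>k. cos (k * h / 2) / (2 * (sin (k * h / 2) / k))"]) auto
  thus ?thesis unfolding True isCont_def by (simp add: cot_coeff_def)
next
  case False
  have "sin (k * h / 2) > 0" using assms False by (intro sin_gt_zero) auto
  hence "isCont (\<lambda>k. k / 2 * cot (k * h / 2)) k" unfolding cot_def by (intro continuous_intros) auto
  moreover have "\<forall>\<^sub>F k in nhds k. k \<noteq> 0" using False by (rule t1_space_nhds)
  hence "\<forall>\<^sub>F k in nhds k. k / 2 * cot (k * h / 2) = cot_coeff k h" 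
    by (rule eventually_mono) (simp add: cot_coeff_def)
  ultimately show ?thesis by (subst isCont_cong[symmetric])
qed

lemma continuous_on_piece_form:
  assumes "0 < h" "b * h < pi"
  shows "continuous_on {0..b} (\<lambda>k. piece_form k h u v u' v')"
proof -
  have le: "k * h < pi" if "k \<in> {0..b}" for k
  proof -
    have "k * h \<le> b * h" using that assms by (intro mult_right_mono) auto
    thus ?thesis using assms by linarith
  qed
  have "isCont (\<lambda>k. cot_coeff k h) k" if "k \<in> {0..b}" for k
  proof (rule isCont_cot_coeff)
    show "k * h < 2 * pi" using le[OF that] pi_gt_zero by linarith
  qed (use that assms in auto)
  hence "continuous_on {0..b} (\<lambda>k. cot_coeff k h)" by (simp add: continuous_at_imp_continuous_on)
  moreover have "cos (k * h / 2) \<noteq> 0" if "k \<in> {0..b}" for k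
  proof -
    have "0 < cos (k * h / 2)"
      using le[OF that] that assms by (intro cos_gt_zero_pi) (auto intro: less_le_trans[of _ 0])
    thus ?thesis by simp
  qed
  hence "continuous_on {0..b} (\<lambda>k. tan_coeff k h)" unfolding tan_coeff_def by (auto intro!: continuous_intros)
  ultimately show ?thesis unfolding piece_form_def by (intro continuous_intros)
qed

lemma piece_form_strict_antimono:
  assumes "0 < k" "k < k'" "0 < h" "k' * h < pi"
  shows "piece_form k' h u v u v \<le> piece_form k h u v u v" "u \<noteq> 0 \<or> v \<noteq> 0 \<Longrightarrow> piece_form k' h u v u v < piece_form k h u v u v"
proof -
  have "k' * h < 2 * pi" using assms pi_gt_zero by linarith
  hence c: "cot_coeff k' h < cot_coeff k h" using assms by (intro cot_coeff_strict_antimono)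
  have t: "tan_coeff k h < tan_coeff k' h" using assms by (intro tan_coeff_strict_mono) auto
  have eq: "piece_form k h u v u v - piece_form k' h u v u v =
    (cot_coeff k h - cot_coeff k' h) * (v - u)\<^sup>2 + (tan_coeff k' h - tan_coeff k h) * (u + v)\<^sup>2"
    unfolding piece_form_def by (simp add: algebra_simps power2_eq_square)
  have 1: "0 \<le> (cot_coeff k h - cot_coeff k' h) * (v - u)\<^sup>2" "0 \<le> (tan_coeff k' h - tan_coeff k h) * (u + v)\<^sup>2" using c t by auto
  show "piece_form k' h u v u v \<le> piece_form k h u v u v" using eq 1 by linarith
  assume "u \<noteq> 0 \<or> v \<noteq> 0"
  hence "v - u \<noteq> 0 \<or> u + v \<noteq> 0" by auto
  hence "0 < (cot_coeff k h - cot_coeff k' h) * (v - u)\<^sup>2 \<or> 0 < (tan_coeff k' h - tan_coeff k h) * (u + v)\<^sup>2"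
  proof
    assume "v - u \<noteq> 0"
    hence "0 < (v - u)\<^sup>2" by simp
    thus ?thesis using c by simp
  next
    assume "u + v \<noteq> 0"
    hence "0 < (u + v)\<^sup>2" by simp
    thus ?thesis using t by simp
  qed
  thus "piece_form k' h u v u v < piece_form k h u v u v" using eq 1 by linarith
qed

definition wave :: "real \<Rightarrow> real \<Rightarrow> real \<Rightarrow> real \<Rightarrow> real" where
  "wave k A B t = A * cos (k * t) + B * sin (k * t)"

definition wave' :: "real \<Rightarrow> real \<Rightarrow> real \<Rightarrow> real \<Rightarrow> real" where
  "wave' k A B t = k * (B * cos (k * t) - A * sin (k * t))"

lemma wave_deriv:
  "(wave k A B has_real_derivative wave' k A B t) (at t within S)"
  "(wave' k A B has_real_derivative - k\<^sup>2 * wave k A B t) (at t within S)"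
  unfolding wave_def[abs_def] wave'_def[abs_def]
  by (auto intro!: derivative_eq_intros simp: algebra_simps power2_eq_square)

lemma piece_form_explicit:
  assumes "k \<noteq> 0" "sin (k * h) \<noteq> 0"
  shows "piece_form k h u v u' v' = k / sin (k * h) * (cos (k * h) * (u * u' + v * v') - (u * v' + v * u'))"
proof -
  define y where "y = k * h / 2"
  have y: "k * h = 2 * y" unfolding y_def by simp
  have s: "sin y \<noteq> 0" "cos y \<noteq> 0" using assms(2) unfolding y by (auto simp: sin_double)
  have "cot y * (2 * sin y * cos y) = 2 * (cos y)\<^sup>2" "tan y * (2 * sin y * cos y) = 2 * (sin y)\<^sup>2"
    using s unfolding cot_def tan_def by (simp_all add: power2_eq_square)
  moreover have "2 * (cos y)\<^sup>2 = 1 + cos (2 * y)" "2 * (sin y)\<^sup>2 = 1 - cos (2 * y)" using cos_double_cos[of y] cos_double_sin[of y] by simp_all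
  ultimately have ct: "cot y * sin (2 * y) = 1 + cos (2 * y)" "tan y * sin (2 * y) = 1 - cos (2 * y)"
    unfolding sin_double by simp_all
  have "piece_form k h u v u' v' * sin (2 * y) = k / 2 * ((cot y * sin (2 * y)) * ((v - u) * (v' - u')) - (tan y * sin (2 * y)) * ((u + v) * (u' + v')))"
    using assms(1) unfolding piece_form_def cot_coeff_def tan_coeff_def y_def by (simp add: field_simps)
  also have "\<dots> = k * (cos (2 * y) * (u * u' + v * v') - (u * v' + v * u'))"
    unfolding ct by (simp add: field_simps)
  finally show ?thesis using assms(2) unfolding y by (simp add: field_simps)
qed

lemma wave_step:
  "wave k A B (t + h) = cos (k * h) * wave k A B t + sin (k * h) * (B * cos (k * t) - A * sin (k * t))"
  "B * cos (k * (t + h)) - A * sin (k * (t + h)) = cos (k * h) * (B * cos (k * t) - A * sin (k * t)) - sin (k * h) * wave k A B t"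
  unfolding wave_def by (simp_all add: distrib_left cos_add sin_add algebra_simps)

text \<open>
  Integration by parts: the form between a solution and an arbitrary function only sees the boundary terms.
\<close>
lemma piece_form_wave:
  assumes "k \<noteq> 0" "sin (k * h) \<noteq> 0"
  shows "piece_form k h (wave k A B t) (wave k A B (t + h)) u' v' = wave' k A B (t + h) * v' - wave' k A B t * u'"
proof -
  define w d where "w = wave k A B t" and "d = B * cos (k * t) - A * sin (k * t)"
  have sc: "sin (k * h) * sin (k * h) = 1 - cos (k * h) * cos (k * h)"
    using sin_cos_squared_add[of "k * h"] by (simp add: power2_eq_square)
  have "sin (k * h) * (sin (k * h) * w * v') = (sin (k * h) * sin (k * h)) * w * v'" by simp
  hence e: "sin (k * h) * (sin (k * h) * w * v') = w * v' - cos (k * h) * cos (k * h) * w * v'" unfolding sc by (simp add: algebra_simps)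
  have e2: "cos (k * h) * (w * u' + (cos (k * h) * w + sin (k * h) * d) * v') - (w * v' + (cos (k * h) * w + sin (k * h) * d) * u')
     = sin (k * h) * ((cos (k * h) * d - sin (k * h) * w) * v' - d * u')"
    using e by (simp add: algebra_simps)
  thus ?thesis
    unfolding piece_form_explicit[OF assms] wave'_def wave_step w_def[symmetric] d_def[symmetric] e2 using assms by (simp add: algebra_simps)
qed

lemma wave_through:
  assumes "sin (k * h) \<noteq> 0"
  shows "wave k u ((v - u * cos (k * h)) / sin (k * h)) 0 = u" "wave k u ((v - u * cos (k * h)) / sin (k * h)) h = v"
  using assms unfolding wave_def by (auto simp: field_simps)

text \<open>
  Rotating \<open>(f, f' / k)\<close> back by the angle \<open>k t\<close> gives a constant vector.
\<close>
lemma harmonic_oscillator_is_wave: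
  assumes "0 \<le> L" "k \<noteq> 0" and f: "\<And>t. t \<in> {0..L} \<Longrightarrow> (f has_real_derivative f' t) (at t within {0..L})"
    and f': "\<And>t. t \<in> {0..L} \<Longrightarrow> (f' has_real_derivative - k\<^sup>2 * f t) (at t within {0..L})"
    and t: "t \<in> {0..L}"
  shows "f t = wave k (f 0) (f' 0 / k) t" "f' t = wave' k (f 0) (f' 0 / k) t"
proof -
  define p q where "p t = f t * cos (k * t) - f' t / k * sin (k * t)" and "q t = f t * sin (k * t) + f' t / k * cos (k * t)" for t
  have "(p has_real_derivative 0) (at t within {0..L})" if "t \<in> {0..L}" for t
    unfolding p_def[abs_def] using f[OF that] f'[OF that] \<open>k \<noteq> 0\<close>
    by (auto intro!: derivative_eq_intros simp: field_simps power2_eq_square)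
  then obtain c where "\<forall>t\<in>{0..L}. p t = c" using has_field_derivative_zero_constant[of "{0..L}" p] by auto
  hence "p t = p 0" using t \<open>0 \<le> L\<close> by simp
  hence p: "p t = f 0" unfolding p_def by simp
  have "(q has_real_derivative 0) (at t within {0..L})" if "t \<in> {0..L}" for t
    unfolding q_def[abs_def] using f[OF that] f'[OF that] \<open>k \<noteq> 0\<close>
    by (auto intro!: derivative_eq_intros simp: field_simps power2_eq_square)
  then obtain c where "\<forall>t\<in>{0..L}. q t = c" using has_field_derivative_zero_constant[of "{0..L}" q] by auto
  hence "q t = q 0" using t \<open>0 \<le> L\<close> by simp
  hence q: "q t = f' 0 / k" unfolding q_def by simp
  have "f t = f t * (cos (k * t) * cos (k * t) + sin (k * t) * sin (k * t))" by (simp only: sin_cos_squared_add3 mult_1_right)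
  also have "\<dots> = p t * cos (k * t) + q t * sin (k * t)" unfolding p_def q_def by (simp add: algebra_simps del: sin_cos_squared_add3)
  finally show "f t = wave k (f 0) (f' 0 / k) t" by (simp only: wave_def p q)
  have "f' t = f' t * (cos (k * t) * cos (k * t) + sin (k * t) * sin (k * t))" by (simp only: sin_cos_squared_add3 mult_1_right)
  also have "\<dots> = k * (q t * cos (k * t) - p t * sin (k * t))" unfolding p_def q_def using \<open>k \<noteq> 0\<close> by (simp add: field_simps del: sin_cos_squared_add3)
  finally show "f' t = wave' k (f 0) (f' 0 / k) t" by (simp only: wave'_def p q)
qed

text \<open>
  For \<open>\<mu> \<le> 0\<close> the function \<open>f' f\<close> has the derivative \<open>f'\<^sup>2 - \<mu> f\<^sup>2 \<ge> 0\<close>.  If it takes the same value at both ends,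
  then \<open>f'\<close>, and for \<open>\<mu> < 0\<close> also \<open>f\<close>, vanishes at some point.  In the latter case the two first order
  factors \<open>f' \<plusminus> r f\<close>, where \<open>r\<^sup>2 = - \<mu>\<close>, vanish identically.
\<close>
lemma nonoscillating_energy:
  assumes L: "0 < L" and f: "\<And>t. t \<in> {0..L} \<Longrightarrow> (f has_real_derivative f' t) (at t within {0..L})"
    and f': "\<And>t. t \<in> {0..L} \<Longrightarrow> (f' has_real_derivative - \<mu> * f t) (at t within {0..L})"
    and \<mu>: "\<mu> \<le> 0"
  shows "f' 0 * f 0 \<le> f' L * f L"
    and "f' 0 * f 0 = f' L * f L \<Longrightarrow> t \<in> {0..L} \<Longrightarrow> f t = f 0"
    and "f' 0 * f 0 = f' L * f L \<Longrightarrow> \<mu> < 0 \<Longrightarrow> t \<in> {0..L} \<Longrightarrow> f t = 0"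
proof -
  have d: "((\<lambda>t. f' t * f t) has_real_derivative (f' t)\<^sup>2 - \<mu> * (f t)\<^sup>2) (at t within {0..L})" if "t \<in> {0..L}" for t
    using f[OF that] f'[OF that] by (auto intro!: derivative_eq_intros simp: algebra_simps power2_eq_square)
  have "\<exists>x\<in>{0<..<L}. f' L * f L - f' 0 * f 0 = ((f' x)\<^sup>2 - \<mu> * (f x)\<^sup>2) * (L - 0)"
    using d L by (intro mvt_simple) (auto simp: has_field_derivative_def)
  then obtain x where x: "x \<in> {0<..<L}" and eq: "f' L * f L - f' 0 * f 0 = ((f' x)\<^sup>2 - \<mu> * (f x)\<^sup>2) * L" by auto
  have nn: "0 \<le> (f' x)\<^sup>2" "0 \<le> - \<mu> * (f x)\<^sup>2" using \<mu> by (auto simp: mult_nonpos_nonneg)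
  hence "0 \<le> (f' x)\<^sup>2 - \<mu> * (f x)\<^sup>2" by linarith
  hence "0 \<le> ((f' x)\<^sup>2 - \<mu> * (f x)\<^sup>2) * L" using L by simp
  thus "f' 0 * f 0 \<le> f' L * f L" using eq by linarith
  assume "f' 0 * f 0 = f' L * f L"
  hence z: "(f' x)\<^sup>2 - \<mu> * (f x)\<^sup>2 = 0" using eq L by simp
  hence fx: "f' x = 0" using nn by (metis add.inverse_inverse add_nonneg_eq_0_iff diff_conv_add_uminus mult_minus_left power_eq_0_iff)
  have neg: "f t = 0" if "\<mu> < 0" "t \<in> {0..L}" for t
  proof -
    have fx0: "f x = 0" using z fx that(1) by simp
    define r where "r = sqrt (- \<mu>)"
    have r: "r * r = - \<mu>" "0 < r" unfolding r_def using that(1) by auto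
    define p q where "p t = (f' t + r * f t) * exp (- r * t)" and "q t = (f' t - r * f t) * exp (r * t)" for t
    have "(p has_real_derivative 0) (at t within {0..L})" if "t \<in> {0..L}" for t
    proof -
      have "(p has_real_derivative (- \<mu> * f t + r * f' t) * exp (- r * t) + (f' t + r * f t) * (exp (- r * t) * (- r))) (at t within {0..L})"
        unfolding p_def[abs_def] using f[OF that] f'[OF that] by (auto intro!: derivative_eq_intros)
      also have "(- \<mu> * f t + r * f' t) * exp (- r * t) + (f' t + r * f t) * (exp (- r * t) * (- r)) = 0"
        unfolding r(1)[symmetric] by (simp add: algebra_simps)
      finally show ?thesis .
    qed
    then obtain c where "\<forall>t\<in>{0..L}. p t = c" using has_field_derivative_zero_constant[of "{0..L}" p] by auto
    hence "p t = p x" using x that by simp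
    moreover have "(q has_real_derivative 0) (at t within {0..L})" if "t \<in> {0..L}" for t
    proof -
      have "(q has_real_derivative (- \<mu> * f t - r * f' t) * exp (r * t) + (f' t - r * f t) * (exp (r * t) * r)) (at t within {0..L})"
        unfolding q_def[abs_def] using f[OF that] f'[OF that] by (auto intro!: derivative_eq_intros)
      also have "(- \<mu> * f t - r * f' t) * exp (r * t) + (f' t - r * f t) * (exp (r * t) * r) = 0"
        unfolding r(1)[symmetric] by (simp add: algebra_simps)
      finally show ?thesis .
    qed
    then obtain c where "\<forall>t\<in>{0..L}. q t = c" using has_field_derivative_zero_constant[of "{0..L}" q] by auto
    hence "q t = q x" using x that by simp
    ultimately have "f' t + r * f t = 0" "f' t - r * f t = 0" unfolding p_def q_def fx fx0 by auto
    thus "f t = 0" using r(2) by auto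
  qed
  thus "\<mu> < 0 \<Longrightarrow> t \<in> {0..L} \<Longrightarrow> f t = 0" .
  show "f t = f 0" if t: "t \<in> {0..L}"
  proof (cases "\<mu> < 0")
    case True
    thus ?thesis using neg[of t] neg[of 0] t L by simp
  next
    case False
    hence "\<mu> = 0" using \<mu> by simp
    hence "(f' has_real_derivative 0) (at t within {0..L})" if "t \<in> {0..L}" for t using f'[OF that] by simp
    then obtain c where "\<forall>t\<in>{0..L}. f' t = c" using has_field_derivative_zero_constant[of "{0..L}" f'] by auto
    hence "\<forall>t\<in>{0..L}. f' t = 0" using fx x by force
    hence "(f has_real_derivative 0) (at t within {0..L})" if "t \<in> {0..L}" for t using f[OF that] that by simp
    then obtain c where "\<forall>t\<in>{0..L}. f t = c" using has_field_derivative_zero_constant[of "{0..L}" f] by auto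
    thus ?thesis using t L by simp
  qed
qed

section \<open>Eigenfunctions on a metric graph\<close>

text \<open>
  Connectedness is used in the form that a function on the vertices that agrees at the two ends of every arc is constant.
\<close>
locale metric_graph = fin_digraph G for G :: "('a, 'b) pre_digraph" +
  fixes l :: "'b \<Rightarrow> real"
  assumes length_pos: "e \<in> arcs G \<Longrightarrow> 0 < l e"
    and constant_on_vertices: "\<And>g :: 'a \<Rightarrow> real. (\<And>e. e \<in> arcs G \<Longrightarrow> g (tail G e) = g (head G e)) \<Longrightarrow> v \<in> verts G \<Longrightarrow> w \<in> verts G \<Longrightarrow> g v = g w"
    and vertex_on_arc: "v \<in> verts G \<Longrightarrow> \<exists>e\<in>arcs G. v = tail G e \<or> v = head G e"
    and verts_nonempty: "verts G \<noteq> {}"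
begin

lemma sum_ends_eq_sum_vertices:
  fixes a b :: "'b \<Rightarrow> real"
  shows "(\<Sum>e\<in>arcs G. b e * w (head G e) - a e * w (tail G e)) 
    = - (\<Sum>v\<in>verts G. w v * ((\<Sum>e\<in>out_arcs G v. a e) - (\<Sum>e\<in>in_arcs G v. b e)))"
proof -
  have "(\<Sum>v\<in>verts G. w v * (\<Sum>e\<in>in_arcs G v. b e)) = (\<Sum>v\<in>verts G. \<Sum>e\<in>{e \<in> arcs G. head G e = v}. b e * w (head G e))"
    by (auto simp: in_arcs_def sum_distrib_left mult.commute intro!: sum.cong)
  also have "\<dots> = (\<Sum>e\<in>arcs G. b e * w (head G e))" by (intro sum.group) auto
  finally have 1: "(\<Sum>v\<in>verts G. w v * (\<Sum>e\<in>in_arcs G v. b e)) = (\<Sum>e\<in>arcs G. b e * w (head G e))" .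
  have "(\<Sum>v\<in>verts G. w v * (\<Sum>e\<in>out_arcs G v. a e)) = (\<Sum>v\<in>verts G. \<Sum>e\<in>{e \<in> arcs G. tail G e = v}. a e * w (tail G e))"
    by (auto simp: out_arcs_def sum_distrib_left mult.commute intro!: sum.cong)
  also have "\<dots> = (\<Sum>e\<in>arcs G. a e * w (tail G e))" by (intro sum.group) auto
  finally have 2: "(\<Sum>v\<in>verts G. w v * (\<Sum>e\<in>out_arcs G v. a e)) = (\<Sum>e\<in>arcs G. a e * w (tail G e))" .
  show ?thesis by (simp add: right_diff_distrib sum_subtractf 1 2)
qed

lemma kirchhoff_iff:
  fixes a b :: "'b \<Rightarrow> real"
  shows "(\<forall>v\<in>verts G. (\<Sum>e\<in>out_arcs G v. a e) - (\<Sum>e\<in>in_arcs G v. b e) = 0) \<longleftrightarrow>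
    (\<forall>w. (\<Sum>e\<in>arcs G. b e * w (head G e) - a e * w (tail G e)) = 0)"
proof
  assume "\<forall>v\<in>verts G. (\<Sum>e\<in>out_arcs G v. a e) - (\<Sum>e\<in>in_arcs G v. b e) = 0"
  thus "\<forall>w. (\<Sum>e\<in>arcs G. b e * w (head G e) - a e * w (tail G e)) = 0"
    unfolding sum_ends_eq_sum_vertices by simp
next
  assume *: "\<forall>w. (\<Sum>e\<in>arcs G. b e * w (head G e) - a e * w (tail G e)) = 0"
  show "\<forall>v\<in>verts G. (\<Sum>e\<in>out_arcs G v. a e) - (\<Sum>e\<in>in_arcs G v. b e) = 0"
  proof
    fix v assume v: "v \<in> verts G"
    have "0 = (\<Sum>u\<in>verts G. (if u = v then 1 else 0) * ((\<Sum>e\<in>out_arcs G u. a e) - (\<Sum>e\<in>in_arcs G u. b e)))"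
      using *[rule_format, of "\<lambda>u. if u = v then 1 else 0"] sum_ends_eq_sum_vertices[of b "\<lambda>u. if u = v then 1 else 0" a] by simp
    also have "\<dots> = (\<Sum>u\<in>verts G. if u = v then ((\<Sum>e\<in>out_arcs G u. a e) - (\<Sum>e\<in>in_arcs G u. b e)) else 0)"
      by (intro sum.cong) auto
    also have "\<dots> = (\<Sum>e\<in>out_arcs G v. a e) - (\<Sum>e\<in>in_arcs G v. b e)" using v by (simp add: sum.delta)
    finally show "(\<Sum>e\<in>out_arcs G v. a e) - (\<Sum>e\<in>in_arcs G v. b e) = 0" by simp
  qed
qed

definition extend :: "('b \<Rightarrow> real \<Rightarrow> real) \<Rightarrow> 'b \<Rightarrow> real \<Rightarrow> real" where
  "extend f e t = (if e \<in> arcs G \<and> t \<in> {0..l e} then f e t else 0)"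

text \<open>
  By the Kirchhoff condition the differences of \<open>f' f\<close> between the ends of the edges add up to 0, and none of them is negative.
\<close>
lemma nonpositive_eigenfunction:
  assumes f: "f \<in> eigenspace G l mu" and mu: "mu \<le> 0"
  shows "\<exists>c. f = extend (\<lambda>e t. c)" and "mu < 0 \<Longrightarrow> f = 0"
proof -
  from f obtain f' g where out: "\<And>e t. \<not> (e \<in> arcs G \<and> t \<in> {0..l e}) \<Longrightarrow> f e t = 0"
    and g: "\<And>e. e \<in> arcs G \<Longrightarrow> f e 0 = g (tail G e) \<and> f e (l e) = g (head G e)"
    and d: "\<And>e t. e \<in> arcs G \<Longrightarrow> t \<in> {0..l e} \<Longrightarrow> (f e has_real_derivative f' e t) (at t within {0..l e})"
      "\<And>e t. e \<in> arcs G \<Longrightarrow> t \<in> {0..l e} \<Longrightarrow> (f' e has_real_derivative - mu * f e t) (at t within {0..l e})"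
    and K: "\<forall>v\<in>verts G. (\<Sum>e\<in>out_arcs G v. f' e 0) - (\<Sum>e\<in>in_arcs G v. f' e (l e)) = 0"
    unfolding eigenspace_def continuous_functions_def by blast
  have en: "f' e 0 * f e 0 \<le> f' e (l e) * f e (l e)" 
     "f' e 0 * f e 0 = f' e (l e) * f e (l e) \<Longrightarrow> t \<in> {0..l e} \<Longrightarrow> f e t = f e 0"
     "f' e 0 * f e 0 = f' e (l e) * f e (l e) \<Longrightarrow> mu < 0 \<Longrightarrow> t \<in> {0..l e} \<Longrightarrow> f e t = 0" if "e \<in> arcs G" for e t
    using nonoscillating_energy[OF length_pos[OF that] d(1)[OF that] d(2)[OF that] mu] by blast+
  have "(\<Sum>e\<in>arcs G. f' e (l e) * g (head G e) - f' e 0 * g (tail G e)) = 0"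
    using K unfolding kirchhoff_iff by blast
  hence "(\<Sum>e\<in>arcs G. f' e (l e) * f e (l e) - f' e 0 * f e 0) = 0"
    by (subst (asm) sum.cong[OF refl, of _ _ "\<lambda>e. f' e (l e) * f e (l e) - f' e 0 * f e 0"]) (auto simp: g)
  moreover have "0 \<le> f' e (l e) * f e (l e) - f' e 0 * f e 0" if "e \<in> arcs G" for e
    using en(1)[OF that] by simp
  ultimately have "f' e 0 * f e 0 = f' e (l e) * f e (l e)" if "e \<in> arcs G" for e
    using sum_nonneg_eq_0_iff[of "arcs G" "\<lambda>e. f' e (l e) * f e (l e) - f' e 0 * f e 0"] that by auto
  note eq = this
  have const: "f e t = g (tail G e)" if "e \<in> arcs G" "t \<in> {0..l e}" for e t
    using en(2)[OF that(1) eq[OF that(1)] that(2)] g[OF that(1)] by simp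
  have "g (tail G e) = g (head G e)" if "e \<in> arcs G" for e
    using const[OF that, of "l e"] g[OF that] length_pos[OF that] by simp
  note gc = constant_on_vertices[of g, OF this]
  obtain v where v: "v \<in> verts G" using verts_nonempty by auto
  have "g (tail G e) = g v" if "e \<in> arcs G" for e using that v by (intro gc) auto
  hence "f = extend (\<lambda>e t. g v)"
    using const out by (auto simp: extend_def fun_eq_iff)
  thus "\<exists>c. f = extend (\<lambda>e t. c)" ..
  assume "mu < 0"
  have "f e t = 0" for e t
    using en(3)[of e t] eq \<open>mu < 0\<close> out by (cases "e \<in> arcs G \<and> t \<in> {0..l e}") auto
  thus "f = 0" by (simp add: fun_eq_iff)
qed

lemma extend_eigenfunction:
  assumes ends: "\<And>e. e \<in> arcs G \<Longrightarrow> f e 0 = g (tail G e) \<and> f e (l e) = g (head G e)"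
    and d: "\<And>e t. e \<in> arcs G \<Longrightarrow> (f e has_real_derivative f' e t) (at t)"
      "\<And>e t. e \<in> arcs G \<Longrightarrow> (f' e has_real_derivative - mu * f e t) (at t)"
    and K: "\<forall>v\<in>verts G. (\<Sum>e\<in>out_arcs G v. f' e 0) - (\<Sum>e\<in>in_arcs G v. f' e (l e)) = 0"
  shows "extend f \<in> eigenspace G l mu"
proof -
  have ext: "extend f e t = f e t" if "e \<in> arcs G" "t \<in> {0..l e}" for e t using that by (simp add: extend_def)
  have D: "(extend f e has_real_derivative f' e t) (at t within {0..l e})" if "e \<in> arcs G" "t \<in> {0..l e}" for e t
    using d(1)[OF that(1)] by (rule has_field_derivative_transform_within[OF has_field_derivative_at_within zero_less_one that(2)]) (simp add: ext that)
  have D2: "(f' e has_real_derivative - mu * extend f e t) (at t within {0..l e})" if "e \<in> arcs G" "t \<in> {0..l e}" for e t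
    using has_field_derivative_at_within[OF d(2)[OF that(1)]] ext[OF that] by simp
  have "continuous_on {0..l e} (extend f e)" if "e \<in> arcs G" for e
    using D[OF that] by (rule DERIV_continuous_on)
  hence "extend f \<in> continuous_functions G l"
    unfolding continuous_functions_def using ends length_pos
    by (auto simp: ext less_imp_le intro!: exI[of _ g]) (auto simp: extend_def)
  thus ?thesis unfolding eigenspace_def using D D2 K by (auto intro!: exI[of _ f'])
qed

lemma arcs_nonempty: "arcs G \<noteq> {}"
  using verts_nonempty vertex_on_arc by blast

lemma extend_const_nonzero: 
  assumes "c \<noteq> 0"
  shows "extend (\<lambda>e t. c) \<noteq> 0"
proof
  assume z: "extend (\<lambda>e t. c) = 0"
  obtain e where "e \<in> arcs G" using arcs_nonempty by auto
  hence "extend (\<lambda>e t. c) e 0 = c" using length_pos[of e] by (simp add: extend_def)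
  with assms z show False by simp
qed

lemma zero_eigenvalue: "is_eigenvalue G l 0" "multiplicity_of G l 0 = 1"
proof -
  define u where "u = extend (\<lambda>e t. 1)"
  have u: "u \<in> eigenspace G l 0" unfolding u_def
    by (rule extend_eigenfunction[of _ "\<lambda>_. 1" "\<lambda>_ _. 0"]) auto
  moreover have u0: "u \<noteq> 0" unfolding u_def by (rule extend_const_nonzero) simp
  ultimately show "is_eigenvalue G l 0" unfolding is_eigenvalue_def by blast
  have "f \<in> edge_fun.span {u}" if fm: "f \<in> eigenspace G l 0" for f
  proof -
    obtain c where "f = extend (\<lambda>e t. c)" using nonpositive_eigenfunction(1)[OF fm] by auto
    hence "f = fun_scale c u" unfolding u_def by (auto simp: extend_def fun_scale_def fun_eq_iff)
    thus ?thesis by (simp add: edge_fun.span_base edge_fun.span_scale)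
  qed
  thus "multiplicity_of G l 0 = 1" unfolding multiplicity_of_def
    using u u0 by (intro edge_fun.dim_unique[of "{u}"]) (auto simp: edge_fun.independent_insert edge_fun.span_empty)
qed

lemma no_negative_eigenvalue: "is_eigenvalue G l mu \<Longrightarrow> 0 \<le> mu"
  using nonpositive_eigenfunction(2)[of _ mu] unfolding is_eigenvalue_def by force

lemma sum_fun_apply: "(\<Sum>i\<in>A. F i :: 'b \<Rightarrow> real \<Rightarrow> real) e t = (\<Sum>i\<in>A. F i e t)"
  by (induction A rule: infinite_finite_induct) auto

lemma eigenfunction_wave:
  assumes "f \<in> eigenspace G l (k\<^sup>2)" "k \<noteq> 0"
  obtains A B g where "f = extend (\<lambda>e. wave k (A e) (B e))" 
    and "\<And>e. e \<in> arcs G \<Longrightarrow> wave k (A e) (B e) 0 = g (tail G e) \<and> wave k (A e) (B e) (l e) = g (head G e)"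
    and "\<And>w. (\<Sum>e\<in>arcs G. wave' k (A e) (B e) (l e) * w (head G e) - wave' k (A e) (B e) 0 * w (tail G e)) = 0"
proof -
  from assms obtain f' g where out: "\<And>e t. \<not> (e \<in> arcs G \<and> t \<in> {0..l e}) \<Longrightarrow> f e t = 0"
    and g: "\<And>e. e \<in> arcs G \<Longrightarrow> f e 0 = g (tail G e) \<and> f e (l e) = g (head G e)"
    and d: "\<And>e t. e \<in> arcs G \<Longrightarrow> t \<in> {0..l e} \<Longrightarrow> (f e has_real_derivative f' e t) (at t within {0..l e})"
      "\<And>e t. e \<in> arcs G \<Longrightarrow> t \<in> {0..l e} \<Longrightarrow> (f' e has_real_derivative - k\<^sup>2 * f e t) (at t within {0..l e})"
    and K: "\<forall>v\<in>verts G. (\<Sum>e\<in>out_arcs G v. f' e 0) - (\<Sum>e\<in>in_arcs G v. f' e (l e)) = 0"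
    unfolding eigenspace_def continuous_functions_def by blast
  define A B where "A e = f e 0" and "B e = f' e 0 / k" for e
  have w1: "f e t = wave k (A e) (B e) t" "f' e t = wave' k (A e) (B e) t" if "e \<in> arcs G" "t \<in> {0..l e}" for e t
    using harmonic_oscillator_is_wave[OF less_imp_le[OF length_pos[OF that(1)]] assms(2) d(1)[OF that(1)] d(2)[OF that(1)] that(2)] unfolding A_def B_def by auto
  show thesis
  proof (rule that)
    show "f = extend (\<lambda>e. wave k (A e) (B e))" using w1 out by (auto simp: extend_def fun_eq_iff)
    show "wave k (A e) (B e) 0 = g (tail G e) \<and> wave k (A e) (B e) (l e) = g (head G e)" if "e \<in> arcs G" for e
      using w1(1)[OF that, of 0] w1(1)[OF that, of "l e"] g[OF that] length_pos[OF that] by simp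
    fix w :: "'a \<Rightarrow> real"
    have "(\<Sum>e\<in>arcs G. f' e (l e) * w (head G e) - f' e 0 * w (tail G e)) = 0"
      using K unfolding kirchhoff_iff by blast
    also have "(\<Sum>e\<in>arcs G. f' e (l e) * w (head G e) - f' e 0 * w (tail G e)) = (\<Sum>e\<in>arcs G. wave' k (A e) (B e) (l e) * w (head G e) - wave' k (A e) (B e) 0 * w (tail G e))"
      using w1(2) length_pos by (intro sum.cong) (auto simp: less_imp_le)
    finally show "(\<Sum>e\<in>arcs G. wave' k (A e) (B e) (l e) * w (head G e) - wave' k (A e) (B e) 0 * w (tail G e)) = 0" .
  qed
qed

text \<open>
  The dimension of an infinite-dimensional space is 0 by convention, so a finite spanning set is needed: the
  sine and the cosine on each single edge.
\<close>
lemma multiplicity_pos: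
  assumes "is_eigenvalue G l mu"
  shows "1 \<le> multiplicity_of G l mu"
proof (cases "mu = 0")
  case True
  thus ?thesis using zero_eigenvalue by simp
next
  case False
  define k where "k = sqrt mu"
  have k: "k \<noteq> 0" "k\<^sup>2 = mu" using False no_negative_eigenvalue[OF assms] unfolding k_def by auto
  define C S where "C e = extend (\<lambda>e' t. if e' = e then cos (k * t) else 0)" 
    and "S e = extend (\<lambda>e' t. if e' = e then sin (k * t) else 0)" for e
  have span: "eigenspace G l mu \<subseteq> edge_fun.span (C ` arcs G \<union> S ` arcs G)"
  proof
    fix f assume "f \<in> eigenspace G l mu"
    then obtain A B g where f: "f = extend (\<lambda>e. wave k (A e) (B e))" using eigenfunction_wave[of f k] k by metis
    have "f = (\<Sum>e\<in>arcs G. fun_scale (A e) (C e) + fun_scale (B e) (S e))"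
    proof (intro ext)
      fix e t
      have "(\<Sum>i\<in>arcs G. fun_scale (A i) (C i) + fun_scale (B i) (S i)) e t 
          = (\<Sum>i\<in>arcs G. if e = i then A i * C i e t + B i * S i e t else 0)"
        unfolding sum_fun_apply by (intro sum.cong) (auto simp: fun_scale_def C_def S_def extend_def)
      also have "\<dots> = f e t" unfolding f by (auto simp: extend_def wave_def C_def S_def)
      finally show "f e t = (\<Sum>i\<in>arcs G. fun_scale (A i) (C i) + fun_scale (B i) (S i)) e t" by simp
    qed
    also have "\<dots> \<in> edge_fun.span (C ` arcs G \<union> S ` arcs G)"
      by (intro edge_fun.span_sum edge_fun.span_add edge_fun.span_scale edge_fun.span_base) auto
    finally show "f \<in> edge_fun.span (C ` arcs G \<union> S ` arcs G)" .
  qed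
  obtain f where f: "f \<in> eigenspace G l mu" "f \<noteq> 0" using assms unfolding is_eigenvalue_def by blast
  obtain W where W: "W \<subseteq> eigenspace G l mu" "edge_fun.independent W" "eigenspace G l mu \<subseteq> edge_fun.span W" "card W = edge_fun.dim (eigenspace G l mu)"
    using edge_fun.basis_exists by blast
  have "finite W" using edge_fun.independent_span_bound[of "C ` arcs G \<union> S ` arcs G" W] W span by auto
  moreover have "W \<noteq> {}" using W(3) f by (auto simp: edge_fun.span_empty)
  ultimately have "0 < card W" by (simp add: card_gt_0_iff)
  thus ?thesis unfolding multiplicity_of_def W(4)[symmetric] by simp
qed

end

section \<open>Sampling at the quarter points of the edges\<close>

context metric_graph begin

text \<open>
  Nodes are the vertices and the three inner quarter points of each edge.  Four pieces are enough: an edge is shorter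
  than the total length \<open>L\<close>, so for \<open>k \<le> 4 \<pi> / L\<close> every piece is shorter than \<open>\<pi> / k\<close>, where solutions
  are determined by their end values.
\<close>
definition node :: "'b \<Rightarrow> nat \<Rightarrow> 'a + 'b \<times> nat" where
  "node e m = (if m = 0 then Inl (tail G e) else if m = 4 then Inl (head G e) else Inr (e, m))"

definition nodes :: "('a + 'b \<times> nat) set" where
  "nodes = Inl ` verts G \<union> Inr ` (arcs G \<times> {1..3})"

lemma node_simps: "node e 0 = Inl (tail G e)" "node e 1 = Inr (e, 1)" "node e (Suc 0) = Inr (e, 1)" "node e 2 = Inr (e, 2)" "node e 3 = Inr (e, 3)" "node e 4 = Inl (head G e)"
  by (auto simp: node_def)

lemma finite_nodes: "finite nodes"
  unfolding nodes_def by auto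

lemma node_in_nodes: "e \<in> arcs G \<Longrightarrow> m \<le> 4 \<Longrightarrow> node e m \<in> nodes"
  unfolding node_def nodes_def by auto

lemma nodes_cases:
  assumes "p \<in> nodes" obtains e m where "e \<in> arcs G" "m \<le> 4" "p = node e m"
proof -
  consider v where "v \<in> verts G" "p = Inl v" | e m where "e \<in> arcs G" "m \<in> {1..3}" "p = Inr (e, m)"
    using assms unfolding nodes_def by auto
  thus thesis
  proof cases
    case (1 v)
    then obtain e where "e \<in> arcs G" "v = tail G e \<or> v = head G e" using vertex_on_arc by blast
    thus thesis using 1 that[of e 0] that[of e 4] by (auto simp: node_simps)
  next
    case (2 e m)
    thus thesis using that[of e m] by (auto simp: node_def)
  qed
qed

definition edge_form :: "real \<Rightarrow> 'b \<Rightarrow> ('a + 'b \<times> nat \<Rightarrow> real) \<Rightarrow> ('a + 'b \<times> nat \<Rightarrow> real) \<Rightarrow> real" where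
  "edge_form k e g g' = (\<Sum>m<4. piece_form k (l e / 4) (g (node e m)) (g (node e (Suc m))) (g' (node e m)) (g' (node e (Suc m))))"

definition energy_form :: "real \<Rightarrow> ('a + 'b \<times> nat \<Rightarrow> real) \<Rightarrow> ('a + 'b \<times> nat \<Rightarrow> real) \<Rightarrow> real" where
  "energy_form k g g' = (\<Sum>e\<in>arcs G. edge_form k e g g')"

lemma edge_form_sym: "edge_form k e g g' = edge_form k e g' g"
  unfolding edge_form_def piece_form_def by (intro sum.cong refl) (simp add: mult_ac add_ac)

lemma energy_form_sym: "energy_form k g g' = energy_form k g' g"
  unfolding energy_form_def by (intro sum.cong refl edge_form_sym)

lemma edge_form_cong:
  assumes "\<And>m. m \<le> 4 \<Longrightarrow> g (node e m) = h (node e m)" "\<And>m. m \<le> 4 \<Longrightarrow> g' (node e m) = h' (node e m)"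
  shows "edge_form k e g g' = edge_form k e h h'"
  unfolding edge_form_def using assms by (intro sum.cong) auto

lemma energy_form_cong:
  assumes "\<And>p. p \<in> nodes \<Longrightarrow> g p = h p" "\<And>p. p \<in> nodes \<Longrightarrow> g' p = h' p"
  shows "energy_form k g g' = energy_form k h h'"
  unfolding energy_form_def using assms node_in_nodes by (intro sum.cong edge_form_cong) auto

definition short :: "real \<Rightarrow> bool" where
  "short k \<longleftrightarrow> (\<forall>e\<in>arcs G. k * (l e / 4) < pi)"

lemma short_mono: "short k' \<Longrightarrow> k \<le> k' \<Longrightarrow> short k"
proof -
  assume *: "short k'" "k \<le> k'"
  have "k * (l e / 4) \<le> k' * (l e / 4)" if "e \<in> arcs G" for e
    using * length_pos[OF that] by (intro mult_right_mono) auto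
  thus "short k" using * unfolding short_def by fastforce
qed

lemma short_sin:
  assumes "short k" "0 < k" "e \<in> arcs G" shows "0 < sin (k * (l e / 4))"
  using assms length_pos[OF assms(3)] unfolding short_def by (intro sin_gt_zero) auto

text \<open>
  The boundary terms of the four pieces telescope, because the derivative of a wave is continuous along the edge.
\<close>
lemma edge_form_wave:
  assumes "short k" "0 < k" "e \<in> arcs G" and g: "\<And>m. m \<le> 4 \<Longrightarrow> g (node e m) = wave k A B (m * (l e / 4))"
  shows "edge_form k e g g' = wave' k A B (l e) * g' (Inl (head G e)) - wave' k A B 0 * g' (Inl (tail G e))"
proof -
  define D where "D m = wave' k A B (real m * (l e / 4)) * g' (node e m)" for m
  have "edge_form k e g g' = (\<Sum>m<4. D (Suc m) - D m)"
    unfolding edge_form_def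
  proof (intro sum.cong refl)
    fix m :: nat assume "m \<in> {..<4}"
    hence gm: "g (node e m) = wave k A B (m * (l e / 4))" "g (node e (Suc m)) = wave k A B (m * (l e / 4) + l e / 4)"
      using g[of m] g[of "Suc m"] by (auto simp: algebra_simps add_divide_distrib)
    have "real (Suc m) * (l e / 4) = m * (l e / 4) + l e / 4" by (simp add: algebra_simps)
    thus "piece_form k (l e / 4) (g (node e m)) (g (node e (Suc m))) (g' (node e m)) (g' (node e (Suc m))) = D (Suc m) - D m"
      unfolding gm D_def using short_sin[OF assms(1-3)] assms(2) by (simp only:) (intro piece_form_wave, auto)
  qed
  also have "\<dots> = D 4 - D 0" by (rule sum_lessThan_telescope)
  finally show ?thesis unfolding D_def by (simp add: node_simps)
qed

lemma edge_form_indicator: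
  assumes "e \<in> arcs G" "e' \<in> arcs G" "m \<in> {1..3}"
  shows "edge_form k e' g (\<lambda>p. if p = Inr (e, m) then 1 else 0) = (if e' = e then
     piece_form k (l e / 4) (g (node e (m - 1))) (g (node e m)) 0 1 + piece_form k (l e / 4) (g (node e m)) (g (node e (Suc m))) 1 0 else 0)"
proof (cases "e' = e")
  case False
  hence "node e' i \<noteq> Inr (e, m)" for i by (auto simp: node_def)
  thus ?thesis using False unfolding edge_form_def by (simp add: piece_form_def)
next
  case True
  have m: "m = 1 \<or> m = 2 \<or> m = 3" using assms(3) by auto
  have [simp]: "piece_form k h u v 0 0 = 0" for h u v by (simp add: piece_form_def)
  show ?thesis using m True unfolding edge_form_def
    by (auto simp: node_def numeral_eq_Suc)
qed

text \<open>
  Testing against the indicator of an inner node shows that the derivatives of the two adjacent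
  pieces agree there, so the pieces form one wave.
\<close>
lemma radical_wave:
  assumes "short k" "0 < k" and rad: "\<And>g'. energy_form k g g' = 0" and e: "e \<in> arcs G"
  defines "A \<equiv> g (node e 0)" and "B \<equiv> (g (node e 1) - g (node e 0) * cos (k * (l e / 4))) / sin (k * (l e / 4))"
  shows "m \<le> 4 \<Longrightarrow> g (node e m) = wave k A B (m * (l e / 4))"
proof -
  define h where "h = l e / 4"
  have s: "sin (k * h) \<noteq> 0" using short_sin[OF assms(1,2) e] unfolding h_def by simp
  have w01: "g (node e 0) = wave k A B 0" "g (node e 1) = wave k A B h"
    using wave_through[OF s, of "g (node e 0)" "g (node e 1)"] unfolding A_def B_def h_def by auto
  have inner: "piece_form k h (g (node e (m - 1))) (g (node e m)) 0 1 + piece_form k h (g (node e m)) (g (node e (Suc m))) 1 0 = 0"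
    if "m \<in> {1..3}" for m
  proof -
    have "0 = energy_form k g (\<lambda>p. if p = Inr (e, m) then 1 else 0)" using rad by simp
    also have "\<dots> = (\<Sum>e'\<in>arcs G. if e = e' then piece_form k (l e / 4) (g (node e (m - 1))) (g (node e m)) 0 1 + piece_form k (l e / 4) (g (node e m)) (g (node e (Suc m))) 1 0 else 0)"
      unfolding energy_form_def using edge_form_indicator[OF e _ that] by (intro sum.cong) auto
    also have "\<dots> = piece_form k h (g (node e (m - 1))) (g (node e m)) 0 1 + piece_form k h (g (node e m)) (g (node e (Suc m))) 1 0"
      using e by (simp add: h_def)
    finally show ?thesis by simp
  qed
  have step: "g (node e (Suc m)) = wave k A B (real m * h + h)" 
    if m: "m \<in> {1..3}" and prev: "g (node e (m - 1)) = wave k A B (real (m - 1) * h)" "g (node e m) = wave k A B (real m * h)" for m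
  proof -
    have mh: "real m * h = real (m - 1) * h + h" using m by (simp add: of_nat_diff algebra_simps)
    have "piece_form k h (g (node e (m - 1))) (g (node e m)) 0 1 = wave' k A B (real m * h)"
      unfolding prev mh using assms(2) s by (subst piece_form_wave) auto
    moreover have "piece_form k h (g (node e m)) (g (node e (Suc m))) 1 0 = k / sin (k * h) * (cos (k * h) * wave k A B (real m * h) - g (node e (Suc m)))"
      using assms(2) s by (subst piece_form_explicit) (auto simp: prev)
    ultimately have "k / sin (k * h) * (g (node e (Suc m)) - cos (k * h) * wave k A B (real m * h)) = wave' k A B (real m * h)"
      using inner[OF m] by (simp add: algebra_simps)
    hence "g (node e (Suc m)) = cos (k * h) * wave k A B (real m * h) + sin (k * h) * (wave' k A B (real m * h) / k)"
      using s assms(2) by (simp add: field_simps)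
    thus ?thesis unfolding wave_step(1) wave'_def using assms(2) by simp
  qed
  have "m \<le> 4 \<Longrightarrow> g (node e m) = wave k A B (real m * h) \<and> (m < 4 \<longrightarrow> g (node e (Suc m)) = wave k A B (real m * h + h))"
  proof (induction m)
    case 0
    then show ?case using w01 by simp
  next
    case (Suc m)
    hence IH: "g (node e m) = wave k A B (real m * h)" "g (node e (Suc m)) = wave k A B (real (Suc m) * h)" by (auto simp: algebra_simps)
    show ?case
    proof (intro conjI impI)
      show "g (node e (Suc m)) = wave k A B (real (Suc m) * h)" by fact
      assume "Suc m < 4"
      thus "g (node e (Suc (Suc m))) = wave k A B (real (Suc m) * h + h)" using IH by (intro step) auto
    qed
  qed
  thus "m \<le> 4 \<Longrightarrow> g (node e m) = wave k A B (m * (l e / 4))" unfolding h_def by simp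
qed

text \<open>
  Testing against functions on the vertices turns the vanishing of the form into the Kirchhoff conditions.
\<close>
lemma is_eigenvalue_iff_radical:
  assumes "short k" "0 < k"
  shows "is_eigenvalue G l (k\<^sup>2) \<longleftrightarrow> (\<exists>g. (\<exists>p\<in>nodes. g p \<noteq> 0) \<and> (\<forall>g'. energy_form k g g' = 0))"
proof
  assume "is_eigenvalue G l (k\<^sup>2)"
  then obtain f where f: "f \<in> eigenspace G l (k\<^sup>2)" "f \<noteq> 0" unfolding is_eigenvalue_def by blast
  obtain A B g where fw: "f = extend (\<lambda>e. wave k (A e) (B e))" 
    and ends: "\<And>e. e \<in> arcs G \<Longrightarrow> wave k (A e) (B e) 0 = g (tail G e) \<and> wave k (A e) (B e) (l e) = g (head G e)"
    and K: "\<And>w. (\<Sum>e\<in>arcs G. wave' k (A e) (B e) (l e) * w (head G e) - wave' k (A e) (B e) 0 * w (tail G e)) = 0"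
    using eigenfunction_wave[OF f(1)] assms(2) by blast
  define G' where "G' p = (case p of Inl v \<Rightarrow> g v | Inr (e, m) \<Rightarrow> wave k (A e) (B e) (real m * (l e / 4)))" for p
  have G': "G' (node e m) = wave k (A e) (B e) (real m * (l e / 4))" if "e \<in> arcs G" "m \<le> 4" for e m
    using ends[OF that(1)] that by (auto simp: G'_def node_def)
  have "energy_form k G' h = 0" for h
  proof -
    have "energy_form k G' h = (\<Sum>e\<in>arcs G. wave' k (A e) (B e) (l e) * h (Inl (head G e)) - wave' k (A e) (B e) 0 * h (Inl (tail G e)))"
      unfolding energy_form_def using edge_form_wave[OF assms] G' by (intro sum.cong) auto
    thus ?thesis using K[of "\<lambda>v. h (Inl v)"] by simp
  qed
  moreover have "\<exists>p\<in>nodes. G' p \<noteq> 0"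
  proof (rule ccontr)
    assume "\<not> ?thesis"
    hence z: "wave k (A e) (B e) (real m * (l e / 4)) = 0" if "e \<in> arcs G" "m \<le> 4" for e m
      using G'[OF that] node_in_nodes[OF that] by auto
    have "wave k (A e) (B e) t = 0" if "e \<in> arcs G" for e t
      using z[OF that, of 0] z[OF that, of 1] short_sin[OF assms that] by (simp add: wave_def)
    hence "f = 0" unfolding fw by (simp add: extend_def fun_eq_iff)
    thus False using f by simp
  qed
  ultimately show "\<exists>g. (\<exists>p\<in>nodes. g p \<noteq> 0) \<and> (\<forall>g'. energy_form k g g' = 0)" by blast
next
  assume "\<exists>g. (\<exists>p\<in>nodes. g p \<noteq> 0) \<and> (\<forall>g'. energy_form k g g' = 0)"
  then obtain g p where p: "p \<in> nodes" "g p \<noteq> 0" and rad: "\<And>g'. energy_form k g g' = 0" by blast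
  define A B where "A e = g (node e 0)" and "B e = (g (node e 1) - g (node e 0) * cos (k * (l e / 4))) / sin (k * (l e / 4))" for e
  have gw: "g (node e m) = wave k (A e) (B e) (m * (l e / 4))" if "e \<in> arcs G" "m \<le> 4" for e m
    using radical_wave[OF assms rad that] unfolding A_def B_def .
  have "extend (\<lambda>e. wave k (A e) (B e)) \<in> eigenspace G l (k\<^sup>2)"
  proof (rule extend_eigenfunction)
    show "wave k (A e) (B e) 0 = g (Inl (tail G e)) \<and> wave k (A e) (B e) (l e) = g (Inl (head G e))" if "e \<in> arcs G" for e
      using gw[OF that, of 0] gw[OF that, of 4] by (simp add: node_simps)
    show "(wave k (A e) (B e) has_real_derivative wave' k (A e) (B e) t) (at t)" for e t by (rule wave_deriv)
    show "(wave' k (A e) (B e) has_real_derivative - k\<^sup>2 * wave k (A e) (B e) t) (at t)" for e t by (rule wave_deriv)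
    have "(\<Sum>e\<in>arcs G. wave' k (A e) (B e) (l e) * w (head G e) - wave' k (A e) (B e) 0 * w (tail G e)) = 0" for w
    proof -
      have "0 = energy_form k g (\<lambda>p. case p of Inl v \<Rightarrow> w v | _ \<Rightarrow> 0)" using rad by simp
      also have "\<dots> = (\<Sum>e\<in>arcs G. wave' k (A e) (B e) (l e) * w (head G e) - wave' k (A e) (B e) 0 * w (tail G e))"
        unfolding energy_form_def using edge_form_wave[OF assms _ gw] by (intro sum.cong) auto
      finally show ?thesis by simp
    qed
    thus "\<forall>v\<in>verts G. (\<Sum>e\<in>out_arcs G v. wave' k (A e) (B e) 0) - (\<Sum>e\<in>in_arcs G v. wave' k (A e) (B e) (l e)) = 0"
      unfolding kirchhoff_iff by blast
  qed
  moreover obtain e m where em: "e \<in> arcs G" "m \<le> 4" "p = node e m" using nodes_cases[OF p(1)] .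
  have "real m * (l e / 4) \<le> 4 * (l e / 4)" using em length_pos[of e] by (intro mult_right_mono) auto
  hence "extend (\<lambda>e. wave k (A e) (B e)) e (real m * (l e / 4)) = g p" 
    using gw[OF em(1,2)] em length_pos[of e] by (simp add: extend_def)
  hence "extend (\<lambda>e. wave k (A e) (B e)) \<noteq> 0" using p(2) by auto
  ultimately show "is_eigenvalue G l (k\<^sup>2)" unfolding is_eigenvalue_def by blast
qed

text \<open>
  At \<open>k = 0\<close> the form is a weighted sum of squares of differences of adjacent values.
\<close>
lemma energy_form_zero_pos:
  assumes v: "v \<in> verts G" "g (Inl v) = 0" and p: "p \<in> nodes" "g p \<noteq> 0"
  shows "0 < energy_form 0 g g"
proof (rule ccontr)
  assume neg: "\<not> ?thesis"
  have pf: "piece_form 0 (l e / 4) a b a b = 4 / l e * (b - a)\<^sup>2" for e a b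
    by (simp add: piece_form_def cot_coeff_def tan_coeff_def power2_eq_square)
  have nn: "0 \<le> 4 / l e * (b - a)\<^sup>2" if "e \<in> arcs G" for e a b using length_pos[OF that] by simp
  have ef: "0 \<le> edge_form 0 e g g" if "e \<in> arcs G" for e
    unfolding edge_form_def pf using nn[OF that] by (intro sum_nonneg) auto
  hence "energy_form 0 g g = 0" using neg unfolding energy_form_def by (meson linorder_not_less order_antisym sum_nonneg)
  hence "edge_form 0 e g g = 0" if "e \<in> arcs G" for e
    using ef that sum_nonneg_eq_0_iff[of "arcs G" "\<lambda>e. edge_form 0 e g g"] unfolding energy_form_def by auto
  hence "4 / l e * (g (node e (Suc m)) - g (node e m))\<^sup>2 = 0" if "e \<in> arcs G" "m < 4" for e m
    using sum_nonneg_eq_0_iff[of "{..<4::nat}" "\<lambda>m. 4 / l e * (g (node e (Suc m)) - g (node e m))\<^sup>2"] nn[OF that(1)] that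
    unfolding edge_form_def pf by auto
  hence eq: "g (node e (Suc m)) = g (node e m)" if "e \<in> arcs G" "m < 4" for e m using that length_pos[of e] by fastforce
  have const: "m \<le> 4 \<longrightarrow> g (node e m) = g (Inl (tail G e))" if "e \<in> arcs G" for e m
    using eq[OF that] by (induction m) (auto simp: node_simps)
  have "g (Inl (tail G e)) = g (Inl (head G e))" if "e \<in> arcs G" for e
    using const[OF that, of 4] by (simp add: node_simps)
  note vc = constant_on_vertices[of "\<lambda>v. g (Inl v)", OF this]
  obtain e m where em: "e \<in> arcs G" "m \<le> 4" "p = node e m" using nodes_cases[OF p(1)] .
  have "g p = g (Inl (tail G e))" using const[OF em(1), of m] em by simp
  also have "\<dots> = g (Inl v)" using em(1) v(1) by (intro vc) auto
  finally show False using v p by simp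
qed

lemma energy_form_strict_antimono:
  assumes "short k'" "0 < k" "k < k'" and p: "p \<in> nodes" "g p \<noteq> 0"
  shows "energy_form k' g g < energy_form k g g"
proof -
  have h: "0 < l e / 4" "k' * (l e / 4) < pi" if "e \<in> arcs G" for e using assms(1) length_pos[OF that] that unfolding short_def by auto
  note mono = piece_form_strict_antimono[OF assms(2,3) h]
  have le: "edge_form k' e g g \<le> edge_form k e g g" if "e \<in> arcs G" for e
    unfolding edge_form_def using mono(1)[OF that that] by (intro sum_mono)
  obtain e m where em: "e \<in> arcs G" "m \<le> 4" "p = node e m" using nodes_cases[OF p(1)] .
  \<comment> \<open>A piece that has the node as an end.\<close>
  define m' where "m' = (if m = 4 then 3 else m)"
  have m': "m' < 4" "g (node e m') \<noteq> 0 \<or> g (node e (Suc m')) \<noteq> 0" using em p unfolding m'_def by auto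
  have "edge_form k' e g g < edge_form k e g g"
    unfolding edge_form_def
  proof (rule sum_strict_mono_ex1)
    show "\<exists>a\<in>{..<4}. piece_form k' (l e / 4) (g (node e a)) (g (node e (Suc a))) (g (node e a)) (g (node e (Suc a)))
      < piece_form k (l e / 4) (g (node e a)) (g (node e (Suc a))) (g (node e a)) (g (node e (Suc a)))"
      using m' by (intro bexI[of _ m'] mono(2)[OF em(1) em(1)]) auto
  qed (use mono(1)[OF em(1) em(1)] in auto)
  thus ?thesis unfolding energy_form_def using em(1) le by (intro sum_strict_mono_ex1) auto
qed

lemma energy_form_add: "energy_form k (\<lambda>p. g p + g2 p) h = energy_form k g h + energy_form k g2 h"
  unfolding energy_form_def edge_form_def piece_form_def sum.distrib[symmetric]
  by (intro sum.cong refl) (simp add: algebra_simps)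

lemma energy_form_scale: "energy_form k (\<lambda>p. c * g p) h = c * energy_form k g h"
  unfolding energy_form_def edge_form_def piece_form_def sum_distrib_left
  by (intro sum.cong refl) (simp add: algebra_simps)

lemma continuous_on_energy_form:
  assumes "short K"
  shows "continuous_on {0..K} (\<lambda>k. energy_form k g h)"
  unfolding energy_form_def edge_form_def using assms length_pos
  by (intro continuous_on_sum continuous_on_piece_form) (auto simp: short_def)

definition nonpositive_plane :: "real \<Rightarrow> bool" where
  "nonpositive_plane k \<longleftrightarrow> (\<exists>g h. (\<forall>c d. (\<forall>p\<in>nodes. c * g p + d * h p = 0) \<longrightarrow> c = 0 \<and> d = 0) \<and>
     energy_form k g g \<le> 0 \<and> energy_form k h h \<le> 0 \<and> (energy_form k g h)\<^sup>2 \<le> energy_form k g g * energy_form k h h)"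

text \<open>
  The type \<open>'p\<close> only provides a Euclidean space whose coordinates are the nodes.
\<close>
lemma singular_parameters:
  fixes \<iota> :: "'p::finite \<Rightarrow> 'a + 'b \<times> nat"
  assumes bij: "bij_betw \<iota> UNIV nodes" and short: "short K" and K: "0 < K"
  shows "finite {k \<in> {0<..K}. is_eigenvalue G l (k\<^sup>2)}"
    and "nonpositive_plane K \<Longrightarrow> \<exists>k\<in>{0<..K}. is_eigenvalue G l (k\<^sup>2)"
proof -
  define val where "val x p = x $ inv_into UNIV \<iota> p" for x :: "real ^ 'p" and p
  define vec where "vec g = (\<chi> i. g (\<iota> i))" for g :: "'a + 'b \<times> nat \<Rightarrow> real"
  have inj: "inj \<iota>" and img: "range \<iota> = nodes" using bij unfolding bij_betw_def by auto
  have val_vec: "val (vec g) p = g p" if "p \<in> nodes" for g p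
    unfolding val_def vec_def using that img by (simp add: f_inv_into_f)
  have val_at: "val x (\<iota> i) = x $ i" for x i unfolding val_def using inj by (simp add: inv_into_f_f)
  define B where "B k x y = energy_form k (val x) (val y)" for k x y
  have B_vec: "B k x (vec g) = energy_form k (val x) g" for k x g
    unfolding B_def by (intro energy_form_cong) (auto simp: val_vec)
  have B_vec2: "B k (vec h) (vec g) = energy_form k h g" for k h g
    unfolding B_def by (intro energy_form_cong) (auto simp: val_vec)
  have val_lin: "val (x + y) = (\<lambda>p. val x p + val y p)" "val (c *\<^sub>R x) = (\<lambda>p. c * val x p)" for x y c
    unfolding val_def by auto
  have lin: "linear (\<lambda>x. B k x y)" for k y
  proof (rule linearI)
    show "B k (x1 + x2) y = B k x1 y + B k x2 y" for x1 x2 unfolding B_def val_lin(1) by (rule energy_form_add)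
    show "B k (c *\<^sub>R x) y = c *\<^sub>R B k x y" for c x unfolding B_def val_lin(2) energy_form_scale by simp
  qed
  have sym: "B k x y = B k y x" for k x y unfolding B_def by (rule energy_form_sym)
  have bil: "bilinear (B k)" for k
  proof -
    have eq: "B k x = (\<lambda>y. B k y x)" for x by (rule ext) (rule sym)
    have "linear (B k x)" for x by (subst eq) (rule lin)
    thus ?thesis unfolding bilinear_def using lin by blast
  qed
  have nz: "\<exists>p\<in>nodes. val x p \<noteq> 0" if "x \<noteq> 0" for x
  proof -
    obtain i where "x $ i \<noteq> 0" using \<open>x \<noteq> 0\<close> by (auto simp: vec_eq_iff)
    thus ?thesis using val_at[of x i] img by (intro bexI[of _ "\<iota> i"]) auto
  qed
  have rad: "is_eigenvalue G l (k\<^sup>2) \<longleftrightarrow> (\<exists>x. x \<noteq> 0 \<and> (\<forall>y. B k x y = 0))" if "k \<in> {0<..K}" for k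
  proof -
    have k: "short k" "0 < k" using that short short_mono[of K k] by auto
    show ?thesis unfolding is_eigenvalue_iff_radical[OF k]
    proof
      assume "\<exists>g. (\<exists>p\<in>nodes. g p \<noteq> 0) \<and> (\<forall>g'. energy_form k g g' = 0)"
      then obtain g p where g: "p \<in> nodes" "g p \<noteq> 0" "\<And>g'. energy_form k g g' = 0" by blast
      have "vec g \<noteq> 0" using g val_vec[of p g] by (auto simp: val_def)
      moreover have "B k (vec g) y = 0" for y
        unfolding B_def using g(3)[of "val y"] energy_form_cong[of "val (vec g)" g "val y" "val y" k] val_vec by auto
      ultimately show "\<exists>x. x \<noteq> 0 \<and> (\<forall>y. B k x y = 0)" by blast
    next
      assume "\<exists>x. x \<noteq> 0 \<and> (\<forall>y. B k x y = 0)"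
      then obtain x where x: "x \<noteq> 0" "\<And>y. B k x y = 0" by blast
      have "energy_form k (val x) g' = 0" for g' using B_vec[of k x g'] x(2) by simp
      thus "\<exists>g. (\<exists>p\<in>nodes. g p \<noteq> 0) \<and> (\<forall>g'. energy_form k g g' = 0)"
        using nz[OF x(1)] by blast
    qed
  qed
  have "finite {k \<in> {0<..K}. \<exists>x. x \<noteq> 0 \<and> (\<forall>y. B k x y = 0)}"
  proof (rule finite_singular_decreasing[OF bil sym])
    fix k k' x assume k: "k \<in> {0<..K}" "k' \<in> {0<..K}" "k < k'" and "x \<noteq> (0 :: real ^ 'p)"
    obtain p where "p \<in> nodes" "val x p \<noteq> 0" using nz[OF \<open>x \<noteq> 0\<close>] by blast
    thus "B k' x x < B k x x" unfolding B_def using k short short_mono[of K k'] by (intro energy_form_strict_antimono) auto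
  qed
  also have "{k \<in> {0<..K}. \<exists>x. x \<noteq> 0 \<and> (\<forall>y. B k x y = 0)} = {k \<in> {0<..K}. is_eigenvalue G l (k\<^sup>2)}"
    using rad by blast
  finally show "finite {k \<in> {0<..K}. is_eigenvalue G l (k\<^sup>2)}" .
  assume "nonpositive_plane K"
  then obtain g h where ind: "\<And>c d. (\<forall>p\<in>nodes. c * g p + d * h p = 0) \<Longrightarrow> c = 0 \<and> d = 0"
    and np: "energy_form K g g \<le> 0" "energy_form K h h \<le> 0" "(energy_form K g h)\<^sup>2 \<le> energy_form K g g * energy_form K h h"
    unfolding nonpositive_plane_def by blast
  have plane: "nsd_plane (B K)" unfolding nsd_plane_def
  proof (intro exI conjI allI impI)
    fix c d assume "c *\<^sub>R vec g + d *\<^sub>R vec h = 0"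
    hence "val (c *\<^sub>R vec g + d *\<^sub>R vec h) p = 0" for p by (simp add: val_def)
    hence "c * val (vec g) p + d * val (vec h) p = 0" for p by (simp only: val_lin)
    hence "\<forall>p\<in>nodes. c * g p + d * h p = 0" using val_vec by metis
    from ind[OF this] show "c = 0" "d = 0" by auto
  qed (use np in \<open>auto simp: B_vec2\<close>)
  obtain v where v: "v \<in> verts G" using verts_nonempty by auto
  hence "Inl v \<in> range \<iota>" unfolding img nodes_def by auto
  then obtain i where i: "\<iota> i = Inl v" by auto
  have "\<exists>k\<in>{0<..K}. \<exists>x. x \<noteq> 0 \<and> (\<forall>y. B k x y = 0)"
  proof (rule bilinear_family_becomes_singular[where B = B and z = "axis i 1", OF bil sym _ _ _ plane])
    show "continuous_on {0..K} (\<lambda>k. B k x y)" for x y unfolding B_def by (rule continuous_on_energy_form[OF short])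
    fix x :: "real ^ 'p" assume x: "x \<bullet> axis i 1 = 0" "x \<noteq> 0"
    have "val x (Inl v) = 0" using x(1) val_at[of x i] i by (simp add: inner_axis)
    thus "0 < B 0 x x" unfolding B_def using nz[OF x(2)] energy_form_zero_pos[OF v] by blast
  qed (use K in simp)
  thus "\<exists>k\<in>{0<..K}. is_eigenvalue G l (k\<^sup>2)" using rad by blast
qed

text \<open>
  The eigenvalues up to \<open>K\<^sup>2\<close> form a finite set that contains 0 and another element.  Hence the least bound with
  two eigenvalues below it exists, and it is one of them.
\<close>
lemma first_eigenvalue:
  fixes \<iota> :: "'p::finite \<Rightarrow> 'a + 'b \<times> nat"
  assumes bij: "bij_betw \<iota> UNIV nodes" and short: "short K" and K: "0 < K" and plane: "nonpositive_plane K"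
  shows "eigenvalue 1 G l \<le> K\<^sup>2" and "2 \<le> eigenvalue_count G l (eigenvalue 1 G l)"
proof -
  define E where "E x = {mu. is_eigenvalue G l mu \<and> mu \<le> x}" for x
  have cnt: "eigenvalue_count G l x = (\<Sum>mu\<in>E x. multiplicity_of G l mu)" for x unfolding eigenvalue_count_def E_def ..
  have "E (K\<^sup>2) \<subseteq> insert 0 ((\<lambda>k. k\<^sup>2) ` {k \<in> {0<..K}. is_eigenvalue G l (k\<^sup>2)})"
  proof
    fix mu assume mu: "mu \<in> E (K\<^sup>2)"
    hence nn: "0 \<le> mu" unfolding E_def using no_negative_eigenvalue by auto
    show "mu \<in> insert 0 ((\<lambda>k. k\<^sup>2) ` {k \<in> {0<..K}. is_eigenvalue G l (k\<^sup>2)})"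
    proof (cases "mu = 0")
      case False
      have "sqrt mu \<le> K" using mu K unfolding E_def by (simp add: real_le_lsqrt)
      hence "sqrt mu \<in> {k \<in> {0<..K}. is_eigenvalue G l (k\<^sup>2)}" using False nn mu by (auto simp: E_def)
      hence "(sqrt mu)\<^sup>2 \<in> (\<lambda>k. k\<^sup>2) ` {k \<in> {0<..K}. is_eigenvalue G l (k\<^sup>2)}" by (rule imageI)
      thus ?thesis using nn by simp
    qed simp
  qed
  hence fin: "finite (E (K\<^sup>2))" using singular_parameters(1)[OF bij short K] by (meson finite_imageI finite_insert finite_subset)
  have finE: "finite (E x)" if "x \<le> K\<^sup>2" for x
    using fin by (rule finite_subset[rotated]) (use that in \<open>auto simp: E_def\<close>)
  obtain k where k: "k \<in> {0<..K}" "is_eigenvalue G l (k\<^sup>2)" using singular_parameters(2)[OF bij short K plane] by blast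
  have "2 \<le> (\<Sum>mu\<in>{0, k\<^sup>2}. multiplicity_of G l mu)"
    using multiplicity_pos[OF zero_eigenvalue(1)] multiplicity_pos[OF k(2)] k(1) by simp
  also have "\<dots> \<le> eigenvalue_count G l (K\<^sup>2)"
    unfolding cnt using k zero_eigenvalue by (intro sum_mono2 fin) (auto simp: E_def power_mono)
  finally have two: "2 \<le> eigenvalue_count G l (K\<^sup>2)" .
  define M where "M = {mu \<in> E (K\<^sup>2). 2 \<le> eigenvalue_count G l mu}"
  have down: "\<exists>mu\<in>M. mu \<le> x" if x: "x \<le> K\<^sup>2" "2 \<le> eigenvalue_count G l x" for x
  proof -
    have ne: "E x \<noteq> {}" using x(2) unfolding cnt by auto
    define m where "m = Max (E x)"
    have m: "m \<in> E x" unfolding m_def using finE[OF x(1)] ne by (rule Max_in)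
    have "E m = E x" using m finE[OF x(1)] unfolding m_def by (auto simp: E_def intro: order_trans)
    hence "eigenvalue_count G l m = eigenvalue_count G l x" unfolding cnt by simp
    thus ?thesis using m x by (intro bexI[of _ m]) (auto simp: M_def E_def)
  qed
  have finM: "finite M" unfolding M_def using fin by simp
  have neM: "M \<noteq> {}" using down[OF order_refl two] by auto
  have mM: "Min M \<in> M" using finM neM by (rule Min_in)
  have ev: "eigenvalue 1 G l = Min M" unfolding eigenvalue_def
  proof (rule Least_equality)
    show "1 + 1 \<le> eigenvalue_count G l (Min M)" using mM unfolding M_def by simp
    fix x assume x: "1 + 1 \<le> eigenvalue_count G l x"
    show "Min M \<le> x"
    proof (cases "x \<le> K\<^sup>2")
      case True
      then obtain mu where "mu \<in> M" "mu \<le> x" using down[of x] x by auto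
      thus ?thesis using Min_le[OF finM] by (meson order_trans)
    next
      case False
      thus ?thesis using mM unfolding M_def E_def by auto
    qed
  qed
  show "eigenvalue 1 G l \<le> K\<^sup>2" "2 \<le> eigenvalue_count G l (eigenvalue 1 G l)"
    using mM unfolding ev M_def E_def by auto
qed

lemma first_eigenvalue_ge:
  assumes "2 \<le> eigenvalue_count G l (eigenvalue 1 G l)" "0 \<le> K"
    and none: "\<And>k. 0 < k \<Longrightarrow> k < K \<Longrightarrow> \<not> is_eigenvalue G l (k\<^sup>2)"
  shows "K\<^sup>2 \<le> eigenvalue 1 G l"
proof (rule ccontr)
  define x where "x = eigenvalue 1 G l"
  assume "\<not> K\<^sup>2 \<le> eigenvalue 1 G l"
  hence x: "x < K\<^sup>2" unfolding x_def by simp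
  have "{mu. is_eigenvalue G l mu \<and> mu \<le> x} \<subseteq> {0}"
  proof
    fix mu assume mu: "mu \<in> {mu. is_eigenvalue G l mu \<and> mu \<le> x}"
    hence nn: "0 \<le> mu" using no_negative_eigenvalue by auto
    have "sqrt mu < K" using mu x assms(2) by (intro real_less_lsqrt) auto
    thus "mu \<in> {0}" using none[of "sqrt mu"] mu nn by (cases "mu = 0") auto
  qed
  hence "eigenvalue_count G l x \<le> (\<Sum>mu\<in>{0}. multiplicity_of G l mu)"
    unfolding eigenvalue_count_def by (intro sum_mono2) auto
  thus False using assms(1) zero_eigenvalue unfolding x_def by simp
qed

end

section \<open>A polynomial inequality for three pairs of numbers\<close>

text \<open>
  The square of \<open>c - (al - be) y / z\<close> absorbs the possibly negative coefficient of \<open>y\<close> when \<open>be\<close> is the smaller one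
  of \<open>be\<close> and \<open>ga\<close>.  The constant \<open>c = 2 ga (1 - al)\<close> is chosen such that \<open>- c (al - be)\<close> is a lower bound of that
  coefficient and \<open>c\<^sup>2 / 2\<close> is a lower bound of the coefficient of \<open>z\<close>.
\<close>
lemma group_bound:
  fixes al be ga y z :: real
  assumes al: "0 \<le> al" "al \<le> 1" and be: "0 \<le> be" "be \<le> ga" and ga: "ga \<le> 1" and "0 < y" "0 < z"
  defines "t \<equiv> al * (al - 2 * be - 2 * ga + (al * be + be * ga + ga * al))"
  shows "0 \<le> y * (5/2 * be + t) + z * (5/2 * ga + t) + (al - be)\<^sup>2 * y\<^sup>2 / (2 * z)"
proof -
  define c where "c = 2 * ga * (1 - al)"
  have "0 \<le> al\<^sup>2 * (1 - ga) + be * ((1 - al)\<^sup>2 + (3/2 - 2 * ga + 3 * al * ga))"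
  proof -
    have "0 \<le> (1 - al)\<^sup>2 + (3/2 - 2 * ga + 3 * al * ga)"
    proof -
      have "(1 - al)\<^sup>2 + (3/2 - 2 * ga + 3 * al * ga) = (1 - ga) * ((1 - al)\<^sup>2 + 3/2) + ga * (1/2 + al + al\<^sup>2)"
        by algebra
      thus ?thesis using al be ga by (simp add: add_nonneg_nonneg)
    qed
    thus ?thesis using be ga by simp
  qed
  also have "\<dots> = 5/2 * be + t + c * (al - be)"
    unfolding t_def c_def by algebra
  finally have p: "- c * (al - be) \<le> 5/2 * be + t" by simp
  have "0 \<le> 5/2 * ga - 2 * ga\<^sup>2 + al\<^sup>2 * (1 + 2 * ga - 2 * ga\<^sup>2) + al * (5 * ga\<^sup>2 - 4 * ga) + al * (2 - al - ga) * (ga - be)"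
  proof -
    have "0 \<le> al * (2 - al - ga) * (ga - be)" using al be ga by simp
    moreover have "0 \<le> 5/2 * ga - 2 * ga\<^sup>2 + al\<^sup>2 * (1 + 2 * ga - 2 * ga\<^sup>2) + al * (5 * ga\<^sup>2 - 4 * ga)"
    proof -
      have "0 \<le> (al - ga * (4 - 5 * ga) / 2)\<^sup>2 + ga / 4 * ((1 - ga) * ((5 * ga - 3/2)\<^sup>2 + 27/4) + 1) + 2 * al\<^sup>2 * ga * (1 - ga)"
        using al be ga by (intro add_nonneg_nonneg mult_nonneg_nonneg) auto
      also have "\<dots> = 5/2 * ga - 2 * ga\<^sup>2 + al\<^sup>2 * (1 + 2 * ga - 2 * ga\<^sup>2) + al * (5 * ga\<^sup>2 - 4 * ga)"
        by algebra
      finally show ?thesis .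
    qed
    ultimately show ?thesis by linarith
  qed
  also have "\<dots> = 5/2 * ga + t - c\<^sup>2 / 2"
    unfolding t_def c_def by algebra
  finally have q: "c\<^sup>2 / 2 \<le> 5/2 * ga + t" by simp
  have "0 \<le> z / 2 * (c - (al - be) * y / z)\<^sup>2" using assms by simp
  also have "\<dots> = y * (- c * (al - be)) + z * (c\<^sup>2 / 2) + (al - be)\<^sup>2 * y\<^sup>2 / (2 * z)"
    using assms by (simp add: power2_eq_square field_simps)
  also have "\<dots> \<le> y * (5/2 * be + t) + z * (5/2 * ga + t) + (al - be)\<^sup>2 * y\<^sup>2 / (2 * z)"
    using p q assms by (intro add_mono mult_left_mono) auto
  finally show ?thesis .
qed

lemma group_bound_sym:
  fixes al be ga y z :: real
  assumes al: "0 \<le> al" "al \<le> 1" and be: "0 \<le> be" "be \<le> 1" and ga: "0 \<le> ga" "ga \<le> 1" and yz: "0 < y" "0 < z"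
  defines "t \<equiv> al * (al - 2 * be - 2 * ga + (al * be + be * ga + ga * al))"
  shows "0 \<le> y^2 * z * (5/2 * be + t) + y * z^2 * (5/2 * ga + t) + (al - be)\<^sup>2 * y^3 / 2 + (al - ga)\<^sup>2 * z^3 / 2"
proof -
  have main: "0 \<le> y^2 * z * (5/2 * be + al * (al - 2 * be - 2 * ga + (al * be + be * ga + ga * al)))
      + y * z^2 * (5/2 * ga + al * (al - 2 * be - 2 * ga + (al * be + be * ga + ga * al))) + (al - be)\<^sup>2 * y^3 / 2"
    if "0 \<le> be" "be \<le> ga" "ga \<le> 1" "0 < y" "0 < z" for be ga y z
  proof -
    have "0 \<le> (y * z) * (y * (5/2 * be + al * (al - 2 * be - 2 * ga + (al * be + be * ga + ga * al)))
      + z * (5/2 * ga + al * (al - 2 * be - 2 * ga + (al * be + be * ga + ga * al))) + (al - be)\<^sup>2 * y\<^sup>2 / (2 * z))"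
      using group_bound[OF al that] that by simp
    also have "\<dots> = y^2 * z * (5/2 * be + al * (al - 2 * be - 2 * ga + (al * be + be * ga + ga * al)))
      + y * z^2 * (5/2 * ga + al * (al - 2 * be - 2 * ga + (al * be + be * ga + ga * al))) + (al - be)\<^sup>2 * y^3 / 2"
      using that(5) by (simp add: field_simps power2_eq_square power3_eq_cube)
    finally show ?thesis .
  qed
  show ?thesis
  proof (cases "be \<le> ga")
    case True
    have "0 \<le> (al - ga)\<^sup>2 * z^3 / 2" using yz by simp
    with main[of be ga y z] True be ga yz show ?thesis unfolding t_def by linarith
  next
    case False
    have "0 \<le> (al - be)\<^sup>2 * y^3 / 2" using yz by simp
    moreover have t: "t = al * (al - 2 * ga - 2 * be + (al * ga + ga * be + be * al))"
      unfolding t_def by (simp add: algebra_simps)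
    have "0 \<le> z^2 * y * (5/2 * ga + t) + z * y^2 * (5/2 * be + t) + (al - ga)\<^sup>2 * z^3 / 2"
      unfolding t using main[of ga be z y] False be ga yz by simp
    moreover have "z\<^sup>2 * y * (5/2 * ga + t) = y * z\<^sup>2 * (5/2 * ga + t)"
      "z * y\<^sup>2 * (5/2 * be + t) = y\<^sup>2 * z * (5/2 * be + t)" by auto
    ultimately show ?thesis by linarith
  qed
qed

text \<open>
  For \<open>be = t ga\<close> with \<open>t \<le> 1\<close> the quotient by \<open>ga\<^sup>2\<close> is expanded at \<open>ga = 1\<close>, where it is \<open>(1 - t) (1 / 2 + t)\<close>.
\<close>
lemma slack_polynomial_nonneg:
  fixes be ga :: real
  assumes "0 \<le> be" "be \<le> 1" "0 \<le> ga" "ga \<le> 1"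
  shows "0 \<le> 5/2*(be^2+ga^2) - 2*(be^3+ga^3) - 7/2*be*ga*(be+ga) + 2*be^2*ga^2*(1-be-ga) + 4*be*ga*(be^2+ga^2)" (is "0 \<le> ?f be ga")
proof -
  have main: "0 \<le> ?f be ga" if "0 \<le> be" "be \<le> ga" "ga \<le> 1" "0 < ga" for be ga :: real
  proof -
    define t w where "t = be / ga" and "w = 1 - ga"
    have t: "0 \<le> t" "t \<le> 1" and w: "0 \<le> w" "w \<le> 1" and eq: "be = t * ga" "ga = 1 - w"
      using that by (auto simp: t_def w_def)
    have A: "0 \<le> (1 - t) * (1/2 + t)" using t by simp
    have "0 \<le> (7/2) * (t - 9/14)\<^sup>2 + 31/56 + 2 * t^2 * (1 - t * w)"
      using t w by (intro add_nonneg_nonneg mult_nonneg_nonneg) (auto simp: mult_le_one)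
    then have B: "0 \<le> w * ((7/2) * (t - 9/14)\<^sup>2 + 31/56 + 2 * t^2 * (1 - t * w))"
      using w by (intro mult_nonneg_nonneg) auto
    have C: "0 \<le> w^2 * (4 * t * (1 - t)) + w^3 * (2 * t^2 + 2 * t^3)"
      using t w by (intro add_nonneg_nonneg mult_nonneg_nonneg) auto
    have "0 \<le> ga^2 * ((1 - t) * (1/2 + t) + w * ((7/2) * (t - 9/14)\<^sup>2 + 31/56 + 2 * t^2 * (1 - t * w)) + (w^2 * (4 * t * (1 - t)) + w^3 * (2 * t^2 + 2 * t^3)))"
      by (rule mult_nonneg_nonneg[OF zero_le_power2 add_nonneg_nonneg[OF add_nonneg_nonneg[OF A B] C]])
    also have "\<dots> = ?f be ga" unfolding eq by algebra
    finally show ?thesis .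
  qed
  show ?thesis
  proof (cases "be \<le> ga")
    case True
    then show ?thesis using main[of be ga] assms by (cases "ga = 0") auto
  next
    case False
    then show ?thesis using main[of ga be] assms by (simp add: algebra_simps)
  qed
qed

text \<open>
  For three pairs \<open>s, s'\<close> of numbers let \<open>x, y, z\<close> be the sums and \<open>a, b, c\<close> the products.  Then \<open>odd_e3\<close> and \<open>odd_e5\<close>
  are the third and fifth elementary symmetric polynomials of the six numbers.  The first matching is admissible if
  \<open>(y + z) odd_e5 \<le> x (y c + z b) + 4 b c\<close>; the sums of the right hand sides and of the factors \<open>y + z\<close> over the three
  matchings, with the weights \<open>x\<^sup>2, y\<^sup>2, z\<^sup>2\<close>, are \<open>weighted_gain\<close> and \<open>weight_total\<close>.
\<close>
definition "weighted_gain x y z a b c = a*y*z*(y^2+z^2) + b*x*z*(x^2+z^2) + c*x*y*(x^2+y^2) + 4*(b*c*x^2+c*a*y^2+a*b*z^2)" for x y z a b c :: real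
definition "weight_total x y z = x^2*(y+z)+y^2*(x+z)+z^2*(x+y)" for x y z :: real
definition "odd_e5 x y z a b c = x*b*c+y*c*a+z*a*b" for x y z a b c :: real
definition "odd_e3 x y z a b c = x*y*z + a*(y+z)+b*(x+z)+c*(x+y)" for x y z a b c :: real
text \<open>
  The products are written as \<open>a = al x\<^sup>2 / 4\<close> and so on.  Here \<open>al \<le> 1\<close> is the inequality
  between the arithmetic and the geometric mean, and \<open>al < 0\<close> means that the two numbers have opposite signs.
\<close>
definition "norm_gain x y z al be ga = al*x*(y^2+z^2)+be*y*(x^2+z^2)+ga*z*(x^2+y^2)+x*y*z*(al*be+be*ga+ga*al)" for x y z al be ga :: real
definition "norm_e3 x y z al be ga = al*x^2*(y+z)+be*y^2*(x+z)+ga*z^2*(x+y)" for x y z al be ga :: real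
definition "norm_e5 x y z al be ga = be*ga*y*z+ga*al*x*z+al*be*x*y" for x y z al be ga :: real

lemma norm_substitution:
  shows "weighted_gain x y z (al*x^2/4) (be*y^2/4) (ga*z^2/4) = x*y*z/4 * norm_gain x y z al be ga" 
    "weight_total x y z * odd_e3 x y z (al*x^2/4) (be*y^2/4) (ga*z^2/4) - weighted_gain x y z (al*x^2/4) (be*y^2/4) (ga*z^2/4)
       = (4*weight_total x y z*(x*y*z)+weight_total x y z*norm_e3 x y z al be ga - x*y*z*norm_gain x y z al be ga)/4"
    "odd_e5 x y z (al*x^2/4) (be*y^2/4) (ga*z^2/4) = x*y*z/16 * norm_e5 x y z al be ga"
  unfolding norm_gain_def norm_e3_def norm_e5_def weighted_gain_def weight_total_def odd_e5_def odd_e3_def 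
  by (simp_all add: field_simps power2_eq_square)

text \<open>
  Up to multiples of \<open>x y z\<close>, the expression is the sum of \<open>(al - be)\<^sup>2 x\<^sup>3 y\<^sup>3\<close> and its two analogues.  Apart from a positive
  term, the rest can be collected with the factors \<open>x\<^sup>3, y\<^sup>3, z\<^sup>3\<close>, with half of each square in either of its groups, so
  that each group is an instance of \<open>group_bound_sym\<close>.
\<close>
lemma norm_inequality_nonneg:
  fixes x y z al be ga :: real
  assumes "0 < x" "0 < y" "0 < z" "0 \<le> al" "al \<le> 1" "0 \<le> be" "be \<le> 1" "0 \<le> ga" "ga \<le> 1"
  shows "0 \<le> norm_gain x y z al be ga" 
    "0 \<le> norm_gain x y z al be ga * norm_e3 x y z al be ga - norm_e5 x y z al be ga * (x+y+z) * weight_total x y z + 5/2 * (x*y*z) * norm_gain x y z al be ga"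
proof -
  show "0 \<le> norm_gain x y z al be ga" unfolding norm_gain_def using assms by simp
  define e where "e = al*be+be*ga+ga*al"
  note g1 = group_bound_sym[of al be ga y z]
  note g2 = group_bound_sym[of be ga al z x]
  note g3 = group_bound_sym[of ga al be x y]
  have A: "0 \<le> x^3 * (y^2 * z * (5/2 * be + al * (al - 2 * be - 2 * ga + (al * be + be * ga + ga * al))) + y * z^2 * (5/2 * ga + al * (al - 2 * be - 2 * ga + (al * be + be * ga + ga * al))) + (al - be)\<^sup>2 * y^3 / 2 + (al - ga)\<^sup>2 * z^3 / 2)"
    using g1 assms by (intro mult_nonneg_nonneg) auto
  have B: "0 \<le> y^3 * (z^2 * x * (5/2 * ga + be * (be - 2 * ga - 2 * al + (be * ga + ga * al + al * be))) + z * x^2 * (5/2 * al + be * (be - 2 * ga - 2 * al + (be * ga + ga * al + al * be))) + (be - ga)\<^sup>2 * z^3 / 2 + (be - al)\<^sup>2 * x^3 / 2)"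
    using g2 assms by (intro mult_nonneg_nonneg) auto
  have C: "0 \<le> z^3 * (x^2 * y * (5/2 * al + ga * (ga - 2 * al - 2 * be + (ga * al + al * be + be * ga))) + x * y^2 * (5/2 * be + ga * (ga - 2 * al - 2 * be + (ga * al + al * be + be * ga))) + (ga - al)\<^sup>2 * x^3 / 2 + (ga - be)\<^sup>2 * y^3 / 2)"
    using g3 assms by (intro mult_nonneg_nonneg) auto
  have D: "0 \<le> 5/2 * (x*y*z)^2 * e" unfolding e_def using assms by simp
  have "norm_gain x y z al be ga * norm_e3 x y z al be ga - norm_e5 x y z al be ga * (x+y+z) * weight_total x y z + 5/2 * (x*y*z) * norm_gain x y z al be ga
     = x^3 * (y^2 * z * (5/2 * be + al * (al - 2 * be - 2 * ga + (al * be + be * ga + ga * al))) + y * z^2 * (5/2 * ga + al * (al - 2 * be - 2 * ga + (al * be + be * ga + ga * al))) + (al - be)\<^sup>2 * y^3 / 2 + (al - ga)\<^sup>2 * z^3 / 2)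
     + y^3 * (z^2 * x * (5/2 * ga + be * (be - 2 * ga - 2 * al + (be * ga + ga * al + al * be))) + z * x^2 * (5/2 * al + be * (be - 2 * ga - 2 * al + (be * ga + ga * al + al * be))) + (be - ga)\<^sup>2 * z^3 / 2 + (be - al)\<^sup>2 * x^3 / 2)
     + z^3 * (x^2 * y * (5/2 * al + ga * (ga - 2 * al - 2 * be + (ga * al + al * be + be * ga))) + x * y^2 * (5/2 * be + ga * (ga - 2 * al - 2 * be + (ga * al + al * be + be * ga))) + (ga - al)\<^sup>2 * x^3 / 2 + (ga - be)\<^sup>2 * y^3 / 2)
     + 5/2 * (x*y*z)^2 * e"
    unfolding norm_gain_def norm_e3_def norm_e5_def weight_total_def e_def by (simp add: algebra_simps power2_eq_square power3_eq_cube)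
  with A B C D show "0 \<le> norm_gain x y z al be ga * norm_e3 x y z al be ga - norm_e5 x y z al be ga * (x+y+z) * weight_total x y z + 5/2 * (x*y*z) * norm_gain x y z al be ga" by linarith
qed

text \<open>
  With \<open>al = - u < 0\<close>, the group of \<open>y\<^sup>3\<close> can be negative by \<open>u\<close> times \<open>deficit\<close>, and \<open>slack\<close> is what
  the proof of \<open>group_bound\<close> leaves over when the smaller one of the two other parameters is 0.
\<close>
definition "slack be ga = 5/2 * ga - 2 * ga\<^sup>2 + be\<^sup>2 * (1 + ga - 2 * ga\<^sup>2) + be * (4 * ga\<^sup>2 - 2 * ga)" for be ga :: real
definition "deficit be ga = (1 - be)\<^sup>2 + (3/2 - 2 * ga + 3 * be * ga)" for be ga :: real

lemma deficit_nonneg: 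
  assumes "0 \<le> be" "be \<le> 1" "0 \<le> ga" "ga \<le> 1" shows "0 \<le> deficit be ga"
proof -
  have "deficit be ga = (1 - ga) * ((1 - be)\<^sup>2 + 3/2) + ga * (1/2 + be + be\<^sup>2)"
    unfolding deficit_def by algebra
  thus ?thesis using assms by (simp add: add_nonneg_nonneg)
qed

lemma deficit_le_slack:
  assumes "0 \<le> be" "be \<le> 1" "0 \<le> ga" "ga \<le> 1" shows "ga * deficit be ga \<le> slack be ga"
proof -
  have "slack be ga - ga * deficit be ga = be\<^sup>2 * (1 - ga\<^sup>2) + be * ga\<^sup>2 * (1 - be)"
    unfolding deficit_def slack_def by algebra
  moreover have "0 \<le> be\<^sup>2 * (1 - ga\<^sup>2) + be * ga\<^sup>2 * (1 - be)"
    using assms by (intro add_nonneg_nonneg mult_nonneg_nonneg) (auto simp: power_le_one)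
  ultimately show ?thesis by linarith
qed

lemma slack_sum_ge:
  assumes "0 \<le> be" "be \<le> 1" "0 \<le> ga" "ga \<le> 1" 
  shows "5/2 * be * ga * (be + ga) \<le> ga * slack be ga + be * slack ga be"
proof -
  have "ga * slack be ga + be * slack ga be - 5/2 * be * ga * (be + ga) = 5/2*(be^2+ga^2) - 2*(be^3+ga^3) - 7/2*be*ga*(be+ga) + 2*be^2*ga^2*(1-be-ga) + 4*be*ga*(be^2+ga^2)"
    unfolding slack_def by algebra
  with slack_polynomial_nonneg[OF assms] show ?thesis by linarith
qed

lemma group_bound_neg:
  fixes u be ga x z :: real
  assumes "0 \<le> u" "0 \<le> be" "be \<le> 1" "0 \<le> ga" "ga \<le> 1" and xz: "0 < x" "0 < z"
  defines "t \<equiv> be * (be - 2 * ga + 2 * u + (be * ga - u * (be + ga)))"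
  shows "z^2 * x * slack be ga - u * x^2 * z * deficit be ga
      \<le> z^2 * x * (5/2 * ga + t) + z * x^2 * (- 5/2 * u + t) + (be + u)\<^sup>2 * x^3 / 2"
proof -
  define c where "c = 2 * ga * (1 - be)"
  have "0 \<le> x / 2 * (c * z - (be + u) * x)\<^sup>2 + z^2 * x * (be * u * (2 - be - ga)) + z * x^2 * (be\<^sup>2 * (1 - ga))"
    using assms by (intro add_nonneg_nonneg mult_nonneg_nonneg) auto
  also have "\<dots> = z^2 * x * (5/2 * ga + t) + z * x^2 * (- 5/2 * u + t) + (be + u)\<^sup>2 * x^3 / 2 - 
     (z^2 * x * slack be ga - u * x^2 * z * deficit be ga)"
    unfolding c_def t_def slack_def deficit_def by algebra
  finally show ?thesis by simp
qed

text \<open>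
  The condition on \<open>norm_e5\<close> bounds \<open>V = u x\<close> by \<open>be ga y z / (ga z + be y)\<close>.  This is small enough for the deficits of
  the two groups of \<open>y\<^sup>3\<close> and \<open>z\<^sup>3\<close> to be paid by their slacks, and for the remaining term with \<open>V y z\<close> to be
  paid by what is left of both.
\<close>
lemma norm_inequality_neg:
  fixes x y z u be ga :: real
  assumes pos: "0 < x" "0 < y" "0 < z" "0 \<le> u" and be: "0 < be" "be \<le> 1" and ga: "0 < ga" "ga \<le> 1"
    and norm_e5: "0 \<le> norm_e5 x y z (-u) be ga"
  shows "0 \<le> norm_gain x y z (-u) be ga" 
    "0 \<le> norm_gain x y z (-u) be ga * norm_e3 x y z (-u) be ga - norm_e5 x y z (-u) be ga * (x+y+z) * weight_total x y z + 5/2 * (x*y*z) * norm_gain x y z (-u) be ga"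
proof -
  define w where "w = ga * z + be * y"
  define V where "V = u * x"
  define Z where "Z = y^2 * z^2 / w"
  have w: "0 < w" unfolding w_def using assms by (simp add: add_pos_pos)
  have Z: "0 \<le> Z" "Z * w = y^2 * z^2" unfolding Z_def using w by auto
  have V: "0 \<le> V" "V * w \<le> be * ga * y * z" unfolding V_def w_def using assms 
    by (auto simp: norm_e5_def algebra_simps)
  have Zy: "ga * Z \<le> z * y^2" "be * Z \<le> y * z^2"
  proof -
    have "ga * Z * w \<le> z * y^2 * w" "be * Z * w \<le> y * z^2 * w"
      using Z assms by (auto simp: mult.assoc) (auto simp: w_def power2_eq_square algebra_simps)
    thus "ga * Z \<le> z * y^2" "be * Z \<le> y * z^2" using w by auto
  qed
  have V1: "V * y^2 \<le> ga * (z * y^2 - ga * Z)"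
  proof -
    have "V * w * y^2 \<le> be * ga * y * z * y^2" using V by (intro mult_right_mono) auto
    also have "\<dots> = ga * (z * y^2 * w - ga * (Z * w))" unfolding Z(2) by (simp add: w_def algebra_simps power2_eq_square)
    finally have "V * y^2 * w \<le> ga * (z * y^2 - ga * Z) * w" by (simp add: algebra_simps)
    thus ?thesis using w by simp
  qed
  have V2: "V * z^2 \<le> be * (y * z^2 - be * Z)"
  proof -
    have "V * w * z^2 \<le> be * ga * y * z * z^2" using V by (intro mult_right_mono) auto
    also have "\<dots> = be * (y * z^2 * w - be * (Z * w))" unfolding Z(2) by (simp add: w_def algebra_simps power2_eq_square)
    finally have "V * z^2 * w \<le> be * (y * z^2 - be * Z) * w" by (simp add: algebra_simps)
    thus ?thesis using w by simp
  qed
  have V3: "V * (y * z) \<le> be * ga * Z"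
  proof -
    have "V * w * (y * z) \<le> be * ga * y * z * (y * z)" using V pos by (intro mult_right_mono) auto
    also have "\<dots> = be * ga * (Z * w)" unfolding Z(2) by (simp add: w_def algebra_simps power2_eq_square)
    finally have "V * (y * z) * w \<le> be * ga * Z * w" by (simp add: algebra_simps)
    thus ?thesis using w by simp
  qed
  have V3': "V * (y * z) * (be + ga) \<le> be * ga * Z * (be + ga)"
    using V3 be ga by (intro mult_right_mono) auto
  have "0 \<le> be^2 * (1 - ga) + ga^2 * (1 - be)" using be ga by simp
  moreover have "0 \<le> be^2 * ga + ga^2 * be" using be ga by simp
  ultimately have bg: "be * ga * (be + ga) \<le> be^2 + ga^2" by (simp add: algebra_simps power2_eq_square)
  have "be * ga * (be + ga) * Z \<le> (be^2 + ga^2) * Z" using bg Z(1) by (rule mult_right_mono)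
  hence "V * y^2 + V * z^2 + V * (y * z) * (be + ga) \<le> ga * z * y^2 + be * y * z^2"
    using V1 V2 V3' by (simp add: algebra_simps power2_eq_square)
  moreover have "0 \<le> be * y * x^2 + ga * z * x^2 + x * y * z * be * ga" using pos be ga by simp
  ultimately show k: "0 \<le> norm_gain x y z (-u) be ga" 
    unfolding norm_gain_def V_def by (simp add: algebra_simps)
  have K1: "V * y^2 * deficit be ga \<le> slack be ga * (z * y^2 - ga * Z)"
  proof -
    have "V * y^2 * deficit be ga \<le> ga * (z * y^2 - ga * Z) * deficit be ga"
      using V1 deficit_nonneg be ga by (intro mult_right_mono) auto
    also have "\<dots> = (ga * deficit be ga) * (z * y^2 - ga * Z)" by simp
    also have "\<dots> \<le> slack be ga * (z * y^2 - ga * Z)"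
      using deficit_le_slack be ga Zy by (intro mult_right_mono) auto
    finally show ?thesis .
  qed
  have K2: "V * z^2 * deficit ga be \<le> slack ga be * (y * z^2 - be * Z)"
  proof -
    have "V * z^2 * deficit ga be \<le> be * (y * z^2 - be * Z) * deficit ga be"
      using V2 deficit_nonneg be ga by (intro mult_right_mono) auto
    also have "\<dots> = (be * deficit ga be) * (y * z^2 - be * Z)" by simp
    also have "\<dots> \<le> slack ga be * (y * z^2 - be * Z)"
      using deficit_le_slack be ga Zy by (intro mult_right_mono) auto
    finally show ?thesis .
  qed
  have sum4: "0 \<le> (b - a) + (d - c) + (f - e) + 5/2 * (h - g)" if "a \<le> b" "c \<le> d" "e \<le> f" "g \<le> h" for a b c d e f g h :: real
    using that by simp
  have "5/2 * be * ga * (be + ga) * Z \<le> (ga * slack be ga + be * slack ga be) * Z"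
    using slack_sum_ge be ga Z by (intro mult_right_mono) auto
  hence "0 \<le> (slack be ga * (z * y^2 - ga * Z) - V * y^2 * deficit be ga) + (slack ga be * (y * z^2 - be * Z) - V * z^2 * deficit ga be)
     + ((ga * slack be ga + be * slack ga be) * Z - 5/2 * be * ga * (be + ga) * Z)
     + 5/2 * (be * ga * Z * (be + ga) - V * (y * z) * (be + ga))"
    by (rule sum4[OF K1 K2 _ V3'])
  also have "\<dots> = y^2 * z * slack be ga + z^2 * y * slack ga be - V * (y^2 * deficit be ga + z^2 * deficit ga be + 5/2 * (y * z) * (be + ga))"
    by (simp add: field_simps)
  finally have "0 \<le> y^2 * z * slack be ga + z^2 * y * slack ga be - V * (y^2 * deficit be ga + z^2 * deficit ga be + 5/2 * (y * z) * (be + ga))" .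
  hence F: "0 \<le> x * y * z * (y^2 * z * slack be ga + z^2 * y * slack ga be - V * (y^2 * deficit be ga + z^2 * deficit ga be + 5/2 * (y * z) * (be + ga)))"
    using pos by simp
  have G1: "y^3 * (z^2 * x * slack be ga - u * x^2 * z * deficit be ga)
      \<le> y^3 * (z^2 * x * (5/2 * ga + be * (be - 2 * ga + 2 * u + (be * ga - u * (be + ga)))) + z * x^2 * (- 5/2 * u + be * (be - 2 * ga + 2 * u + (be * ga - u * (be + ga)))) + (be + u)\<^sup>2 * x^3 / 2)"
    using group_bound_neg[of u be ga x z] assms by (intro mult_left_mono) auto
  have G2: "z^3 * (y^2 * x * slack ga be - u * x^2 * y * deficit ga be)
      \<le> z^3 * (y^2 * x * (5/2 * be + ga * (ga - 2 * be + 2 * u + (ga * be - u * (ga + be)))) + y * x^2 * (- 5/2 * u + ga * (ga - 2 * be + 2 * u + (ga * be - u * (ga + be)))) + (ga + u)\<^sup>2 * x^3 / 2)"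
    using group_bound_neg[of u ga be x y] assms by (intro mult_left_mono) auto
  have "0 \<le> be * (1 - ga) + ga + be + u * (be + ga)" using assms by (intro add_nonneg_nonneg mult_nonneg_nonneg) auto
  hence H: "0 \<le> x^3 * y * z * (y * (5/2 * be + u * (u + be + ga + (be * (1 - ga) + ga + u * (be + ga)))) + z * (5/2 * ga + u * (u + be + ga + (be * (1 - ga) + ga + u * (be + ga)))))
     + x^3 * ((u + be)\<^sup>2 * y^3 / 2 + (u + ga)\<^sup>2 * z^3 / 2) + (be - ga)\<^sup>2 * y^3 * z^3 + 5/2 * (x*y*z)^2 * be * ga"
    using assms by (intro add_nonneg_nonneg mult_nonneg_nonneg divide_nonneg_nonneg) auto
  have "norm_gain x y z (-u) be ga * norm_e3 x y z (-u) be ga - norm_e5 x y z (-u) be ga * (x+y+z) * weight_total x y z + 5/2 * (x*y*z) * norm_gain x y z (-u) be ga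
    = x^3 * y * z * (y * (5/2 * be + u * (u + be + ga + (be * (1 - ga) + ga + u * (be + ga)))) + z * (5/2 * ga + u * (u + be + ga + (be * (1 - ga) + ga + u * (be + ga)))))
     + x^3 * ((u + be)\<^sup>2 * y^3 / 2 + (u + ga)\<^sup>2 * z^3 / 2) + (be - ga)\<^sup>2 * y^3 * z^3 + 5/2 * (x*y*z)^2 * be * ga
     + y^3 * (z^2 * x * (5/2 * ga + be * (be - 2 * ga + 2 * u + (be * ga - u * (be + ga)))) + z * x^2 * (- 5/2 * u + be * (be - 2 * ga + 2 * u + (be * ga - u * (be + ga)))) + (be + u)\<^sup>2 * x^3 / 2)
     + z^3 * (y^2 * x * (5/2 * be + ga * (ga - 2 * be + 2 * u + (ga * be - u * (ga + be)))) + y * x^2 * (- 5/2 * u + ga * (ga - 2 * be + 2 * u + (ga * be - u * (ga + be)))) + (ga + u)\<^sup>2 * x^3 / 2)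
     - 5/2 * x * y^2 * z^2 * V * (be + ga)"
    unfolding norm_gain_def norm_e3_def norm_e5_def weight_total_def V_def by (simp add: algebra_simps power2_eq_square power3_eq_cube)
  moreover have "x * y * z * (y^2 * z * slack be ga + z^2 * y * slack ga be - V * (y^2 * deficit be ga + z^2 * deficit ga be + 5/2 * (y * z) * (be + ga)))
    = y^3 * (z^2 * x * slack be ga - u * x^2 * z * deficit be ga) + z^3 * (y^2 * x * slack ga be - u * x^2 * y * deficit ga be) - 5/2 * x * y^2 * z^2 * V * (be + ga)"
    unfolding V_def by algebra
  ultimately show "0 \<le> norm_gain x y z (-u) be ga * norm_e3 x y z (-u) be ga - norm_e5 x y z (-u) be ga * (x+y+z) * weight_total x y z + 5/2 * (x*y*z) * norm_gain x y z (-u) be ga"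
    using F G1 G2 H by linarith
qed


text \<open>
  Since \<open>norm_gain \<le> 3/2 weight_total\<close>, the difference is at least \<open>weight_total\<close> times the
  expression of the previous lemmas; this is where the factor \<open>5/2 = 4 - 3/2\<close> comes from.
\<close>
theorem odd_discriminant:
  fixes x y z a b c :: real
  assumes pos: "0 < x" "0 < y" "0 < z" and b: "0 < b" "4 * b \<le> y^2" and c: "0 < c" "4 * c \<le> z^2" and a: "4 * a \<le> x^2"
    and R: "0 \<le> a \<or> 0 \<le> odd_e5 x y z a b c"
  shows "odd_e5 x y z a b c * (x + y + z) * (weight_total x y z)^2 \<le> weighted_gain x y z a b c * (weight_total x y z * odd_e3 x y z a b c - weighted_gain x y z a b c)"
proof -
  define al be ga where "al = 4 * a / x^2" and "be = 4 * b / y^2" and "ga = 4 * c / z^2"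
  have abc: "a = al * x^2 / 4" "b = be * y^2 / 4" "c = ga * z^2 / 4" 
    unfolding al_def be_def ga_def using pos by auto
  have al: "al \<le> 1" and be: "0 < be" "be \<le> 1" and ga: "0 < ga" "ga \<le> 1"
    unfolding al_def be_def ga_def using pos a b c by auto
  define P where "P = weight_total x y z"
  define k where "k = norm_gain x y z al be ga"
  define C where "C = norm_e3 x y z al be ga"
  define r where "r = norm_e5 x y z al be ga"
  define q where "q = x * y * z"
  have q: "0 < q" unfolding q_def using pos by simp
  have *: "0 \<le> k \<and> 0 \<le> k * C - r * (x+y+z) * P + 5/2 * q * k"
  proof (cases "0 \<le> al")
    case True
    show ?thesis unfolding k_def C_def r_def P_def q_def 
      using norm_inequality_nonneg[of x y z al be ga] pos True al be ga by auto
  next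
    case False
    have "\<not> 0 \<le> a" using False pos unfolding abc(1) by (simp add: zero_le_mult_iff)
    hence "0 \<le> q / 16 * r" using R norm_substitution(3)[of x y z al be ga] unfolding abc q_def r_def by auto
    hence "0 \<le> r" using q by (simp add: zero_le_mult_iff)
    thus ?thesis unfolding k_def C_def r_def P_def q_def
      using norm_inequality_neg[of x y z "- al" be ga] pos False be ga by simp
  qed
  have P: "6 * q \<le> P"
  proof -
    have "P - 6 * q = x * (y - z)^2 + y * (x - z)^2 + z * (x - y)^2"
      unfolding P_def q_def weight_total_def by algebra
    moreover have "0 \<le> \<dots>" using pos by simp
    ultimately show ?thesis by linarith
  qed
  have "k \<le> P + 3 * q"
  proof -
    have "al * (x * (y^2+z^2)) \<le> 1 * (x * (y^2+z^2))" "be * (y * (x^2+z^2)) \<le> 1 * (y * (x^2+z^2))" "ga * (z * (x^2+y^2)) \<le> 1 * (z * (x^2+y^2))"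
      using pos al be ga by (intro mult_right_mono; simp)+
    moreover have "q * (al*be+be*ga+ga*al) \<le> q * 3"
    proof -
      have "be * ga \<le> 1" using be ga by (simp add: mult_le_one)
      moreover have "al * (be + ga) \<le> 1 * (be + ga)" using al be ga by (intro mult_right_mono) auto
      ultimately have "al*be+be*ga+ga*al \<le> 3" using be ga by (simp add: algebra_simps)
      thus ?thesis using q by simp
    qed
    ultimately show ?thesis unfolding k_def P_def norm_gain_def weight_total_def q_def by (simp add: algebra_simps)
  qed
  hence "k \<le> 3/2 * P" using P by linarith
  hence "0 \<le> q * k * (3/2 * P - k)" using * q by simp
  moreover have "0 \<le> P * (k * C - r * (x+y+z) * P + 5/2 * q * k)" using * P q by simp
  ultimately have "0 \<le> q / 16 * (q * k * (3/2 * P - k) + P * (k * C - r * (x+y+z) * P + 5/2 * q * k))"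
    using q by simp
  also have "\<dots> = (q / 4 * k) * ((4 * P * q + P * C - q * k) / 4) - q / 16 * r * (x + y + z) * P^2"
    by (simp add: field_simps power2_eq_square)
  finally have "q / 16 * r * (x + y + z) * P^2 \<le> (q / 4 * k) * ((4 * P * q + P * C - q * k) / 4)" by simp
  moreover note norm_substitution[of x y z al be ga, folded abc k_def P_def C_def r_def q_def]
  ultimately show ?thesis unfolding P_def[symmetric] by (simp only:)
qed

text \<open>
  With \<open>X = weighted_gain / weight_total\<close>, \<open>odd_discriminant\<close> says \<open>(X - e1) (X - e5) \<le> 0\<close> for \<open>e1 = x + y + z\<close> and
  \<open>e5 = odd_e5\<close>.
\<close>
lemma weighted_gain_ge:
  fixes x y z a b c :: real
  assumes pos: "0 < x" "0 < y" "0 < z" and b: "0 < b" "4 * b \<le> y^2" and c: "0 < c" "4 * c \<le> z^2" and a: "4 * a \<le> x^2"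
    and R: "0 < odd_e5 x y z a b c"
    and E: "odd_e3 x y z a b c = x + y + z + odd_e5 x y z a b c" and le: "odd_e5 x y z a b c \<le> x + y + z"
  shows "weight_total x y z * odd_e5 x y z a b c \<le> weighted_gain x y z a b c"
proof (rule ccontr)
  define P where "P = weight_total x y z"
  define K where "K = weighted_gain x y z a b c"
  define r where "r = odd_e5 x y z a b c"
  have P: "0 < P" unfolding P_def weight_total_def using pos by (simp add: add_pos_pos)
  assume "\<not> ?thesis"
  hence 1: "K < P * r" unfolding P_def K_def r_def by simp
  have "P * r \<le> P * (x + y + z)" using P le unfolding r_def by simp
  with 1 have 2: "K < P * (x + y + z)" by linarith
  have "0 < (P * r - K) * (P * (x + y + z) - K)" using 1 2 by simp
  also have "\<dots> = r * (x + y + z) * P^2 - K * (P * (x + y + z + r) - K)" by algebra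
  also have "\<dots> \<le> 0" using odd_discriminant[OF pos b c a disjI2[OF less_imp_le[OF R]]]
    unfolding E P_def r_def K_def by simp
  finally show False by simp
qed

lemma some_matching_gains:
  fixes x y z a b c :: real
  assumes pos: "0 < x" "0 < y" "0 < z" and le: "weight_total x y z * odd_e5 x y z a b c \<le> weighted_gain x y z a b c"
  shows "(y + z) * odd_e5 x y z a b c \<le> x * (y * c + z * b) + 4 * b * c \<or>
         (x + z) * odd_e5 x y z a b c \<le> y * (x * c + z * a) + 4 * a * c \<or>
         (x + y) * odd_e5 x y z a b c \<le> z * (x * b + y * a) + 4 * a * b"
proof (rule ccontr)
  assume neg: "\<not> ?thesis"
  define r where "r = odd_e5 x y z a b c"
  have "0 < x^2 * ((y + z) * r - (x * (y * c + z * b) + 4 * b * c))" 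
    "0 < y^2 * ((x + z) * r - (y * (x * c + z * a) + 4 * a * c))"
    "0 < z^2 * ((x + y) * r - (z * (x * b + y * a) + 4 * a * b))"
    using neg pos unfolding r_def by simp_all
  hence "0 < x^2 * ((y + z) * r - (x * (y * c + z * b) + 4 * b * c)) + 
    y^2 * ((x + z) * r - (y * (x * c + z * a) + 4 * a * c)) + z^2 * ((x + y) * r - (z * (x * b + y * a) + 4 * a * b))"
    by linarith
  also have "\<dots> = weight_total x y z * r - weighted_gain x y z a b c"
    unfolding weight_total_def weighted_gain_def by (simp add: algebra_simps power2_eq_square)
  finally show False using le unfolding r_def by simp
qed

section \<open>Six cotangents of angles with given sum\<close>

text \<open>
  The condition under which the test function of the matching with the pair \<open>x\<close> of uncut edges
  has nonpositive energy, provided that \<open>odd_e5\<close> is positive.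
\<close>
definition good :: "real \<Rightarrow> real \<Rightarrow> real \<Rightarrow> real \<Rightarrow> real \<Rightarrow> real \<Rightarrow> bool" where
  "good x y z a b c \<longleftrightarrow> (y + z) * odd_e5 x y z a b c \<le> x * (y * c + z * b) + 4 * b * c"

text \<open>
  The factor \<open>(1 + i cot p) (1 + i cot p')\<close> is, up to the positive factor \<open>1 / (sin p sin p')\<close>, the unit complex number
  of argument \<open>\<pi> - (p + p')\<close>.  The product of the three factors therefore is real, which is the first equation.
  The second one comes from the derivative of the argument of \<open>\<Prod> (1 + i \<tau> cot p)\<close> at \<open>\<tau> = 1\<close>.
\<close>
lemma cot_angle_identities:
  fixes p1 p2 q1 q2 r1 r2 :: real
  assumes sin: "0 < sin p1" "0 < sin p2" "0 < sin q1" "0 < sin q2" "0 < sin r1" "0 < sin r2"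
    and sum: "p1 + p2 + q1 + q2 + r1 + r2 = 2 * pi"
  defines "x \<equiv> cot p1 + cot p2" and "y \<equiv> cot q1 + cot q2" and "z \<equiv> cot r1 + cot r2"
    and "a \<equiv> cot p1 * cot p2" and "b \<equiv> cot q1 * cot q2" and "c \<equiv> cot r1 * cot r2"
  shows "odd_e3 x y z a b c = x + y + z + odd_e5 x y z a b c"
    and "4 * (x + y + z - odd_e5 x y z a b c) * ((sin p1 * sin p2) * (sin q1 * sin q2) * (sin r1 * sin r2)) =
      sin (2 * p1) + sin (2 * p2) + sin (2 * q1) + sin (2 * q2) + sin (2 * r1) + sin (2 * r2)"
proof -
  \<comment> \<open>After multiplication with these factors everything is a sine or a cosine of a sum or a difference.\<close>
  define S1 S2 S3 where "S1 = sin p1 * sin p2" and "S2 = sin q1 * sin q2" and "S3 = sin r1 * sin r2"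
  have S: "0 < S1" "0 < S2" "0 < S3" unfolding S1_def S2_def S3_def using sin by auto
  have x: "x * S1 = sin (p1 + p2)" "y * S2 = sin (q1 + q2)" "z * S3 = sin (r1 + r2)"
    unfolding x_def y_def z_def S1_def S2_def S3_def cot_def sin_add using sin by (auto simp: field_simps)
  have a: "a * S1 = cos p1 * cos p2" "b * S2 = cos q1 * cos q2" "c * S3 = cos r1 * cos r2"
    unfolding a_def b_def c_def S1_def S2_def S3_def cot_def using sin by (auto simp: field_simps)
  define X Y Z where "X = x * S1" and "Y = y * S2" and "Z = z * S3"
  define C1 C2 C3 where "C1 = (1 - a) * S1" and "C2 = (1 - b) * S2" and "C3 = (1 - c) * S3"
  define D1 D2 D3 where "D1 = (1 + a) * S1" and "D2 = (1 + b) * S2" and "D3 = (1 + c) * S3"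
  have C: "C1 = - cos (p1 + p2)" "C2 = - cos (q1 + q2)" "C3 = - cos (r1 + r2)"
    unfolding C1_def C2_def C3_def left_diff_distrib a by (simp_all add: S1_def S2_def S3_def cos_add)
  have D: "D1 = cos (p1 - p2)" "D2 = cos (q1 - q2)" "D3 = cos (r1 - r2)"
    unfolding D1_def D2_def D3_def distrib_right a by (simp_all add: S1_def S2_def S3_def cos_diff)
  have "sin ((p1 + p2) + ((q1 + q2) + (r1 + r2))) = 0" using sum by (simp add: algebra_simps)
  hence "X * C2 * C3 + Y * C1 * C3 + Z * C1 * C2 - X * Y * Z = 0"
    unfolding X_def Y_def Z_def x C by (simp only: sin_add[of "p1 + p2"] sin_add[of "q1 + q2"] cos_add[of "q1 + q2"]) (simp add: algebra_simps)
  hence "(S1 * S2 * S3) * (odd_e3 x y z a b c - (x + y + z + odd_e5 x y z a b c)) = 0"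
    unfolding X_def Y_def Z_def C1_def C2_def C3_def odd_e3_def odd_e5_def by (simp add: algebra_simps)
  thus "odd_e3 x y z a b c = x + y + z + odd_e5 x y z a b c" using S by simp
  have sw: "sin ((q1 + q2) + (r1 + r2)) = - X" "sin ((p1 + p2) + (r1 + r2)) = - Y" "sin ((p1 + p2) + (q1 + q2)) = - Z"
  proof -
    have "(q1 + q2) + (r1 + r2) = 2 * pi - (p1 + p2)" "(p1 + p2) + (r1 + r2) = 2 * pi - (q1 + q2)" "(p1 + p2) + (q1 + q2) = 2 * pi - (r1 + r2)"
      using sum by linarith+
    thus "sin ((q1 + q2) + (r1 + r2)) = - X" "sin ((p1 + p2) + (r1 + r2)) = - Y" "sin ((p1 + p2) + (q1 + q2)) = - Z"
      unfolding X_def Y_def Z_def x by (simp_all only: sin_2pi_minus)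
  qed
  have sx: "Y * C3 + Z * C2 = X" "X * C3 + Z * C1 = Y" "X * C2 + Y * C1 = Z"
    using sw unfolding C sin_add[of "q1 + q2"] sin_add[of "p1 + p2"] X_def Y_def Z_def x by (simp_all add: algebra_simps)
  have pr: "sin (2 * u) + sin (2 * v) = 2 * (sin (u + v) * cos (u - v))" for u v :: real
  proof -
    have "2 * u = (u + v) + (u - v)" "2 * v = (u + v) - (u - v)" by simp_all
    thus ?thesis by (simp only: sin_add[of "u + v"] sin_diff[of "u + v"])
  qed
  have "4 * (x + y + z - odd_e5 x y z a b c) * (S1 * S2 * S3) 
     = 2 * (D1 * (Y * C3 + Z * C2) + D2 * (X * C3 + Z * C1) + D3 * (X * C2 + Y * C1))"
    unfolding X_def Y_def Z_def C1_def C2_def C3_def D1_def D2_def D3_def odd_e5_def by (simp add: algebra_simps)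
  also have "\<dots> = 2 * (sin (p1 + p2) * cos (p1 - p2)) + 2 * (sin (q1 + q2) * cos (q1 - q2)) + 2 * (sin (r1 + r2) * cos (r1 - r2))"
    unfolding sx unfolding D X_def Y_def Z_def x by (simp add: algebra_simps)
  also have "\<dots> = sin (2 * p1) + sin (2 * p2) + sin (2 * q1) + sin (2 * q2) + sin (2 * r1) + sin (2 * r2)"
    unfolding pr[symmetric] by simp
  finally show "4 * (x + y + z - odd_e5 x y z a b c) * ((sin p1 * sin p2) * (sin q1 * sin q2) * (sin r1 * sin r2)) =
      sin (2 * p1) + sin (2 * p2) + sin (2 * q1) + sin (2 * q2) + sin (2 * r1) + sin (2 * r2)"
    unfolding S1_def S2_def S3_def .
qed

lemma abs_sin_add: "\<bar>sin (u + v)\<bar> \<le> \<bar>sin u\<bar> + \<bar>sin v :: real\<bar>"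
proof -
  have "\<bar>sin (u + v)\<bar> \<le> \<bar>sin u\<bar> * \<bar>cos v\<bar> + \<bar>cos u\<bar> * \<bar>sin v\<bar>"
    unfolding sin_add by (metis abs_mult abs_triangle_ineq)
  also have "\<dots> \<le> \<bar>sin u\<bar> * 1 + 1 * \<bar>sin v\<bar>" by (intro add_mono mult_left_mono mult_right_mono) auto
  finally show ?thesis by simp
qed

lemma cot_pos: "0 < t \<Longrightarrow> t < pi / 2 \<Longrightarrow> 0 < cot (t :: real)"
  unfolding cot_def by (intro divide_pos_pos cos_gt_zero sin_gt_zero) auto

text \<open>
  The five other terms \<open>sin (2 p)\<close> are nonnegative, and the exceptional one is minus the sine of their sum.
  So the sum of the six is nonnegative, which says \<open>odd_e5 \<le> x + y + z\<close>.
\<close>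
lemma good_exceptional:
  fixes p1 p2 q1 q2 r1 r2 :: real
  assumes p1: "0 < p1" "p1 < pi"
    and acute: "0 < p2" "p2 < pi/2" "0 < q1" "q1 < pi/2" "0 < q2" "q2 < pi/2" "0 < r1" "r1 < pi/2" "0 < r2" "r2 < pi/2"
    and sum: "p1 + p2 + q1 + q2 + r1 + r2 = 2 * pi"
  defines "x \<equiv> cot p1 + cot p2" and "y \<equiv> cot q1 + cot q2" and "z \<equiv> cot r1 + cot r2"
    and "a \<equiv> cot p1 * cot p2" and "b \<equiv> cot q1 * cot q2" and "c \<equiv> cot r1 * cot r2"
  assumes R: "0 < odd_e5 x y z a b c"
  shows "good x y z a b c \<or> good y x z b a c \<or> good z x y c a b"
proof -
  have sin: "0 < sin p1" "0 < sin p2" "0 < sin q1" "0 < sin q2" "0 < sin r1" "0 < sin r2"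
    using p1 acute by (auto intro!: sin_gt_zero)
  have cot: "0 < cot p2" "0 < cot q1" "0 < cot q2" "0 < cot r1" "0 < cot r2"
    using acute by (auto intro!: cot_pos)
  have yz: "0 < y" "0 < z" "0 < b" "0 < c" unfolding y_def z_def b_def c_def using cot by auto
  have x: "0 < x"
  proof (rule ccontr)
    assume "\<not> 0 < x"
    hence "x \<le> 0" "cot p1 < 0" unfolding x_def using cot by auto
    hence "a < 0" unfolding a_def using cot by (simp add: mult_neg_pos)
    have "odd_e5 x y z a b c = x * (b * c) + a * (y * c + z * b)" unfolding odd_e5_def by (simp add: algebra_simps)
    moreover have "x * (b * c) \<le> 0" using \<open>x \<le> 0\<close> yz by (simp add: mult_nonpos_nonneg)
    moreover have "a * (y * c + z * b) < 0" using \<open>a < 0\<close> yz by (intro mult_neg_pos) (auto intro: add_pos_pos)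
    ultimately show False using R by linarith
  qed
  have amgm: "4 * (u * v) \<le> (u + v)\<^sup>2" for u v :: real
  proof -
    have "(u + v)\<^sup>2 - 4 * (u * v) = (u - v)\<^sup>2" by (simp add: power2_eq_square algebra_simps)
    thus ?thesis by (metis diff_ge_0_iff_ge zero_le_power2)
  qed
  note id = cot_angle_identities[OF sin sum, folded x_def y_def z_def a_def b_def c_def]
  have sin2: "0 \<le> sin (2 * t)" if "0 < t" "t < pi/2" for t using that by (intro sin_ge_zero) auto
  \<comment> \<open>The doubled angles have the sum \<open>4 \<pi>\<close>.\<close>
  have e: "2 * p1 = - (2 * p2 + (2 * q1 + (2 * q2 + (2 * r1 + 2 * r2)))) + 2 * pi + 2 * pi" using sum by simp
  have "sin (2 * p1) = - sin (2 * p2 + (2 * q1 + (2 * q2 + (2 * r1 + 2 * r2))))" by (simp only: e sin_periodic sin_minus)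
  hence "\<bar>sin (2 * p1)\<bar> \<le> sin (2 * p2) + (sin (2 * q1) + (sin (2 * q2) + (sin (2 * r1) + sin (2 * r2))))"
    using abs_sin_add[of "2 * p2" "2 * q1 + (2 * q2 + (2 * r1 + 2 * r2))"] abs_sin_add[of "2 * q1" "2 * q2 + (2 * r1 + 2 * r2)"]
      abs_sin_add[of "2 * q2" "2 * r1 + 2 * r2"] abs_sin_add[of "2 * r1" "2 * r2"]
      sin2[OF acute(1,2)] sin2[OF acute(3,4)] sin2[OF acute(5,6)] sin2[OF acute(7,8)] sin2[OF acute(9,10)] by linarith
  hence "0 \<le> 4 * (x + y + z - odd_e5 x y z a b c) * ((sin p1 * sin p2) * (sin q1 * sin q2) * (sin r1 * sin r2))"
    unfolding id(2) by linarith
  moreover have "0 < (sin p1 * sin p2) * (sin q1 * sin q2) * (sin r1 * sin r2)" using sin by simp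
  ultimately have "odd_e5 x y z a b c \<le> x + y + z" by (simp add: zero_le_mult_iff)
  hence "weight_total x y z * odd_e5 x y z a b c \<le> weighted_gain x y z a b c"
    using amgm by (intro weighted_gain_ge x yz R id(1)) (auto simp: x_def y_def z_def a_def b_def c_def)
  from some_matching_gains[OF x yz(1,2) this] show ?thesis
    unfolding good_def odd_e5_def by (simp add: algebra_simps)
qed

lemma good_matching_exists:
  fixes p1 p2 q1 q2 r1 r2 :: real
  assumes ang: "\<forall>t\<in>{p1,p2,q1,q2,r1,r2}. 0 < t \<and> t < pi"
    and one: "(\<forall>t\<in>{p2,q1,q2,r1,r2}. t < pi/2) \<or> (\<forall>t\<in>{p1,q1,q2,r1,r2}. t < pi/2) \<or> (\<forall>t\<in>{p1,p2,q2,r1,r2}. t < pi/2) \<or>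
       (\<forall>t\<in>{p1,p2,q1,r1,r2}. t < pi/2) \<or> (\<forall>t\<in>{p1,p2,q1,q2,r2}. t < pi/2) \<or> (\<forall>t\<in>{p1,p2,q1,q2,r1}. t < pi/2)"
    and sum: "p1 + p2 + q1 + q2 + r1 + r2 = 2 * pi"
  defines "x \<equiv> cot p1 + cot p2" and "y \<equiv> cot q1 + cot q2" and "z \<equiv> cot r1 + cot r2"
    and "a \<equiv> cot p1 * cot p2" and "b \<equiv> cot q1 * cot q2" and "c \<equiv> cot r1 * cot r2"
  assumes R: "0 < odd_e5 x y z a b c"
  shows "good x y z a b c \<or> good y x z b a c \<or> good z x y c a b"
proof -
  have sw: "good x z y a c b = good x y z a b c" for x y z a b c
    unfolding good_def odd_e5_def by (simp add: algebra_simps)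
  have Rsw: "odd_e5 y x z b a c = odd_e5 x y z a b c" "odd_e5 z x y c a b = odd_e5 x y z a b c" for x y z a b c
    unfolding odd_e5_def by (simp_all add: algebra_simps)
  have ab: "x = cot p2 + cot p1" "y = cot q2 + cot q1" "z = cot r2 + cot r1" 
    "a = cot p2 * cot p1" "b = cot q2 * cot q1" "c = cot r2 * cot r1"
    unfolding x_def y_def z_def a_def b_def c_def by simp_all
  note d = x_def y_def z_def a_def b_def c_def
  from one show ?thesis
  proof (elim disjE)
    assume "\<forall>t\<in>{p2,q1,q2,r1,r2}. t < pi/2"
    thus ?thesis using good_exceptional[of p1 p2 q1 q2 r1 r2] ang sum R by (simp add: d[symmetric])
  next
    assume "\<forall>t\<in>{p1,q1,q2,r1,r2}. t < pi/2"
    thus ?thesis using good_exceptional[of p2 p1 q1 q2 r1 r2] ang sum R by (simp add: d[symmetric] ab[symmetric])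
  next
    assume "\<forall>t\<in>{p1,p2,q2,r1,r2}. t < pi/2"
    thus ?thesis using good_exceptional[of q1 q2 p1 p2 r1 r2] ang sum R 
      by (simp add: d[symmetric] ab[symmetric] Rsw(1)[of y x z b a c] sw[of z y x c b a]) blast
  next
    assume "\<forall>t\<in>{p1,p2,q1,r1,r2}. t < pi/2"
    thus ?thesis using good_exceptional[of q2 q1 p1 p2 r1 r2] ang sum R 
      by (simp add: d[symmetric] ab[symmetric] Rsw(1)[of y x z b a c] sw[of z y x c b a]) blast
  next
    assume "\<forall>t\<in>{p1,p2,q1,q2,r2}. t < pi/2"
    thus ?thesis using good_exceptional[of r1 r2 p1 p2 q1 q2] ang sum R 
      by (simp add: d[symmetric] ab[symmetric] Rsw(2) sw[of x z y a c b] sw[of y z x b c a]) blast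
  next
    assume "\<forall>t\<in>{p1,p2,q1,q2,r1}. t < pi/2"
    thus ?thesis using good_exceptional[of r2 r1 p1 p2 q1 q2] ang sum R 
      by (simp add: d[symmetric] ab[symmetric] Rsw(2) sw[of x z y a c b] sw[of y z x b c a]) blast
  qed
qed

section \<open>Test functions\<close>

context metric_graph begin

lemma nonpositive_planeI:
  assumes "\<And>c d. (\<And>p. p \<in> nodes \<Longrightarrow> c * g p + d * h p = 0) \<Longrightarrow> c = 0 \<and> d = 0"
    and "energy_form k g g \<le> 0" "energy_form k h h \<le> 0" "energy_form k g h = 0"
  shows "nonpositive_plane k"
  unfolding nonpositive_plane_def
proof (rule exI[of _ g], rule exI[of _ h], intro conjI)
  show "\<forall>c d. (\<forall>p\<in>nodes. c * g p + d * h p = 0) \<longrightarrow> c = 0 \<and> d = 0"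
    by (intro allI impI, rule assms(1)) blast
  show "(energy_form k g h)\<^sup>2 \<le> energy_form k g g * energy_form k h h"
    using assms(2-4) by (simp add: mult_nonpos_nonpos)
qed (fact assms)+

definition half_cot :: "real \<Rightarrow> 'b \<Rightarrow> real" where
  "half_cot k e = cot (k * l e / 2)"

text \<open>
  A wave on \<open>e\<close> is \<open>(n cos (k (t - l / 2)) + d sin (k (t - l / 2))) / sin (k l / 2)\<close>.  In contrast to the
  end values, the numbers \<open>n\<close> and \<open>d\<close> also describe the waves on an edge of length \<open>\<pi> / k\<close>, where the values at the two ends
  are opposite.
\<close>
definition assemble :: "real \<Rightarrow> ('a \<Rightarrow> real) \<Rightarrow> ('b \<Rightarrow> real) \<Rightarrow> ('b \<Rightarrow> real) \<Rightarrow> 'a + 'b \<times> nat \<Rightarrow> real" where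
  "assemble k u n d p = (case p of Inl v \<Rightarrow> u v | Inr (e, m) \<Rightarrow> 
     wave k (n e * half_cot k e - d e) (n e + d e * half_cot k e) (real m * (l e / 4)))"

lemma wave_ends:
  assumes "sin (k * L / 2) \<noteq> 0" 
  defines "s \<equiv> cot (k * L / 2)"
  shows "wave k (n * s - d) (n + d * s) 0 = n * s - d" "wave k (n * s - d) (n + d * s) L = n * s + d"
    "wave' k (n * s - d) (n + d * s) 0 = k * (n + d * s)" "wave' k (n * s - d) (n + d * s) L = k * (d * s - n)"
proof -
  define y where "y = k * L / 2"
  have kL: "k * L = 2 * y" unfolding y_def by simp
  have sy: "sin y \<noteq> 0" using assms(1) unfolding y_def .
  have sc: "s * sin y = cos y" unfolding s_def y_def[symmetric] cot_def using sy by simp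
  have c2: "cos (2 * y) = 1 - 2 * (sin y * sin y)" unfolding cos_double_sin by (simp add: power2_eq_square)
  have s2: "sin (2 * y) = 2 * (sin y * (s * sin y))" unfolding sin_double sc by simp
  have ss: "sin y * sin y + (s * sin y) * (s * sin y) = 1" unfolding sc using sin_cos_squared_add3[of y] by (simp add: add.commute)
  have ss': "s * s * (sin y * sin y) = 1 - sin y * sin y" using ss by (simp add: algebra_simps)
  show "wave k (n * s - d) (n + d * s) 0 = n * s - d" "wave' k (n * s - d) (n + d * s) 0 = k * (n + d * s)"
    unfolding wave_def wave'_def by simp_all
  have "wave k (n * s - d) (n + d * s) L = n * s - d + 2 * d * (sin y * sin y) + 2 * d * (s * s * (sin y * sin y))"
    unfolding wave_def kL c2 s2 by (simp add: algebra_simps)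
  thus "wave k (n * s - d) (n + d * s) L = n * s + d" unfolding ss' by (simp add: algebra_simps)
  have "wave' k (n * s - d) (n + d * s) L = k * (n + d * s - 2 * n * (sin y * sin y) - 2 * n * (s * s * (sin y * sin y)))"
    unfolding wave'_def kL c2 s2 by (simp add: algebra_simps)
  thus "wave' k (n * s - d) (n + d * s) L = k * (d * s - n)" unfolding ss' by (simp add: algebra_simps)
qed

lemma energy_form_assemble_left:
  assumes short: "short k" "0 < k" and two_pi: "\<And>e. e \<in> arcs G \<Longrightarrow> k * l e < 2 * pi"
    and u: "\<And>e. e \<in> arcs G \<Longrightarrow> u (tail G e) = n e * half_cot k e - d e \<and> u (head G e) = n e * half_cot k e + d e"
  shows "energy_form k (assemble k u n d) g = (\<Sum>e\<in>arcs G. k * (d e * half_cot k e - n e) * g (Inl (head G e)) - k * (n e + d e * half_cot k e) * g (Inl (tail G e)))"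
proof -
  have s: "sin (k * l e / 2) \<noteq> 0" if "e \<in> arcs G" for e
  proof -
    have "0 < sin (k * l e / 2)" using two_pi[OF that] length_pos[OF that] short(2) by (intro sin_gt_zero) auto
    thus ?thesis by simp
  qed
  show ?thesis unfolding energy_form_def
  proof (intro sum.cong refl)
    fix e assume e: "e \<in> arcs G"
    note w = wave_ends[OF s[OF e], of "n e" "d e", folded half_cot_def]
    have "assemble k u n d (node e m) = wave k (n e * half_cot k e - d e) (n e + d e * half_cot k e) (real m * (l e / 4))" if "m \<le> 4" for m
      using u[OF e] w unfolding assemble_def node_def by auto
    from edge_form_wave[OF short e this, of g]
    show "edge_form k e (assemble k u n d) g = k * (d e * half_cot k e - n e) * g (Inl (head G e)) - k * (n e + d e * half_cot k e) * g (Inl (tail G e))"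
      unfolding w by simp
  qed
qed

lemma energy_form_assemble:
  assumes short: "short k" "0 < k" and two_pi: "\<And>e. e \<in> arcs G \<Longrightarrow> k * l e < 2 * pi"
    and u: "\<And>e. e \<in> arcs G \<Longrightarrow> u (tail G e) = n e * half_cot k e - d e \<and> u (head G e) = n e * half_cot k e + d e"
    and u': "\<And>e. e \<in> arcs G \<Longrightarrow> u' (tail G e) = n' e * half_cot k e - d' e \<and> u' (head G e) = n' e * half_cot k e + d' e"
  shows "energy_form k (assemble k u n d) (assemble k u' n' d') = 2 * k * (\<Sum>e\<in>arcs G. half_cot k e * (d e * d' e - n e * n' e))"
proof -
  have "energy_form k (assemble k u n d) (assemble k u' n' d') = (\<Sum>e\<in>arcs G. k * (d e * half_cot k e - n e) * assemble k u' n' d' (Inl (head G e)) - k * (n e + d e * half_cot k e) * assemble k u' n' d' (Inl (tail G e)))"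
    by (rule energy_form_assemble_left; fact)
  also have "\<dots> = 2 * k * (\<Sum>e\<in>arcs G. half_cot k e * (d e * d' e - n e * n' e))"
    unfolding sum_distrib_left by (intro sum.cong refl) (simp add: assemble_def u' algebra_simps)
  finally show ?thesis .
qed

text \<open>
  The values at the quarter points.  The energy is that of a path with three inner nodes, so \<open>(1, sqrt 2, 1)\<close> and \<open>(1, 0, -1)\<close>
  are multiples of samples of the first two sine functions of the edge.
\<close>
definition bump :: "'b \<Rightarrow> real \<Rightarrow> real \<Rightarrow> real \<Rightarrow> 'a + 'b \<times> nat \<Rightarrow> real" where
  "bump e a b c p = (if p = Inr (e, 1) then a else if p = Inr (e, 2) then b else if p = Inr (e, 3) then c else 0)"

lemma energy_form_assemble_bump:
  assumes "short k" "0 < k" "\<And>e. e \<in> arcs G \<Longrightarrow> k * l e < 2 * pi"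
    "\<And>e. e \<in> arcs G \<Longrightarrow> u (tail G e) = n e * half_cot k e - d e \<and> u (head G e) = n e * half_cot k e + d e"
  shows "energy_form k (assemble k u n d) (bump e a b c) = 0"
proof -
  have "energy_form k (assemble k u n d) (bump e a b c) = (\<Sum>e'\<in>arcs G. k * (d e' * half_cot k e' - n e') * bump e a b c (Inl (head G e')) - k * (n e' + d e' * half_cot k e') * bump e a b c (Inl (tail G e')))"
    by (rule energy_form_assemble_left; fact)
  thus ?thesis by (simp add: bump_def)
qed

lemma bump_other_edge: "e' \<noteq> e \<Longrightarrow> bump e a b c (node e' m) = 0"
  by (auto simp: bump_def node_def)

lemma edge_form_zero: 
  assumes "\<And>m. m \<le> 4 \<Longrightarrow> g (node e m) = 0" shows "edge_form k e h g = 0"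
  unfolding edge_form_def using assms by (intro sum.neutral) (auto simp: piece_form_def)

lemma energy_form_bump_disjoint:
  assumes "e \<noteq> e'" shows "energy_form k (bump e a b c) (bump e' a' b' c') = 0"
  unfolding energy_form_def
proof (intro sum.neutral ballI)
  fix e'' assume "e'' \<in> arcs G"
  show "edge_form k e'' (bump e a b c) (bump e' a' b' c') = 0"
  proof (cases "e'' = e'")
    case True
    hence "e'' \<noteq> e" using assms by auto
    thus ?thesis using bump_other_edge[of e'' e] by (subst edge_form_sym) (intro edge_form_zero, auto)
  next
    case False
    thus ?thesis using bump_other_edge[of e'' e'] by (intro edge_form_zero) auto
  qed
qed

lemma energy_form_bump:
  assumes short: "short k" "0 < k" and e: "e \<in> arcs G"
  shows "energy_form k (bump e a b c) (bump e a' b' c') = 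
    k / sin (k * (l e / 4)) * (2 * cos (k * (l e / 4)) * (a * a' + b * b' + c * c') - (a * b' + a' * b + b * c' + b' * c))"
proof -
  have s: "k \<noteq> 0" "sin (k * (l e / 4)) \<noteq> 0" using short_sin[OF short e] short(2) by auto
  have "energy_form k (bump e a b c) (bump e a' b' c') = (\<Sum>e'\<in>arcs G. if e' = e then edge_form k e (bump e a b c) (bump e a' b' c') else 0)"
    unfolding energy_form_def using bump_other_edge by (intro sum.cong) (auto intro!: edge_form_zero)
  also have "\<dots> = edge_form k e (bump e a b c) (bump e a' b' c')" using e by simp
  also have "\<dots> = k / sin (k * (l e / 4)) * (2 * cos (k * (l e / 4)) * (a * a' + b * b' + c * c') - (a * b' + a' * b + b * c' + b' * c))"
    unfolding edge_form_def piece_form_explicit[OF s]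
    by (simp add: numeral_eq_Suc node_def bump_def algebra_simps add_divide_distrib)
  finally show ?thesis .
qed

lemma energy_form_bump_nonpos:
  assumes "short k" "0 < k" "e \<in> arcs G"
  shows "pi \<le> k * l e \<Longrightarrow> energy_form k (bump e 1 (sqrt 2) 1) (bump e 1 (sqrt 2) 1) \<le> 0"
    and "2 * pi \<le> k * l e \<Longrightarrow> energy_form k (bump e 1 0 (-1)) (bump e 1 0 (-1)) \<le> 0"
proof -
  have s: "0 < sin (k * (l e / 4))" using short_sin[OF assms] .
  have lt: "k * (l e / 4) < pi" using assms unfolding short_def by auto
  assume "pi \<le> k * l e"
  hence "cos (k * (l e / 4)) \<le> cos (pi / 4)" using lt by (intro cos_monotone_0_pi_le) auto
  hence "8 * cos (k * (l e / 4)) - 4 * sqrt 2 \<le> 0" by (simp add: cos_45)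
  hence "k / sin (k * (l e / 4)) * (8 * cos (k * (l e / 4)) - 4 * sqrt 2) \<le> 0"
    using s assms(2) by (intro mult_nonneg_nonpos) auto
  thus "energy_form k (bump e 1 (sqrt 2) 1) (bump e 1 (sqrt 2) 1) \<le> 0"
    unfolding energy_form_bump[OF assms] by (simp add: mult.commute)
next
  have s: "0 < sin (k * (l e / 4))" using short_sin[OF assms] .
  have lt: "k * (l e / 4) < pi" using assms unfolding short_def by auto
  assume "2 * pi \<le> k * l e"
  hence "cos (k * (l e / 4)) \<le> cos (pi / 2)" using lt by (intro cos_monotone_0_pi_le) auto
  hence "k / sin (k * (l e / 4)) * (4 * cos (k * (l e / 4))) \<le> 0"
    using s assms(2) by (intro mult_nonneg_nonpos) auto
  thus "energy_form k (bump e 1 0 (-1)) (bump e 1 0 (-1)) \<le> 0"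
    unfolding energy_form_bump[OF assms] by simp
qed

lemma bump_simps: "bump e a b c (Inl v) = 0" "bump e a b c (Inr (e, 1)) = a" "bump e a b c (Inr (e, Suc 0)) = a" "bump e a b c (Inr (e, 2)) = b"
  by (auto simp: bump_def)

lemma inner_node: "e \<in> arcs G \<Longrightarrow> Inr (e, 1) \<in> nodes" "e \<in> arcs G \<Longrightarrow> Inr (e, 2) \<in> nodes" "v \<in> verts G \<Longrightarrow> Inl v \<in> nodes"
  by (auto simp: nodes_def)

lemma plane_two_long_edges:
  assumes "short k" "0 < k" "e \<in> arcs G" "e' \<in> arcs G" "e \<noteq> e'" "pi \<le> k * l e" "pi \<le> k * l e'"
  shows "nonpositive_plane k"
proof (rule nonpositive_planeI[where g = "bump e 1 (sqrt 2) 1" and h = "bump e' 1 (sqrt 2) 1"])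
  fix c d assume *: "\<And>p. p \<in> nodes \<Longrightarrow> c * bump e 1 (sqrt 2) 1 p + d * bump e' 1 (sqrt 2) 1 p = 0"
  show "c = 0 \<and> d = 0"
    using *[OF inner_node(1)[OF assms(3)]] *[OF inner_node(1)[OF assms(4)]] assms(5) by (auto simp: bump_def)
qed (use assms energy_form_bump_nonpos energy_form_bump_disjoint in auto)

lemma plane_very_long_edge:
  assumes "short k" "0 < k" "e \<in> arcs G" "2 * pi \<le> k * l e"
  shows "nonpositive_plane k"
proof (rule nonpositive_planeI[where g = "bump e 1 (sqrt 2) 1" and h = "bump e 1 0 (-1)"])
  fix c d assume *: "\<And>p. p \<in> nodes \<Longrightarrow> c * bump e 1 (sqrt 2) 1 p + d * bump e 1 0 (-1) p = 0"
  show "c = 0 \<and> d = 0"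
    using *[OF inner_node(1)[OF assms(3)]] *[OF inner_node(2)[OF assms(3)]] by (auto simp: bump_simps)
next
  have "pi \<le> k * l e" using assms(4) pi_gt_zero by linarith
  thus "energy_form k (bump e 1 (sqrt 2) 1) (bump e 1 (sqrt 2) 1) \<le> 0" by (rule energy_form_bump_nonpos(1)[OF assms(1-3)])
  show "energy_form k (bump e 1 0 (-1)) (bump e 1 0 (-1)) \<le> 0" by (rule energy_form_bump_nonpos(2)[OF assms])
  show "energy_form k (bump e 1 (sqrt 2) 1) (bump e 1 0 (-1)) = 0" by (simp add: energy_form_bump[OF assms(1-3)])
qed

text \<open>
  A bump vanishes at the ends of its edge, so it is orthogonal to all waves.
\<close>
lemma plane_assemble_bump:
  assumes short: "short k" "0 < k" and two_pi: "\<And>e. e \<in> arcs G \<Longrightarrow> k * l e < 2 * pi"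
    and u: "\<And>e. e \<in> arcs G \<Longrightarrow> u (tail G e) = n e * half_cot k e - d e \<and> u (head G e) = n e * half_cot k e + d e"
    and v: "v \<in> verts G" "u v \<noteq> 0" and np: "k * (\<Sum>e\<in>arcs G. half_cot k e * ((d e)\<^sup>2 - (n e)\<^sup>2)) \<le> 0"
    and e: "e \<in> arcs G" "pi \<le> k * l e"
  shows "nonpositive_plane k"
proof (rule nonpositive_planeI[where g = "assemble k u n d" and h = "bump e 1 (sqrt 2) 1"])
  fix a b assume *: "\<And>p. p \<in> nodes \<Longrightarrow> a * assemble k u n d p + b * bump e 1 (sqrt 2) 1 p = 0"
  have "a * u v = 0" using *[OF inner_node(3)[OF v(1)]] by (simp add: bump_simps assemble_def)
  hence "a = 0" using v by simp
  thus "a = 0 \<and> b = 0" using *[OF inner_node(1)[OF e(1)]] by (simp add: bump_simps)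
next
  show "energy_form k (assemble k u n d) (assemble k u n d) \<le> 0"
    using np energy_form_assemble[of k u n d u n d, OF short two_pi u u] by (simp add: power2_eq_square mult.assoc)
  show "energy_form k (assemble k u n d) (bump e 1 (sqrt 2) 1) = 0"
    by (rule energy_form_assemble_bump; fact)
qed (use energy_form_bump_nonpos(1)[OF short e] in auto)

lemma plane_assemble_two:
  assumes short: "short k" "0 < k" and two_pi: "\<And>e. e \<in> arcs G \<Longrightarrow> k * l e < 2 * pi"
    and u: "\<And>e. e \<in> arcs G \<Longrightarrow> u (tail G e) = n e * half_cot k e - d e \<and> u (head G e) = n e * half_cot k e + d e"
    and u': "\<And>e. e \<in> arcs G \<Longrightarrow> u' (tail G e) = n' e * half_cot k e - d' e \<and> u' (head G e) = n' e * half_cot k e + d' e"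
    and ind: "\<And>a b. (\<And>v. v \<in> verts G \<Longrightarrow> a * u v + b * u' v = 0) \<Longrightarrow> a = 0 \<and> b = 0" 
    and np: "k * (\<Sum>e\<in>arcs G. half_cot k e * ((d e)\<^sup>2 - (n e)\<^sup>2)) \<le> 0" "k * (\<Sum>e\<in>arcs G. half_cot k e * ((d' e)\<^sup>2 - (n' e)\<^sup>2)) \<le> 0"
    and orth: "(\<Sum>e\<in>arcs G. half_cot k e * (d e * d' e - n e * n' e)) = 0"
  shows "nonpositive_plane k"
proof (rule nonpositive_planeI[where g = "assemble k u n d" and h = "assemble k u' n' d'"])
  fix a b assume *: "\<And>p. p \<in> nodes \<Longrightarrow> a * assemble k u n d p + b * assemble k u' n' d' p = 0"
  show "a = 0 \<and> b = 0"
  proof (rule ind)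
    fix v assume "v \<in> verts G"
    thus "a * u v + b * u' v = 0" using *[OF inner_node(3)] by (simp add: assemble_def)
  qed
next
  show "energy_form k (assemble k u n d) (assemble k u n d) \<le> 0"
    using np energy_form_assemble[of k u n d u n d, OF short two_pi u u] by (simp add: power2_eq_square mult.assoc)
  show "energy_form k (assemble k u' n' d') (assemble k u' n' d') \<le> 0"
    using np energy_form_assemble[of k u' n' d' u' n' d', OF short two_pi u' u'] by (simp add: power2_eq_square mult.assoc)
  show "energy_form k (assemble k u n d) (assemble k u' n' d') = 0"
    using orth energy_form_assemble[of k u n d u' n' d', OF short two_pi u u'] by simp
qed

end

section \<open>The upper bound for the complete graph on four vertices\<close>

abbreviation K4 :: "(nat, nat \<times> nat) pre_digraph" where "K4 \<equiv> complete_graph 4"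

lemma K4_simps:
  "arcs K4 = {(0,1), (2,3), (0,2), (1,3), (0,3), (1,2)}" "verts K4 = {0, 1, 2, 3}" "tail K4 = fst" "head K4 = snd"
  unfolding complete_graph_def by auto

lemma sum_arcs_K4: "(\<Sum>e\<in>arcs K4. f e) = f (0,1) + f (2,3) + f (0,2) + f (1,3) + f (0,3) + (f (1,2) :: real)"
  unfolding K4_simps by (simp add: add.assoc)

lemma metric_graph_K4:
  assumes "is_metric K4 l" shows "metric_graph K4 l"
proof -
  interpret digraph K4 by (rule digraph_complete_graph)
  show ?thesis
  proof
    show "e \<in> arcs K4 \<Longrightarrow> 0 < l e" for e using assms unfolding is_metric_def by blast
    fix g :: "nat \<Rightarrow> real" and v w assume g: "\<And>e. e \<in> arcs K4 \<Longrightarrow> g (tail K4 e) = g (head K4 e)" and "v \<in> verts K4" "w \<in> verts K4"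
    have "g 0 = g 1" "g 0 = g 2" "g 0 = g 3" using g[of "(0,1)"] g[of "(0,2)"] g[of "(0,3)"] unfolding K4_simps by auto
    thus "g v = g w" using \<open>v \<in> verts K4\<close> \<open>w \<in> verts K4\<close> unfolding K4_simps by auto
  qed (auto simp: K4_simps)
qed

lemma K4_nodes_bij:
  assumes "is_metric K4 l"
  shows "\<exists>\<iota> :: 22 \<Rightarrow> nat + (nat \<times> nat) \<times> nat. bij_betw \<iota> UNIV (metric_graph.nodes K4)"
proof -
  interpret metric_graph K4 l using assms by (rule metric_graph_K4)
  have "nodes = verts K4 <+> arcs K4 \<times> {1..3}" unfolding nodes_def Plus_def ..
  hence "card nodes = card (verts K4) + card (arcs K4 \<times> {1..3::nat})" by (simp add: card_Plus)
  also have "\<dots> = 22" unfolding K4_simps by simp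
  finally show ?thesis using finite_nodes by (intro finite_same_card_bij) auto
qed

text \<open>
  The sum of \<open>s n\<^sup>2\<close> over the six edges for the test function of the matching with the uncut pair \<open>s1, s2\<close>.
\<close>
lemma matching_test_identity:
  fixes s1 s2 t1 t2 r1 r2 :: real
  defines "x \<equiv> s1 + s2" and "y \<equiv> t1 + t2" and "z \<equiv> r1 + r2" and "a \<equiv> s1 * s2" and "b \<equiv> t1 * t2" and "c \<equiv> r1 * r2"
  defines "H \<equiv> y * c + z * b" and "D \<equiv> s1 - s2"
  shows "s1 * (2 * b * c + s2 * H)\<^sup>2 + s2 * (2 * b * c + s1 * H)\<^sup>2 + t1 * (t2 * c * D)\<^sup>2 + t2 * (t1 * c * D)\<^sup>2 + r1 * (r2 * b * D)\<^sup>2 + r2 * (r1 * b * D)\<^sup>2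
    = odd_e5 x y z a b c * (x * H + 4 * b * c)"
proof -
  have "s1 * (2 * b * c + s2 * H)\<^sup>2 + s2 * (2 * b * c + s1 * H)\<^sup>2 = 4 * (b * c)\<^sup>2 * x + 8 * b * c * H * a + a * x * H\<^sup>2"
    unfolding x_def a_def by (simp add: power2_eq_square algebra_simps)
  moreover have "t1 * (t2 * c * D)\<^sup>2 + t2 * (t1 * c * D)\<^sup>2 + r1 * (r2 * b * D)\<^sup>2 + r2 * (r1 * b * D)\<^sup>2 = D\<^sup>2 * (b * c * H)"
    unfolding H_def y_def z_def b_def c_def by (simp add: power2_eq_square algebra_simps)
  moreover have "D\<^sup>2 = x\<^sup>2 - 4 * a" unfolding D_def x_def a_def by (simp add: power2_eq_square algebra_simps)
  moreover have "4 * (b * c)\<^sup>2 * x + 8 * b * c * H * a + a * x * H\<^sup>2 + (x\<^sup>2 - 4 * a) * (b * c * H) = (x * (b * c) + a * H) * (x * H + 4 * b * c)"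
    by (simp add: power2_eq_square algebra_simps)
  moreover have "odd_e5 x y z a b c = x * (b * c) + a * H" unfolding odd_e5_def H_def by (simp add: algebra_simps)
  ultimately show ?thesis by simp
qed

lemma matching_energy_nonpos:
  fixes s1 s2 t1 t2 r1 r2 R :: real
  assumes n: "n1 = 2 * (t1 * t2) * (r1 * r2) + s2 * ((t1 + t2) * (r1 * r2) + (r1 + r2) * (t1 * t2))"
    "n2 = - (2 * (t1 * t2) * (r1 * r2) + s1 * ((t1 + t2) * (r1 * r2) + (r1 + r2) * (t1 * t2)))"
    "n3 = t2 * (r1 * r2) * (s1 - s2)" "n4 = t1 * (r1 * r2) * (s1 - s2)" "n5 = r2 * (t1 * t2) * (s1 - s2)" "n6 = r1 * (t1 * t2) * (s1 - s2)"
    and d: "d1 = 0" "d2 = 0" "d3\<^sup>2 = R\<^sup>2" "d4\<^sup>2 = R\<^sup>2" "d5\<^sup>2 = R\<^sup>2" "d6\<^sup>2 = R\<^sup>2"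
    and R: "R = odd_e5 (s1 + s2) (t1 + t2) (r1 + r2) (s1 * s2) (t1 * t2) (r1 * r2)" "0 < R"
    and good: "good (s1 + s2) (t1 + t2) (r1 + r2) (s1 * s2) (t1 * t2) (r1 * r2)"
  shows "s1 * (d1\<^sup>2 - n1\<^sup>2) + s2 * (d2\<^sup>2 - n2\<^sup>2) + (t1 * (d3\<^sup>2 - n3\<^sup>2) + t2 * (d4\<^sup>2 - n4\<^sup>2)) + (r1 * (d5\<^sup>2 - n5\<^sup>2) + r2 * (d6\<^sup>2 - n6\<^sup>2)) \<le> 0"
    and "n1 + n2 + (n3 + n4) + (n5 + n6) = 0"
proof -
  define Q where "Q = (s1 + s2) * ((t1 + t2) * (r1 * r2) + (r1 + r2) * (t1 * t2)) + 4 * (t1 * t2) * (r1 * r2)"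
  have "s1 * n1\<^sup>2 + s2 * n2\<^sup>2 + t1 * n3\<^sup>2 + t2 * n4\<^sup>2 + r1 * n5\<^sup>2 + r2 * n6\<^sup>2 = R * Q"
    unfolding Q_def R(1) matching_test_identity[symmetric] n power2_minus ..
  moreover have "s1 * (d1\<^sup>2 - n1\<^sup>2) + s2 * (d2\<^sup>2 - n2\<^sup>2) + (t1 * (d3\<^sup>2 - n3\<^sup>2) + t2 * (d4\<^sup>2 - n4\<^sup>2)) + (r1 * (d5\<^sup>2 - n5\<^sup>2) + r2 * (d6\<^sup>2 - n6\<^sup>2))
    = R\<^sup>2 * (t1 + t2 + (r1 + r2)) - (s1 * n1\<^sup>2 + s2 * n2\<^sup>2 + t1 * n3\<^sup>2 + t2 * n4\<^sup>2 + r1 * n5\<^sup>2 + r2 * n6\<^sup>2)"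
    unfolding d by (simp add: algebra_simps)
  ultimately have "s1 * (d1\<^sup>2 - n1\<^sup>2) + s2 * (d2\<^sup>2 - n2\<^sup>2) + (t1 * (d3\<^sup>2 - n3\<^sup>2) + t2 * (d4\<^sup>2 - n4\<^sup>2)) + (r1 * (d5\<^sup>2 - n5\<^sup>2) + r2 * (d6\<^sup>2 - n6\<^sup>2))
    = R * ((t1 + t2 + (r1 + r2)) * R - Q)" by (simp add: power2_eq_square algebra_simps)
  also have "\<dots> \<le> 0" using good R(2) unfolding good_def R(1)[symmetric] Q_def by (intro mult_nonneg_nonpos) auto
  finally show "s1 * (d1\<^sup>2 - n1\<^sup>2) + s2 * (d2\<^sup>2 - n2\<^sup>2) + (t1 * (d3\<^sup>2 - n3\<^sup>2) + t2 * (d4\<^sup>2 - n4\<^sup>2)) + (r1 * (d5\<^sup>2 - n5\<^sup>2) + r2 * (d6\<^sup>2 - n6\<^sup>2)) \<le> 0" .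
  show "n1 + n2 + (n3 + n4) + (n5 + n6) = 0" unfolding n by (simp add: algebra_simps)
qed

text \<open>
  The function that is constant at the vertices is scaled by the product of all \<open>s e\<close>, so that \<open>n\<close> is also defined if one of
  the cotangents is 0.
\<close>
definition const_n :: "(nat \<times> nat \<Rightarrow> real) \<Rightarrow> nat \<times> nat \<Rightarrow> real" where
  "const_n s e = (\<Prod>e'\<in>arcs K4 - {e}. s e')"

text \<open>
  The matching consists of the edges \<open>e1\<close> and \<open>e2\<close>; the other pairs of opposite edges are \<open>f1, f2\<close> and \<open>g1, g2\<close>.  The vertex
  values are \<open>\<plusminus> cot_e5 s\<close>, shifted by the constant that makes the function orthogonal to the one of
  \<open>const_n\<close>.  All data
  are polynomials in the cotangents, because everything is scaled by \<open>cot_e5 s\<close>.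
\<close>
definition matching_n :: "(nat \<times> nat \<Rightarrow> real) \<Rightarrow> nat \<times> nat \<Rightarrow> nat \<times> nat \<Rightarrow> nat \<times> nat \<Rightarrow> nat \<times> nat \<Rightarrow> nat \<times> nat \<Rightarrow> nat \<times> nat \<Rightarrow> nat \<times> nat \<Rightarrow> real" where
  "matching_n s e1 e2 f1 f2 g1 g2 e = (let b = s f1 * s f2; c = s g1 * s g2; H = (s f1 + s f2) * c + (s g1 + s g2) * b; D = s e1 - s e2 in
     if e = e1 then 2 * b * c + s e2 * H else if e = e2 then - (2 * b * c + s e1 * H)
     else if e = f1 then s f2 * c * D else if e = f2 then s f1 * c * D
     else if e = g1 then s g2 * b * D else if e = g2 then s g1 * b * D else 0)"

definition cot_e5 :: "(nat \<times> nat \<Rightarrow> real) \<Rightarrow> real" where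
  "cot_e5 s = odd_e5 (s (0,1) + s (2,3)) (s (0,2) + s (1,3)) (s (0,3) + s (1,2)) (s (0,1) * s (2,3)) (s (0,2) * s (1,3)) (s (0,3) * s (1,2))"

definition matching_u :: "(nat \<times> nat \<Rightarrow> real) \<Rightarrow> nat \<times> nat \<Rightarrow> nat \<times> nat \<Rightarrow> nat \<times> nat \<Rightarrow> nat \<times> nat \<Rightarrow> nat \<times> nat \<Rightarrow> nat \<times> nat \<Rightarrow> nat \<Rightarrow> real" where
  "matching_u s e1 e2 f1 f2 g1 g2 v = (if v = fst e1 \<or> v = snd e1 then cot_e5 s else - cot_e5 s) + (s f1 * s f2) * (s g1 * s g2) * (s e1 - s e2)"

definition matching_d :: "(nat \<times> nat \<Rightarrow> real) \<Rightarrow> nat \<times> nat \<Rightarrow> nat \<times> nat \<Rightarrow> real" where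
  "matching_d s e1 e = ((if snd e = fst e1 \<or> snd e = snd e1 then cot_e5 s else - cot_e5 s) - (if fst e = fst e1 \<or> fst e = snd e1 then cot_e5 s else - cot_e5 s)) / 2"

lemma matching_test_function_case:
  fixes s :: "nat \<times> nat \<Rightarrow> real"
  assumes M: "(e1, e2, f1, f2, g1, g2) \<in> {((0,1), (2,3), (0,2), (1,3), (0,3), (1,2)), ((0,2), (1,3), (0,1), (2,3), (0,3), (1,2)),
      ((0,3), (1,2), (0,1), (2,3), (0,2), (1,3))}"
    and good: "good (s e1 + s e2) (s f1 + s f2) (s g1 + s g2) (s e1 * s e2) (s f1 * s f2) (s g1 * s g2)" and R: "0 < cot_e5 s"
  defines "n \<equiv> matching_n s e1 e2 f1 f2 g1 g2" and "d \<equiv> matching_d s e1" and "u \<equiv> matching_u s e1 e2 f1 f2 g1 g2"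
  shows "\<forall>e\<in>arcs K4. u (fst e) = n e * s e - d e \<and> u (snd e) = n e * s e + d e"
    "(\<Sum>e\<in>arcs K4. s e * ((d e)\<^sup>2 - (n e)\<^sup>2)) \<le> 0" "(\<Sum>e\<in>arcs K4. n e) = 0" 
    "\<exists>v\<in>verts K4. \<exists>w\<in>verts K4. u v \<noteq> u w"
proof -
  have cR: "cot_e5 s = odd_e5 (s e1 + s e2) (s f1 + s f2) (s g1 + s g2) (s e1 * s e2) (s f1 * s f2) (s g1 * s g2)"
    using M by (elim insertE emptyE) (simp_all add: cot_e5_def odd_e5_def algebra_simps)
  define C where "C = (s f1 * s f2) * (s g1 * s g2) * (s e1 - s e2)"
  define sg where "sg v = (if v = fst e1 \<or> v = snd e1 then cot_e5 s else - cot_e5 s)" for v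
  have u: "u v = sg v + C" and d: "d e = (sg (snd e) - sg (fst e)) / 2" for v e
    unfolding u_def matching_u_def d_def matching_d_def sg_def C_def by auto
  have n: "n e1 = 2 * (s f1 * s f2) * (s g1 * s g2) + s e2 * ((s f1 + s f2) * (s g1 * s g2) + (s g1 + s g2) * (s f1 * s f2))"
    "n e2 = - (2 * (s f1 * s f2) * (s g1 * s g2) + s e1 * ((s f1 + s f2) * (s g1 * s g2) + (s g1 + s g2) * (s f1 * s f2)))"
    "n f1 = s f2 * (s g1 * s g2) * (s e1 - s e2)" "n f2 = s f1 * (s g1 * s g2) * (s e1 - s e2)"
    "n g1 = s g2 * (s f1 * s f2) * (s e1 - s e2)" "n g2 = s g1 * (s f1 * s f2) * (s e1 - s e2)"
    using M unfolding n_def matching_n_def Let_def by (elim insertE emptyE; simp)+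
  have ends: "sg (fst e1) = cot_e5 s" "sg (snd e1) = cot_e5 s" "sg (fst e2) = - cot_e5 s" "sg (snd e2) = - cot_e5 s" 
    "sg (snd f1) = - sg (fst f1)" "sg (snd f2) = - sg (fst f2)" "sg (snd g1) = - sg (fst g1)" "sg (snd g2) = - sg (fst g2)"
    using M unfolding sg_def by (elim insertE emptyE; simp)+
  have sq: "(sg v)\<^sup>2 = (cot_e5 s)\<^sup>2" for v unfolding sg_def by simp
  have arcs_K4: "arcs K4 = {e1, e2, f1, f2, g1, g2}" using M unfolding K4_simps by (elim insertE emptyE) auto
  have arcs: "(\<Sum>e\<in>arcs K4. F e) = F e1 + F e2 + (F f1 + F f2) + (F g1 + F g2)" for F :: "nat \<times> nat \<Rightarrow> real"
    unfolding sum_arcs_K4 using M by (elim insertE emptyE) simp_all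
  have "n e1 * s e1 = cot_e5 s + C" "n e2 * s e2 = - cot_e5 s + C" "n f1 * s f1 = C" "n f2 * s f2 = C" "n g1 * s g1 = C" "n g2 * s g2 = C"
    unfolding n C_def cR odd_e5_def by (simp_all add: algebra_simps)
  hence "u (fst e) = n e * s e - d e \<and> u (snd e) = n e * s e + d e" if "e \<in> {e1, e2, f1, f2, g1, g2}" for e
    using that unfolding u d by (elim insertE emptyE) (simp_all add: ends)
  thus "\<forall>e\<in>arcs K4. u (fst e) = n e * s e - d e \<and> u (snd e) = n e * s e + d e" unfolding arcs_K4 by blast
  note energy = matching_energy_nonpos[OF n, of "d e1" "d e2" "d f1" "cot_e5 s" "d f2" "d g1" "d g2", OF _ _ _ _ _ _ cR R good]
  show "(\<Sum>e\<in>arcs K4. s e * ((d e)\<^sup>2 - (n e)\<^sup>2)) \<le> 0"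
    unfolding arcs by (rule energy(1)) (simp_all add: d ends sq)
  show "(\<Sum>e\<in>arcs K4. n e) = 0"
    unfolding arcs by (rule energy(2)) (simp_all add: d ends sq)
  have "e1 \<in> arcs K4" "e2 \<in> arcs K4" unfolding arcs_K4 by auto
  hence "fst e1 \<in> verts K4" "fst e2 \<in> verts K4" unfolding K4_simps by auto
  moreover have "u (fst e1) \<noteq> u (fst e2)" unfolding u using R by (simp add: ends)
  ultimately show "\<exists>v\<in>verts K4. \<exists>w\<in>verts K4. u v \<noteq> u w" by blast
qed

lemma matching_test_function:
  fixes s :: "nat \<times> nat \<Rightarrow> real"
  assumes "good (s (0,1) + s (2,3)) (s (0,2) + s (1,3)) (s (0,3) + s (1,2)) (s (0,1) * s (2,3)) (s (0,2) * s (1,3)) (s (0,3) * s (1,2)) \<or>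
    good (s (0,2) + s (1,3)) (s (0,1) + s (2,3)) (s (0,3) + s (1,2)) (s (0,2) * s (1,3)) (s (0,1) * s (2,3)) (s (0,3) * s (1,2)) \<or>
    good (s (0,3) + s (1,2)) (s (0,1) + s (2,3)) (s (0,2) + s (1,3)) (s (0,3) * s (1,2)) (s (0,1) * s (2,3)) (s (0,2) * s (1,3))"
    and R: "0 < cot_e5 s"
  obtains u n d where "\<forall>e\<in>arcs K4. u (fst e) = n e * s e - d e \<and> u (snd e) = n e * s e + d e"
    "(\<Sum>e\<in>arcs K4. s e * ((d e)\<^sup>2 - (n e)\<^sup>2)) \<le> 0" "(\<Sum>e\<in>arcs K4. n e) = 0" 
    "\<exists>v\<in>verts K4. \<exists>w\<in>verts K4. u v \<noteq> u w"
proof -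
  from assms(1) show thesis
  proof (elim disjE)
    assume good: "good (s (0,1) + s (2,3)) (s (0,2) + s (1,3)) (s (0,3) + s (1,2)) (s (0,1) * s (2,3)) (s (0,2) * s (1,3)) (s (0,3) * s (1,2))"
    show thesis by (rule that; rule matching_test_function_case[OF _ good R]) simp_all
  next
    assume good: "good (s (0,2) + s (1,3)) (s (0,1) + s (2,3)) (s (0,3) + s (1,2)) (s (0,2) * s (1,3)) (s (0,1) * s (2,3)) (s (0,3) * s (1,2))"
    show thesis by (rule that; rule matching_test_function_case[OF _ good R]) simp_all
  next
    assume good: "good (s (0,3) + s (1,2)) (s (0,1) + s (2,3)) (s (0,2) + s (1,3)) (s (0,3) * s (1,2)) (s (0,1) * s (2,3)) (s (0,2) * s (1,3))"
    show thesis by (rule that; rule matching_test_function_case[OF _ good R]) simp_all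
  qed
qed

lemma const_n_identities:
  fixes s :: "nat \<times> nat \<Rightarrow> real"
  shows "e \<in> arcs K4 \<Longrightarrow> const_n s e * s e = (\<Prod>e'\<in>arcs K4. s e')" "(\<Sum>e\<in>arcs K4. const_n s e) = cot_e5 s"
proof -
  have fin: "finite (arcs K4)" unfolding K4_simps by simp
  show "e \<in> arcs K4 \<Longrightarrow> const_n s e * s e = (\<Prod>e'\<in>arcs K4. s e')"
    unfolding const_n_def using prod.remove[OF fin, of e s] by (simp add: mult.commute)
  show "(\<Sum>e\<in>arcs K4. const_n s e) = cot_e5 s"
    unfolding sum_arcs_K4 const_n_def K4_simps cot_e5_def odd_e5_def by (simp add: insert_Diff_if algebra_simps)
qed

lemma total_length_K4: "total_length K4 l = l (0,1) + l (2,3) + l (0,2) + l (1,3) + l (0,3) + l (1,2)"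
  unfolding total_length_def by (rule sum_arcs_K4)

lemma const_n_pos:
  assumes "\<And>e'. e' \<in> arcs K4 \<Longrightarrow> e' \<noteq> e \<Longrightarrow> 0 < s e'" shows "0 < const_n s e"
  unfolding const_n_def using assms by (intro prod_pos) auto

text \<open>
  Without two bumps, and if the polynomial \<open>cot_e5 s\<close> is positive, then a matching function is used, together with the
  bump on the edge of length at least \<open>\<pi> / k\<close> or, if there is none, with the function that is constant at the vertices.
  If the polynomial is not positive, then one cotangent is negative, so there is such an edge, and the
  function that is constant at the vertices has nonpositive energy itself.
\<close>
lemma K4_nonpositive_plane:
  assumes l: "is_metric K4 l"
  defines "k \<equiv> 4 * pi / total_length K4 l"
  shows "0 < k" "metric_graph.short K4 l k" "metric_graph.nonpositive_plane K4 l k"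
proof -
  interpret metric_graph K4 l using l by (rule metric_graph_K4)
  have pos: "0 < l (0,1)" "0 < l (2,3)" "0 < l (0,2)" "0 < l (1,3)" "0 < l (0,3)" "0 < l (1,2)"
    using length_pos unfolding K4_simps by auto
  define L where "L = total_length K4 l"
  have L: "L = l (0,1) + l (2,3) + l (0,2) + l (1,3) + l (0,3) + l (1,2)" unfolding L_def by (rule total_length_K4)
  have L0: "0 < L" unfolding L using pos by simp
  show k: "0 < k" unfolding k_def L_def[symmetric] using L0 by simp
  have kL: "k * L = 4 * pi" unfolding k_def L_def[symmetric] using L0 by simp
  have lt: "l e < L" if "e \<in> arcs K4" for e using that pos unfolding K4_simps L by auto
  show short: "short k" unfolding short_def
  proof
    fix e assume "e \<in> arcs K4"
    hence "k * l e < k * L" using lt k by simp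
    thus "k * (l e / 4) < pi" using kL by simp
  qed
  define s where "s = half_cot k"
  have sum: "k * l (0,1) / 2 + k * l (2,3) / 2 + k * l (0,2) / 2 + k * l (1,3) / 2 + k * l (0,3) / 2 + k * l (1,2) / 2 = 2 * pi"
    using kL unfolding L by (simp add: field_simps)
  show "nonpositive_plane k"
  proof (cases "\<exists>e\<in>arcs K4. 2 * pi \<le> k * l e")
    case True
    thus ?thesis using plane_very_long_edge[OF short k] by blast
  next
    case False
    hence two_pi: "k * l e < 2 * pi" if "e \<in> arcs K4" for e using that by auto
    show ?thesis
    proof (cases "\<exists>e\<in>arcs K4. \<exists>e'\<in>arcs K4. e \<noteq> e' \<and> pi \<le> k * l e \<and> pi \<le> k * l e'")
      case True
      thus ?thesis using plane_two_long_edges[OF short k] by blast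
    next
      case False
      hence one: "\<And>e e'. e \<in> arcs K4 \<Longrightarrow> e' \<in> arcs K4 \<Longrightarrow> pi \<le> k * l e \<Longrightarrow> pi \<le> k * l e' \<Longrightarrow> e = e'" by blast
      have s_pos: "0 < s e" if "e \<in> arcs K4" "\<not> pi \<le> k * l e" for e
        unfolding s_def half_cot_def using that length_pos[of e] k by (intro cot_pos) auto
      define P where "P = (\<Prod>e\<in>arcs K4. s e)"
      have const: "P = const_n s e * s e - 0 \<and> P = const_n s e * s e + 0" if "e \<in> arcs K4" for e
        using const_n_identities(1)[OF that, of s] unfolding P_def by simp
      have const_energy: "(\<Sum>e\<in>arcs K4. s e * (0\<^sup>2 - (const_n s e)\<^sup>2)) = - (P * cot_e5 s)"
      proof -
        have "s e * (0\<^sup>2 - (const_n s e)\<^sup>2) = - (P * const_n s e)" if "e \<in> arcs K4" for e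
          unfolding P_def const_n_identities(1)[OF that, symmetric] by (simp add: power2_eq_square)
        hence "(\<Sum>e\<in>arcs K4. s e * (0\<^sup>2 - (const_n s e)\<^sup>2)) = (\<Sum>e\<in>arcs K4. - (P * const_n s e))" by (intro sum.cong) auto
        thus ?thesis unfolding sum_negf sum_distrib_left[symmetric] const_n_identities(2) .
      qed
      show ?thesis
      proof (cases "0 < cot_e5 s")
        case True
        have good: "good (s (0,1) + s (2,3)) (s (0,2) + s (1,3)) (s (0,3) + s (1,2)) (s (0,1) * s (2,3)) (s (0,2) * s (1,3)) (s (0,3) * s (1,2)) \<or>
          good (s (0,2) + s (1,3)) (s (0,1) + s (2,3)) (s (0,3) + s (1,2)) (s (0,2) * s (1,3)) (s (0,1) * s (2,3)) (s (0,3) * s (1,2)) \<or>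
          good (s (0,3) + s (1,2)) (s (0,1) + s (2,3)) (s (0,2) + s (1,3)) (s (0,3) * s (1,2)) (s (0,1) * s (2,3)) (s (0,2) * s (1,3))"
          unfolding s_def half_cot_def
        proof (rule good_matching_exists)
          show "\<forall>t\<in>{k * l (0,1) / 2, k * l (2,3) / 2, k * l (0,2) / 2, k * l (1,3) / 2, k * l (0,3) / 2, k * l (1,2) / 2}. 0 < t \<and> t < pi"
          proof -
            have "k * l e / 2 < pi" if "e \<in> arcs K4" for e using two_pi[OF that] by simp
            thus ?thesis using pos k unfolding K4_simps by simp
          qed
          have 1: "\<And>e e'. e \<in> arcs K4 \<Longrightarrow> e' \<in> arcs K4 \<Longrightarrow> e \<noteq> e' \<Longrightarrow> k * l e < pi \<or> k * l e' < pi"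
            using one by (meson not_le)
          show "(\<forall>t\<in>{k * l (2,3) / 2, k * l (0,2) / 2, k * l (1,3) / 2, k * l (0,3) / 2, k * l (1,2) / 2}. t < pi / 2) \<or>
            (\<forall>t\<in>{k * l (0,1) / 2, k * l (0,2) / 2, k * l (1,3) / 2, k * l (0,3) / 2, k * l (1,2) / 2}. t < pi / 2) \<or>
            (\<forall>t\<in>{k * l (0,1) / 2, k * l (2,3) / 2, k * l (1,3) / 2, k * l (0,3) / 2, k * l (1,2) / 2}. t < pi / 2) \<or>
            (\<forall>t\<in>{k * l (0,1) / 2, k * l (2,3) / 2, k * l (0,2) / 2, k * l (0,3) / 2, k * l (1,2) / 2}. t < pi / 2) \<or>
            (\<forall>t\<in>{k * l (0,1) / 2, k * l (2,3) / 2, k * l (0,2) / 2, k * l (1,3) / 2, k * l (1,2) / 2}. t < pi / 2) \<or>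
            (\<forall>t\<in>{k * l (0,1) / 2, k * l (2,3) / 2, k * l (0,2) / 2, k * l (1,3) / 2, k * l (0,3) / 2}. t < pi / 2)"
          proof (cases "\<exists>e\<in>arcs K4. pi \<le> k * l e")
            case True
            then obtain e where e: "e \<in> arcs K4" "pi \<le> k * l e" by blast
            have "\<forall>e'\<in>arcs K4. e' \<noteq> e \<longrightarrow> k * l e' < pi" using 1[OF _ e(1)] e(2) by (meson not_le)
            with e(1) show ?thesis unfolding K4_simps by (elim insertE emptyE) simp_all
          next
            case False
            hence "k * l e < pi" if "e \<in> arcs K4" for e using that by auto
            thus ?thesis unfolding K4_simps by simp
          qed
          show "0 < odd_e5 (cot (k * l (0,1) / 2) + cot (k * l (2,3) / 2)) (cot (k * l (0,2) / 2) + cot (k * l (1,3) / 2)) (cot (k * l (0,3) / 2) + cot (k * l (1,2) / 2))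
            (cot (k * l (0,1) / 2) * cot (k * l (2,3) / 2)) (cot (k * l (0,2) / 2) * cot (k * l (1,3) / 2)) (cot (k * l (0,3) / 2) * cot (k * l (1,2) / 2))"
            using True unfolding cot_e5_def s_def half_cot_def .
        qed (rule sum)
        obtain u n d where u: "\<forall>e\<in>arcs K4. u (fst e) = n e * s e - d e \<and> u (snd e) = n e * s e + d e"
          and np: "(\<Sum>e\<in>arcs K4. s e * ((d e)\<^sup>2 - (n e)\<^sup>2)) \<le> 0" and n0: "(\<Sum>e\<in>arcs K4. n e) = 0" 
          and nc: "\<exists>v\<in>verts K4. \<exists>w\<in>verts K4. u v \<noteq> u w"
          using matching_test_function[OF good True] .
        have u': "u (tail K4 e) = n e * half_cot k e - d e \<and> u (head K4 e) = n e * half_cot k e + d e" if "e \<in> arcs K4" for e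
          using u that unfolding s_def K4_simps(3,4) by blast
        have np': "k * (\<Sum>e\<in>arcs K4. half_cot k e * ((d e)\<^sup>2 - (n e)\<^sup>2)) \<le> 0"
          using np k unfolding s_def by (simp add: mult_nonneg_nonpos)
        show ?thesis
        proof (cases "\<exists>e\<in>arcs K4. pi \<le> k * l e")
          case True
          then obtain e where e: "e \<in> arcs K4" "pi \<le> k * l e" by blast
          obtain v where v: "v \<in> verts K4" "u v \<noteq> 0"
          proof -
            obtain a b where "a \<in> verts K4" "b \<in> verts K4" "u a \<noteq> u b" using nc by blast
            thus thesis using that[of a] that[of b] by (cases "u a = 0") auto
          qed
          show ?thesis by (rule plane_assemble_bump[where u = u and n = n and d = d and v = v and e = e]; fact)
        next
          case False
          hence "0 < s e" if "e \<in> arcs K4" for e using s_pos that by auto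
          hence P: "0 < P" unfolding P_def by (intro prod_pos) auto
          show ?thesis
          proof (rule plane_assemble_two[where u = u and n = n and d = d and u' = "\<lambda>_. P" and n' = "const_n s" and d' = "\<lambda>_. 0"])
            show "u (tail K4 e) = n e * half_cot k e - d e \<and> u (head K4 e) = n e * half_cot k e + d e" if "e \<in> arcs K4" for e
              using u'[OF that] .
            show "P = const_n s e * half_cot k e - 0 \<and> P = const_n s e * half_cot k e + 0" if "e \<in> arcs K4" for e
              using const[OF that] unfolding s_def .
            show "k * (\<Sum>e\<in>arcs K4. half_cot k e * ((d e)\<^sup>2 - (n e)\<^sup>2)) \<le> 0" by (rule np')
            show "k * (\<Sum>e\<in>arcs K4. half_cot k e * (0\<^sup>2 - (const_n s e)\<^sup>2)) \<le> 0"
              using const_energy P k \<open>0 < cot_e5 s\<close> unfolding s_def by (simp add: mult_nonneg_nonpos)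
          next
            have "(\<Sum>e\<in>arcs K4. half_cot k e * (d e * 0 - n e * const_n s e)) = (\<Sum>e\<in>arcs K4. - (P * n e))"
            proof (intro sum.cong refl)
              fix e assume "e \<in> arcs K4"
              hence "P = const_n s e * s e" using const by simp
              thus "half_cot k e * (d e * 0 - n e * const_n s e) = - (P * n e)" unfolding s_def by simp
            qed
            thus "(\<Sum>e\<in>arcs K4. half_cot k e * (d e * 0 - n e * const_n s e)) = 0"
              unfolding sum_negf sum_distrib_left[symmetric] n0 by simp
          next
            fix a b assume *: "\<And>v. v \<in> verts K4 \<Longrightarrow> a * u v + b * P = 0"
            obtain v w where vw: "v \<in> verts K4" "w \<in> verts K4" "u v \<noteq> u w" using nc by blast
            have "a * u v = a * u w" using *[OF vw(1)] *[OF vw(2)] by linarith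
            hence "a = 0" using vw(3) by simp
            thus "a = 0 \<and> b = 0" using *[OF vw(1)] P by simp
          qed (fact short k two_pi)+
        qed
      next
        case R: False
        have "\<exists>e\<in>arcs K4. pi \<le> k * l e"
        proof (rule ccontr)
          assume "\<not> ?thesis"
          hence "0 < s e" if "e \<in> arcs K4" for e using s_pos that by auto
          hence "0 < const_n s e" for e by (intro const_n_pos) auto
          hence "0 < (\<Sum>e\<in>arcs K4. const_n s e)" unfolding K4_simps by (intro sum_pos) auto
          thus False using R unfolding const_n_identities(2) by simp
        qed
        then obtain e where e: "e \<in> arcs K4" "pi \<le> k * l e" by blast
        have s': "0 < s e'" if "e' \<in> arcs K4" "e' \<noteq> e" for e' using s_pos[OF that(1)] one[OF that(1) e(1) _ e(2)] that by blast
        have ce: "0 < const_n s e" using s' by (rule const_n_pos)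
        have "cos (k * l e / 2) \<le> cos (pi / 2)" using e two_pi[OF e(1)] by (intro cos_monotone_0_pi_le) auto
        moreover have "0 < sin (k * l e / 2)" using two_pi[OF e(1)] k length_pos[OF e(1)] by (intro sin_gt_zero) auto
        ultimately have se: "s e \<le> 0" unfolding s_def half_cot_def cot_def by (simp add: divide_nonpos_pos)
        have P: "P = const_n s e * s e" using const[OF e(1)] by simp
        hence Pn: "P \<le> 0" using ce se by (simp add: mult_nonneg_nonpos)
        have P0: "P \<noteq> 0"
        proof
          assume P0: "P = 0"
          have "const_n s e' = 0" if "e' \<in> arcs K4" "e' \<noteq> e" for e' using const[OF that(1)] s'[OF that] P0 by simp
          hence "(\<Sum>e'\<in>arcs K4. const_n s e') = (\<Sum>e'\<in>arcs K4. if e' = e then const_n s e else 0)" by (intro sum.cong) auto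
          also have "\<dots> = const_n s e" using e(1) by simp
          finally have "cot_e5 s = const_n s e" unfolding const_n_identities(2) .
          thus False using R ce by simp
        qed
        show ?thesis
        proof (rule plane_assemble_bump[where u = "\<lambda>_. P" and n = "const_n s" and d = "\<lambda>_. 0" and v = 0 and e = e])
          show "P = const_n s e * half_cot k e - 0 \<and> P = const_n s e * half_cot k e + 0" if "e \<in> arcs K4" for e
            using const[OF that] unfolding s_def .
          have "0 \<le> P * cot_e5 s" using Pn R by (simp add: mult_nonpos_nonpos)
          thus "k * (\<Sum>e\<in>arcs K4. half_cot k e * (0\<^sup>2 - (const_n s e)\<^sup>2)) \<le> 0"
            using const_energy k unfolding s_def by (simp add: mult_nonneg_nonpos)
          show "0 \<in> verts K4" unfolding K4_simps by simp
        qed (fact short k two_pi e P0)+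
      qed
    qed
  qed
qed

lemma K4_first_eigenvalue:
  assumes l: "is_metric K4 l"
  shows "eigenvalue 1 K4 l \<le> 16 * pi\<^sup>2 / (total_length K4 l)\<^sup>2" and "2 \<le> eigenvalue_count K4 l (eigenvalue 1 K4 l)"
proof -
  interpret metric_graph K4 l using l by (rule metric_graph_K4)
  obtain \<iota> :: "22 \<Rightarrow> nat + (nat \<times> nat) \<times> nat" where \<iota>: "bij_betw \<iota> UNIV nodes" using K4_nodes_bij[OF l] by blast
  note f = first_eigenvalue[OF \<iota> K4_nonpositive_plane(2)[OF l] K4_nonpositive_plane(1)[OF l] K4_nonpositive_plane(3)[OF l]]
  show "eigenvalue 1 K4 l \<le> 16 * pi\<^sup>2 / (total_length K4 l)\<^sup>2" using f(1) by (simp add: power_divide power_mult_distrib)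
  show "2 \<le> eigenvalue_count K4 l (eigenvalue 1 K4 l)" by (rule f(2))
qed

definition thin_metric :: "real \<Rightarrow> nat \<times> nat \<Rightarrow> real" where
  "thin_metric \<delta> e = (if e = (0,1) \<or> e = (2,3) then \<delta> else 1)"

lemma tan_less_cot:
  assumes "0 < x" "0 < y" "x + y < pi / 2" shows "tan y < cot (x :: real)"
proof -
  have "0 < cos (x + y)" using assms by (intro cos_gt_zero) auto
  moreover have "0 < sin x" "0 < cos y" using assms pi_gt_zero by (auto intro!: sin_gt_zero cos_gt_zero)
  ultimately show ?thesis unfolding tan_def cot_def by (simp add: field_simps cos_add)
qed

text \<open>
  The vertex values are expanded into the constant function and the signs of the three matchings, which
  diagonalise the form because opposite edges have the same length.  The four coefficients do not vanish since
  \<open>tan y < cot x\<close> for \<open>x + y < \<pi> / 2\<close>, used with \<open>x, y\<close> equal to \<open>k / 2\<close> and \<open>k \<delta> / 2\<close> in either order.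
\<close>
lemma thin_metric_eigenvalue:
  assumes \<delta>: "0 < \<delta>" and k: "0 < k" "k * (1 + \<delta>) < pi"
  shows "\<not> is_eigenvalue K4 (thin_metric \<delta>) (k\<^sup>2)"
proof
  define l where "l = thin_metric \<delta>"
  have l: "is_metric K4 l" unfolding is_metric_def l_def thin_metric_def using \<delta> by auto
  interpret metric_graph K4 l using l by (rule metric_graph_K4)
  have kd: "0 < k * \<delta>" using k \<delta> by simp
  have k1: "k + k * \<delta> < pi" using k(2) by (simp add: distrib_left)
  have sin: "0 < sin (k * l e)" for e unfolding l_def thin_metric_def using k kd k1 by (auto intro!: sin_gt_zero)
  assume "is_eigenvalue K4 (thin_metric \<delta>) (k\<^sup>2)"
  then obtain f where f: "f \<in> eigenspace K4 l (k\<^sup>2)" "f \<noteq> 0" unfolding l_def is_eigenvalue_def by blast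
  obtain A B g where fw: "f = extend (\<lambda>e. wave k (A e) (B e))" 
    and ends: "\<And>e. e \<in> arcs K4 \<Longrightarrow> wave k (A e) (B e) 0 = g (tail K4 e) \<and> wave k (A e) (B e) (l e) = g (head K4 e)"
    and K: "\<And>w. (\<Sum>e\<in>arcs K4. wave' k (A e) (B e) (l e) * w (head K4 e) - wave' k (A e) (B e) 0 * w (tail K4 e)) = 0"
    using eigenfunction_wave[OF f(1)] k(1) by blast
  have form: "(\<Sum>e\<in>arcs K4. piece_form k (l e) (g (fst e)) (g (snd e)) (w (fst e)) (w (snd e))) = 0" for w
  proof -
    have "(\<Sum>e\<in>arcs K4. piece_form k (l e) (g (fst e)) (g (snd e)) (w (fst e)) (w (snd e))) = 
       (\<Sum>e\<in>arcs K4. wave' k (A e) (B e) (l e) * w (head K4 e) - wave' k (A e) (B e) 0 * w (tail K4 e))"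
    proof (intro sum.cong refl)
      fix e assume "e \<in> arcs K4"
      thus "piece_form k (l e) (g (fst e)) (g (snd e)) (w (fst e)) (w (snd e)) = wave' k (A e) (B e) (l e) * w (head K4 e) - wave' k (A e) (B e) 0 * w (tail K4 e)"
        using piece_form_wave[of k "l e" "A e" "B e" 0 "w (fst e)" "w (snd e)"] ends[of e] sin[of e] k(1) by (simp add: K4_simps(3,4))
    qed
    thus ?thesis using K by simp
  qed
  define a1 b1 a\<delta> b\<delta> where "a1 = cot_coeff k 1" and "b1 = tan_coeff k 1" and "a\<delta> = cot_coeff k \<delta>" and "b\<delta> = tan_coeff k \<delta>"
  have b: "0 < b1" "0 < b\<delta>" unfolding b1_def b\<delta>_def tan_coeff_def using k kd k1 by (auto intro!: mult_pos_pos tan_gt_zero)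
  have ab: "b\<delta> < a1" "b1 < a\<delta>"
    unfolding a1_def b1_def a\<delta>_def b\<delta>_def tan_coeff_def cot_coeff_def using k kd k1 by (auto intro!: tan_less_cot)
  define S T1 T2 T3 where "S = g 0 + g 1 + g 2 + g 3" and "T1 = g 0 + g 1 - g 2 - g 3" and "T2 = g 0 - g 1 + g 2 - g 3" and "T3 = g 0 - g 1 - g 2 + g 3"
  note form' = form[unfolded sum_arcs_K4 l_def thin_metric_def piece_form_def, simplified, folded a1_def b1_def a\<delta>_def b\<delta>_def]
  have "(2 * b\<delta> + 4 * b1) * S = 0" using form'[of "\<lambda>_. 1"] unfolding S_def by (simp add: algebra_simps)
  hence S: "S = 0" using b by (simp add: add_pos_pos less_imp_neq[symmetric])
  have "(4 * a1 - 2 * b\<delta>) * T1 = 0" using form'[of "\<lambda>v. if v = 0 \<or> v = 1 then 1 else -1"] unfolding T1_def by (simp add: algebra_simps)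
  hence T1: "T1 = 0" using ab b by auto
  have "(2 * a\<delta> + 2 * a1 - 2 * b1) * T2 = 0" using form'[of "\<lambda>v. if v = 0 \<or> v = 2 then 1 else -1"] unfolding T2_def by (simp add: algebra_simps)
  hence T2: "T2 = 0" using ab b by auto
  have "(2 * a\<delta> + 2 * a1 - 2 * b1) * T3 = 0" using form'[of "\<lambda>v. if v = 0 \<or> v = 3 then 1 else -1"] unfolding T3_def by (simp add: algebra_simps)
  hence T3: "T3 = 0" using ab b by auto
  have g: "g 0 = 0" "g 1 = 0" "g 2 = 0" "g 3 = 0" using S T1 T2 T3 unfolding S_def T1_def T2_def T3_def by linarith+
  have "wave k (A e) (B e) t = 0" if "e \<in> arcs K4" for e t
  proof -
    have "g (tail K4 e) = 0" "g (head K4 e) = 0" using that g unfolding K4_simps by auto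
    thus ?thesis using ends[OF that] sin[of e] by (auto simp: wave_def)
  qed
  hence "f = 0" unfolding fw by (simp add: extend_def fun_eq_iff)
  thus False using f by simp
qed

lemma thin_metric_bound:
  assumes C: "\<forall>l. is_metric K4 l \<longrightarrow> eigenvalue 1 K4 l \<le> C / (total_length K4 l)\<^sup>2" and \<delta>: "0 < \<delta>"
  shows "(pi * (4 + 2 * \<delta>) / (1 + \<delta>))\<^sup>2 \<le> C"
proof -
  define l where "l = thin_metric \<delta>"
  have l: "is_metric K4 l" unfolding is_metric_def l_def thin_metric_def using \<delta> by auto
  interpret metric_graph K4 l using l by (rule metric_graph_K4)
  have "(pi / (1 + \<delta>))\<^sup>2 \<le> eigenvalue 1 K4 l"
  proof (rule first_eigenvalue_ge[OF K4_first_eigenvalue(2)[OF l]])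
    fix k assume "0 < k" "k < pi / (1 + \<delta>)"
    thus "\<not> is_eigenvalue K4 l (k\<^sup>2)" unfolding l_def using \<delta> by (intro thin_metric_eigenvalue) (auto simp: pos_less_divide_eq)
  qed (use \<delta> in auto)
  also have "\<dots> \<le> C / (4 + 2 * \<delta>)\<^sup>2"
    using C l unfolding total_length_K4 by (auto simp: l_def thin_metric_def algebra_simps)
  finally have "(pi / (1 + \<delta>))\<^sup>2 * (4 + 2 * \<delta>)\<^sup>2 \<le> C" using \<delta> by (simp add: pos_le_divide_eq)
  thus ?thesis by (simp add: power_divide power_mult_distrib)
qed

theorem theorem1p4:
  shows "Lambda_1 (complete_graph 4) = 16 * pi\<^sup>2"
  unfolding Lambda_1_def
proof (rule Least_equality)
  show "\<forall>l. is_metric K4 l \<longrightarrow> eigenvalue 1 K4 l \<le> 16 * pi\<^sup>2 / (total_length K4 l)\<^sup>2"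
    using K4_first_eigenvalue(1) by blast
  fix C assume C: "\<forall>l. is_metric K4 l \<longrightarrow> eigenvalue 1 K4 l \<le> C / (total_length K4 l)\<^sup>2"
  have "((\<lambda>\<delta>. (pi * (4 + 2 * \<delta>) / (1 + \<delta>))\<^sup>2) \<longlongrightarrow> (pi * (4 + 2 * 0) / (1 + 0))\<^sup>2) (at_right 0)"
    by (intro tendsto_intros) auto
  moreover have "\<forall>\<^sub>F \<delta> in at_right 0. (pi * (4 + 2 * \<delta>) / (1 + \<delta>))\<^sup>2 \<le> C"
    using thin_metric_bound[OF C] eventually_at_right_less[of "0::real"] by (auto elim: eventually_mono)
  ultimately have "(pi * (4 + 2 * 0) / (1 + 0))\<^sup>2 \<le> C"
    by (rule tendsto_upperbound) simp
  thus "16 * pi\<^sup>2 \<le> C" by (simp add: power_mult_distrib)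
qed

end
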